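(* For each sample size $n$, let $\mathcal M_n$ be a finite and non-empty family of models $m$, each satisfying $|m|<n-1$, let $r_n=\sup_{m\in\mathcal M_n}|m|/n$, and define $$a_n=\sqrt{\frac{\log(\#\mathcal M_n+1)}{n(1-r_n)^3}},$$ where $\#\mathcal M_n$ is the number of models in $\mathcal M_n$. Assume that $a_n\to0$ as $n\to\infty$. Let $c>0$ be an arbitrary fixed finite constant. Then $$\sup_{m\in\mathcal M_n}|\mathrm{GCV}(m)-\rho^2(m)|=O_p(a_n)$$ holds uniformly over all parameters $\beta,\sigma,\Sigma$ of the Gaussian linear model described in the context that satisfy $\mathrm{Var}_{\beta,\sigma,\Sigma}[y]\le c$. The same holds with $S_p(m)$ or with $\hat\rho^2(m)$ in place of $\mathrm{GCV}(m)$. All three statements continue to hold if $R^2(m)$ replaces $\rho^2(m)$.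
   Context: Model. A response $y$ satisfies $y=\sum_{j=1}^\infty x_j\beta_j+u$, where $\beta=(\beta_j)_{j\ge1}$ is a real sequence; $u$ has mean zero and variance $\sigma^2\ge0$; the random sequence $x=(x_j)_{j\ge1}$ has mean zero and covariances $\Sigma=[E(x_ix_j)]_{i,j\ge1}$; the series converges in squared mean; each $x_j$ is uncorrelated with $u$; and for all $k\ge1$ and $j_1<\dots<j_k$ the covariance matrix of $(x_{j_1},\dots,x_{j_k})'$ is positive definite. All these random variables ($y$, $u$ and $x_j$, $j\ge1$) are assumed jointly Gaussian. Sample. $(Y,X)$ consists of $n$ i.i.d. copies $(y^{(i)},x^{(i)})$, $i=1,\dots,n$, of $(y,x)$; $P_{n,\beta,\sigma,\Sigma}$ and $E_{n,\beta,\sigma,\Sigma}$ denote the corresponding probability and expectation. $\mathrm{Var}_{\beta,\sigma,\Sigma}[y]$ is the variance of $y$. Models. A model is a 0-1 sequence $m=(m_j)_{j\ge1}$, with $|m|$ the number of ones in $m$ ($|m|=0$ is allowed). The restricted least-squares estimator $\tilde\beta(m)$ has $j$th component zero whenever $m_j=0$; its remaining $|m|$ components are obtained by least-squares regression of $Y=(y^{(1)},\dots,y^{(n)})'$ on the corresponding columns of $X$. The residual sum of squares is $\mathrm{RSS}(m)=\sum_{i=1}^n\bigl(y^{(i)}-x^{(i)\prime}\tilde\beta(m)\bigr)^2$. Prediction errors. Let $(y^{(f)},x^{(f)})$ be a copy of $(y,x)$ independent of $(Y,X)$. The conditional and unconditional mean squared prediction errors are $\rho^2(m)=E_{n,\beta,\sigma,\Sigma}\bigl[(y^{(f)}-x^{(f)\prime}\tilde\beta(m))^2\mid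 Y,X\bigr]$ and $R^2(m)=E_{n,\beta,\sigma,\Sigma}\bigl[(y^{(f)}-x^{(f)\prime}\tilde\beta(m))^2\bigr]$. Criteria. $$\mathrm{GCV}(m)=\frac{\mathrm{RSS}(m)}{n-|m|}\cdot\frac{n}{n-|m|},\quad S_p(m)=\frac{\mathrm{RSS}(m)}{n-|m|}\cdot\frac{n-1}{n-1-|m|},\quad \hat\rho^2(m)=\frac{\mathrm{RSS}(m)}{n-|m|}\cdot\frac{n+1}{n+1-|m|}.$$ Uniform $O_p$. For random variables $T_n$ (functions of the sample and possibly of the parameters), "$T_n=O_p(a_n)$ uniformly over a set of parameters" means $\lim_{K\to\infty}\limsup_{n\to\infty}\sup P_{n,\beta,\sigma,\Sigma}(|T_n|>K a_n)=0$, the supremum being over that set of parameters $(\beta,\sigma,\Sigma)$. *)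

theory Defs
  imports "HOL-Probability.Probability"
begin

section \<open>The Gaussian linear model\<close>

text \<open>Degenerate normal distributions (point masses) are included, since the error variance and
  the coefficients may vanish.\<close>

definition gaussian_rv :: "'a measure \<Rightarrow> ('a \<Rightarrow> real) \<Rightarrow> bool" where
  "gaussian_rv M Z \<longleftrightarrow> Z \<in> borel_measurable M \<and>
     ((\<exists>\<mu>. AE \<omega> in M. Z \<omega> = \<mu>) \<or> (\<exists>\<mu> s. 0 < s \<and> distributed M lborel Z (normal_density \<mu> s)))"

definition jointly_gaussian :: "'a measure \<Rightarrow> ('a \<Rightarrow> real) set \<Rightarrow> bool" where
  "jointly_gaussian M V \<longleftrightarrow>
     (\<forall>F c. finite F \<and> F \<subseteq> V \<longrightarrow> gaussian_rv M (\<lambda>\<omega>. \<Sum>Z\<in>F. c Z * Z \<omega>))"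

text \<open>Sequences indexed by \<open>j \<ge> 1\<close> are indexed by \<open>j \<ge> 0\<close> here. The convergence in squared mean
  is stated with the nonnegative integral, so that no integrability side condition is needed.\<close>

locale gaussian_linear_model = prob_space M
  for M :: "'a measure" +
  fixes y :: "'a \<Rightarrow> real" and x :: "nat \<Rightarrow> 'a \<Rightarrow> real" and u :: "'a \<Rightarrow> real"
    and \<beta> :: "nat \<Rightarrow> real" and \<sigma> :: real and \<Sigma> :: "nat \<Rightarrow> nat \<Rightarrow> real"
  assumes gaussian: "jointly_gaussian M (insert y (insert u (range x)))"
    and u_square_integrable: "integrable M (\<lambda>\<omega>. (u \<omega>)\<^sup>2)"
    and x_square_integrable: "\<And>j. integrable M (\<lambda>\<omega>. (x j \<omega>)\<^sup>2)"
    and sigma_nonneg: "0 \<le> \<sigma>"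
    and u_mean: "expectation u = 0"
    and u_variance: "variance u = \<sigma>\<^sup>2"
    and x_mean: "\<And>j. expectation (x j) = 0"
    and x_covariance: "\<And>i j. expectation (\<lambda>\<omega>. x i \<omega> * x j \<omega>) = \<Sigma> i j"
    and x_u_uncorrelated: "\<And>j. expectation (\<lambda>\<omega>. x j \<omega> * u \<omega>) = expectation (x j) * expectation u"
    and positive_definite: "\<And>J c. \<lbrakk>finite J; \<exists>j\<in>J. c j \<noteq> 0\<rbrakk> \<Longrightarrow>
          0 < (\<Sum>i\<in>J. \<Sum>j\<in>J. c i * \<Sigma> i j * c j)"
    and series: "(\<lambda>N. \<integral>\<^sup>+\<omega>. ennreal ((y \<omega> - u \<omega> - (\<Sum>j<N. x j \<omega> * \<beta> j))\<^sup>2) \<partial>M) \<longlonglongrightarrow> 0"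


section \<open>The sample and a future observation\<close>

type_synonym obs = "real \<times> (nat \<Rightarrow> real)"
type_synonym sample = "nat \<Rightarrow> obs"

definition obs_space :: "obs measure" where
  "obs_space = borel \<Otimes>\<^sub>M (\<Pi>\<^sub>M j\<in>UNIV. borel)"

definition obs_law :: "'a measure \<Rightarrow> ('a \<Rightarrow> real) \<Rightarrow> (nat \<Rightarrow> 'a \<Rightarrow> real) \<Rightarrow> obs measure" where
  "obs_law M y x = distr M obs_space (\<lambda>\<omega>. (y \<omega>, \<lambda>j. x j \<omega>))"

text \<open>Below, \<open>D\<close> is the law of \<open>(y, x)\<close>. The underlying probability space carries the sample
  \<open>(Y, X)\<close>, which consists of \<open>n\<close> independent copies indexed by \<open>i < n\<close>, in the first component,
  and the independent future copy in the second component.\<close>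

definition prediction_space :: "nat \<Rightarrow> obs measure \<Rightarrow> (sample \<times> obs) measure" where
  "prediction_space n D = (\<Pi>\<^sub>M i\<in>{..<n}. D) \<Otimes>\<^sub>M D"

definition sample_algebra :: "nat \<Rightarrow> obs measure \<Rightarrow> (sample \<times> obs) measure" where
  "sample_algebra n D =
     vimage_algebra (space (prediction_space n D)) fst (\<Pi>\<^sub>M i\<in>{..<n}. obs_space)"


section \<open>Models and restricted least squares\<close>

type_synonym model = "nat \<Rightarrow> bool"

text \<open>Meaningful only if \<open>m\<close> has finitely many ones; this is required wherever models are
  quantified.\<close>

definition msize :: "model \<Rightarrow> nat" where
  "msize m = card {j. m j}"

definition predict :: "model \<Rightarrow> (nat \<Rightarrow> real) \<Rightarrow> (nat \<Rightarrow> real) \<Rightarrow> real" where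
  "predict m x b = (\<Sum>j | m j. x j * b j)"

definition sum_sq :: "nat \<Rightarrow> model \<Rightarrow> sample \<Rightarrow> (nat \<Rightarrow> real) \<Rightarrow> real" where
  "sum_sq n m s b = (\<Sum>i<n. (fst (s i) - predict m (snd (s i)) b)\<^sup>2)"

definition is_ls :: "nat \<Rightarrow> model \<Rightarrow> sample \<Rightarrow> (nat \<Rightarrow> real) \<Rightarrow> bool" where
  "is_ls n m s b \<longleftrightarrow> (\<forall>j. \<not> m j \<longrightarrow> b j = 0) \<and>
     (\<forall>b'. (\<forall>j. \<not> m j \<longrightarrow> b' j = 0) \<longrightarrow> sum_sq n m s b \<le> sum_sq n m s b')"

text \<open>For \<open>msize m \<le> n\<close>, the least squares solution is unique with probability one in the Gaussian
  linear model. On the exceptional null set the estimator is set to zero, which keeps it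
  measurable.\<close>

definition ls_est :: "nat \<Rightarrow> model \<Rightarrow> sample \<Rightarrow> (nat \<Rightarrow> real)" where
  "ls_est n m s = (if \<exists>!b. is_ls n m s b then (THE b. is_ls n m s b) else (\<lambda>_. 0))"

definition RSS :: "nat \<Rightarrow> model \<Rightarrow> sample \<Rightarrow> real" where
  "RSS n m s = (\<Sum>i<n. (fst (s i) - predict m (snd (s i)) (ls_est n m s))\<^sup>2)"


section \<open>Prediction errors and criteria\<close>

definition sq_pred_err :: "nat \<Rightarrow> model \<Rightarrow> sample \<times> obs \<Rightarrow> real" where
  "sq_pred_err n m \<omega> =
     (fst (snd \<omega>) - predict m (snd (snd \<omega>)) (ls_est n m (fst \<omega>)))\<^sup>2"

definition cond_mspe :: "nat \<Rightarrow> obs measure \<Rightarrow> model \<Rightarrow> sample \<times> obs \<Rightarrow> real" where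
  "cond_mspe n D m = real_cond_exp (prediction_space n D) (sample_algebra n D) (sq_pred_err n m)"

definition mspe :: "nat \<Rightarrow> obs measure \<Rightarrow> model \<Rightarrow> real" where
  "mspe n D m = (\<integral>\<omega>. sq_pred_err n m \<omega> \<partial>prediction_space n D)"

definition GCV :: "nat \<Rightarrow> model \<Rightarrow> sample \<Rightarrow> real" where
  "GCV n m s = RSS n m s / (real n - real (msize m)) * (real n / (real n - real (msize m)))"

definition S_p :: "nat \<Rightarrow> model \<Rightarrow> sample \<Rightarrow> real" where
  "S_p n m s = RSS n m s / (real n - real (msize m))
     * ((real n - 1) / (real n - 1 - real (msize m)))"

definition rho_hat_sq :: "nat \<Rightarrow> model \<Rightarrow> sample \<Rightarrow> real" where
  "rho_hat_sq n m s = RSS n m s / (real n - real (msize m))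
     * ((real n + 1) / (real n + 1 - real (msize m)))"


section \<open>Uniform stochastic order\<close>

definition unif_Op ::
    "(nat \<Rightarrow> 'p \<Rightarrow> 'w measure) \<Rightarrow> 'p set \<Rightarrow> (nat \<Rightarrow> 'p \<Rightarrow> 'w \<Rightarrow> real) \<Rightarrow> (nat \<Rightarrow> real) \<Rightarrow> bool" where
  "unif_Op P \<Theta> T a \<longleftrightarrow>
     ((\<lambda>K::real. limsup (\<lambda>n. SUP \<theta>\<in>\<Theta>.
         emeasure (P n \<theta>) {\<omega> \<in> space (P n \<theta>). \<bar>T n \<theta> \<omega>\<bar> > K * a n})) \<longlongrightarrow> 0) at_top"

end

theory Submission
  imports Defs "HOL-Real_Asymp.Real_Asymp"
begin

text \<open>
  Write \<open>k = |m|\<close> and \<open>d = n - k\<close>. After whitening the regressors in \<open>m\<close> and the residual of \<open>y\<close>, the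
  sample becomes an \<open>n \<times> (k + 1)\<close> matrix of independent standard normals and
  \<open>RSS = \<tau>\<^sup>2 \<cdot> schur\<close>, \<open>\<rho>\<^sup>2 = \<tau>\<^sup>2 \<cdot> vif\<close>, where \<open>\<tau>\<^sup>2 \<le> Var y\<close> is the residual variance and both \<open>schur\<close> and
  \<open>vif = 1 + |v|\<^sup>2\<close> depend on the matrix only (\<open>v\<close> is the least squares coefficient of the last column).
  Reflecting all columns so that the first one points in a coordinate direction removes one row
  and one column. By induction \<open>schur\<close> is chi-square with \<open>d\<close> degrees of freedom, and
  \<open>|T|\<^sup>2 / vif\<close> is chi-square with \<open>d + 1\<close> degrees of freedom if \<open>T\<close> is an independent standard normal
  vector in dimension \<open>n + 1\<close>. Chernoff bounds for chi-square variables then show that \<open>schur / d\<close> and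
  \<open>vif \<cdot> d / n\<close> deviate from 1 by more than \<open>\<delta>\<close> (up to terms of order \<open>1 / d\<close>) with probability
  \<open>O(exp (- C d \<delta>\<^sup>2))\<close>. With \<open>\<delta>\<close> proportional to \<open>K a\<^sub>n d / n\<close> the exponent is at least a multiple of
  \<open>K\<^sup>2 log (#M\<^sub>n + 1)\<close>, because \<open>1 - r\<^sub>n \<le> d / n\<close>, and a union bound suffices.
\<close>

section \<open>Independence from characteristic functions\<close>

text \<open>For \<open>k \<ge> 1\<close> the upper tail of \<open>vif\<close> decays only
  polynomially, so exponential moments cannot be applied to it directly. The independent vector
  \<open>T\<close> repairs this: every elimination step multiplies \<open>1 / vif\<close> by an
  independent beta variable, and a chi-square variable times a matching independent beta variable is
  chi-square with one degree of freedom less. Chernoff bounds are therefore needed for chi-square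
  variables only. The criterion and the prediction error are dependent, but their joint law never
  enters, since each is compared with one and the same number. The model knows joint normality only
  through linear combinations. Hence independence is always read off from a factorizing
  characteristic function, and laws are identified by integrating arbitrary nonnegative measurable
  functions, a form that iterates well under Fubini. The cube in \<open>a n\<close> is what this
  method asks for: with \<delta> proportional to \<open>a d / n\<close>, the exponent
  \<open>d \<delta>^2\<close> is a multiple of \<open>a^2 d^3 / n^2\<close>.\<close>

lemma (in prob_space) weighted_char_unique:
  fixes N :: "real measure" and X w :: "'a \<Rightarrow> real"
  assumes N: "real_distribution N" and X[measurable]: "X \<in> borel_measurable M"
    and w: "integrable M w" and w0: "\<And>\<omega>. 0 \<le> w \<omega>"
    and ch: "\<And>s. (CLINT \<omega>|M. w \<omega> * iexp (s * X \<omega>)) = complex_of_real (LINT \<omega>|M. w \<omega>) * char N s"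
    and A: "A \<in> sets borel"
  shows "(LINT \<omega>|M. w \<omega> * indicator A (X \<omega>)) = (LINT \<omega>|M. w \<omega>) * measure N A"
proof -
  define p where "p = (LINT \<omega>|M. w \<omega>)"
  interpret N: real_distribution N by fact
  have [measurable]: "w \<in> borel_measurable M" using w by simp
  have p0: "0 \<le> p" unfolding p_def using w0 by (intro integral_nonneg_AE) auto
  show ?thesis
  proof (cases "p = 0")
    case True
    then have "AE \<omega> in M. w \<omega> = 0"
      using integral_nonneg_eq_0_iff_AE[OF w] w0 by (auto simp: p_def)
    then have "(LINT \<omega>|M. w \<omega> * indicator A (X \<omega>)) = (LINT \<omega>|M. 0)"
      using A by (intro integral_cong_AE) auto
    with True show ?thesis by (simp add: p_def)
  next
    case False
    with p0 have p: "0 < p" by simp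
    \<comment> \<open>Under the reweighted probability \<open>D\<close> the law of \<open>X\<close>
      has characteristic function \<open>char N\<close>, so the uniqueness theorem identifies it
      with \<open>N\<close>.\<close>
    define D where "D = density M (\<lambda>\<omega>. ennreal (w \<omega> / p))"
    have sD: "sets D = sets M" "space D = space M" by (simp_all add: D_def)
    have "emeasure D (space D) = (\<integral>\<^sup>+\<omega>. ennreal (w \<omega> / p) \<partial>M)"
      unfolding D_def by (simp add: emeasure_density)
    also have "\<dots> = ennreal (LINT \<omega>|M. w \<omega> / p)"
      using w w0 p by (intro nn_integral_eq_integral) auto
    also have "(LINT \<omega>|M. w \<omega> / p) = 1" using p by (simp add: p_def)
    finally have pD: "prob_space D" by (intro prob_spaceI) simp
    interpret D: prob_space D by fact
    have XD[measurable]: "X \<in> borel_measurable D" by (simp add: D_def)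
    define L where "L = distr D borel X"
    have L: "real_distribution L" unfolding L_def
      by (intro D.real_distribution_distr) simp
    have "char L = char N"
    proof
      fix s
      have "char L s = (CLINT \<omega>|D. iexp (s * X \<omega>))"
        unfolding L_def char_def by (subst integral_distr) auto
      also have "\<dots> = (CLINT \<omega>|M. (w \<omega> / p) *\<^sub>R iexp (s * X \<omega>))"
        unfolding D_def using w0 p by (subst integral_density) auto
      also have "\<dots> = (CLINT \<omega>|M. (w \<omega> * iexp (s * X \<omega>)) / p)"
        by (intro Bochner_Integration.integral_cong) (auto simp: scaleR_conv_of_real)
      also have "\<dots> = (CLINT \<omega>|M. w \<omega> * iexp (s * X \<omega>)) / p"
        by simp
      also have "\<dots> = char N s" unfolding ch p_def[symmetric] using p by simp
      finally show "char L s = char N s" .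
    qed
    then have "L = N" using Levy_uniqueness[OF L N] by simp
    then have "measure N A = (LINT t|L. indicator A t)"
      using A by simp
    also have "\<dots> = (LINT \<omega>|D. indicator A (X \<omega>))"
      unfolding L_def using A by (subst integral_distr) auto
    also have "\<dots> = (LINT \<omega>|M. (w \<omega> / p) *\<^sub>R indicator A (X \<omega>))"
      unfolding D_def using w0 p A by (subst integral_density) auto
    also have "\<dots> = (LINT \<omega>|M. (w \<omega> * indicator A (X \<omega>)) / p)"
      by (intro Bochner_Integration.integral_cong) auto
    also have "\<dots> = (LINT \<omega>|M. (w \<omega> * indicator A (X \<omega>))) / p" by simp
    finally show ?thesis using p by (simp add: p_def)
  qed
qed

lemma char_uminus: "char N (- t) = cnj (char N t)"
proof -
  have "cnj (char N t) = (CLINT x|N. cnj (iexp (t * x)))"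
    unfolding char_def by simp
  also have "\<dots> = char N (- t)"
    unfolding char_def by (intro Bochner_Integration.integral_cong) (auto simp: exp_cnj)
  finally show ?thesis by simp
qed

text \<open>The uniqueness theorem for characteristic functions needs nonnegative weights, so it is applied to \<open>w\<close> and to
  \<open>w + Re g\<close>; the imaginary part is the real part of \<open>- \<i> g\<close>.\<close>
lemma (in prob_space) complex_weighted_char_unique:
  fixes N :: "real measure" and X w :: "'a \<Rightarrow> real" and g :: "'a \<Rightarrow> complex"
  assumes N: "real_distribution N" and X[measurable]: "X \<in> borel_measurable M"
    and w: "integrable M w" and g: "integrable M g" and gw: "\<And>\<omega>. norm (g \<omega>) \<le> w \<omega>"
    and chw: "\<And>s. (CLINT \<omega>|M. w \<omega> * iexp (s * X \<omega>)) = complex_of_real (LINT \<omega>|M. w \<omega>) * char N s"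
    and chg: "\<And>s. (CLINT \<omega>|M. g \<omega> * iexp (s * X \<omega>)) = (CLINT \<omega>|M. g \<omega>) * char N s"
    and A: "A \<in> sets borel"
  shows "(CLINT \<omega>|M. g \<omega> * indicator A (X \<omega>)) = (CLINT \<omega>|M. g \<omega>) * measure N A"
proof -
  have re: "(LINT \<omega>|M. Re (h \<omega>) * indicator A (X \<omega>)) = (LINT \<omega>|M. Re (h \<omega>)) * measure N A"
    if h: "integrable M h" and hw: "\<And>\<omega>. norm (h \<omega>) \<le> w \<omega>"
      and ch: "\<And>s. (CLINT \<omega>|M. h \<omega> * iexp (s * X \<omega>)) = (CLINT \<omega>|M. h \<omega>) * char N s"
    for h :: "'a \<Rightarrow> complex"
  proof -
    have [measurable]: "h \<in> borel_measurable M" "w \<in> borel_measurable M" using h w by auto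
    have ih: "integrable M (\<lambda>\<omega>. h \<omega> * iexp (s * X \<omega>))" for s
      using h by (rule Bochner_Integration.integrable_bound) (auto simp: norm_mult)
    have [measurable]: "(\<lambda>\<omega>. cnj (h \<omega>)) \<in> borel_measurable M"
      by (rule measurable_compose[OF \<open>h \<in> borel_measurable M\<close> borel_measurable_continuous_onI])
        (intro continuous_intros)
    have ih': "integrable M (\<lambda>\<omega>. cnj (h \<omega>) * iexp (s * X \<omega>))" for s
      using h by (rule Bochner_Integration.integrable_bound) (auto simp: norm_mult)
    have iw: "integrable M (\<lambda>\<omega>. w \<omega> * iexp (s * X \<omega>))" for s
      using w by (rule Bochner_Integration.integrable_bound) (auto simp: norm_mult)
    \<comment> \<open>\<open>Re h\<close> is the mean of \<open>h\<close> and \<open>cnj h\<close>.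
      Conjugation turns \<open>s\<close> into \<open>- s\<close>, so the hypothesis at
      \<open>- s\<close> yields the same factorization for \<open>cnj h\<close>.\<close>
    have cnj: "(CLINT \<omega>|M. cnj (h \<omega>) * iexp (s * X \<omega>)) = cnj (CLINT \<omega>|M. h \<omega>) * char N s" for s
    proof -
      have "(CLINT \<omega>|M. cnj (h \<omega>) * iexp (s * X \<omega>))
          = (CLINT \<omega>|M. cnj (h \<omega> * iexp ((- s) * X \<omega>)))"
        by (intro Bochner_Integration.integral_cong) (auto simp: exp_cnj)
      also have "\<dots> = cnj ((CLINT \<omega>|M. h \<omega>) * char N (- s))"
        using Bochner_Integration.integral_cnj[of M "\<lambda>\<omega>. h \<omega> * iexp ((- s) * X \<omega>)"] ch[of "- s"] by (simp only:)
      finally show ?thesis by (simp add: char_uminus)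
    qed
    have reh: "complex_of_real (Re z) = z / 2 + cnj z / 2" for z
      by (simp add: complex_eq_iff)
    have ind: "integrable M (\<lambda>\<omega>. f \<omega> * indicator A (X \<omega>))" if f: "integrable M f" for f :: "'a \<Rightarrow> real"
    proof (rule Bochner_Integration.integrable_bound[OF f])
      show "(\<lambda>\<omega>. f \<omega> * indicator A (X \<omega>)) \<in> borel_measurable M"
        using borel_measurable_integrable[OF f] A by measurable
    qed (auto simp: indicator_def)
    have iRe: "integrable M (\<lambda>\<omega>. Re (h \<omega>))" using h by simp
    have "(LINT \<omega>|M. (w \<omega> + Re (h \<omega>)) * indicator A (X \<omega>))
        = (LINT \<omega>|M. w \<omega> + Re (h \<omega>)) * measure N A"
    proof (rule weighted_char_unique[OF N X _ _ _ A])
      show "integrable M (\<lambda>\<omega>. w \<omega> + Re (h \<omega>))" using w iRe by simp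
      show "0 \<le> w \<omega> + Re (h \<omega>)" for \<omega>
        using hw[of \<omega>] abs_Re_le_cmod[of "h \<omega>"] by linarith
      fix s
      have "(CLINT \<omega>|M. complex_of_real (w \<omega> + Re (h \<omega>)) * iexp (s * X \<omega>))
          = (CLINT \<omega>|M. w \<omega> * iexp (s * X \<omega>) + (h \<omega> * iexp (s * X \<omega>) / 2
              + cnj (h \<omega>) * iexp (s * X \<omega>) / 2))"
        by (intro Bochner_Integration.integral_cong refl)
           (simp only: of_real_add reh distrib_right times_divide_eq_left)
      also have "\<dots> = (CLINT \<omega>|M. w \<omega> * iexp (s * X \<omega>))
          + ((CLINT \<omega>|M. h \<omega> * iexp (s * X \<omega>)) / 2 + (CLINT \<omega>|M. cnj (h \<omega>) * iexp (s * X \<omega>)) / 2)"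
        using ih[of s] ih'[of s] iw[of s]
        by (simp only: Bochner_Integration.integral_add integral_divide_zero integrable_divide_zero
              Bochner_Integration.integrable_add)
      also have "\<dots> = (LINT \<omega>|M. w \<omega>) * char N s + ((CLINT \<omega>|M. h \<omega>) * char N s / 2
              + cnj (CLINT \<omega>|M. h \<omega>) * char N s / 2)"
        unfolding chw ch cnj ..
      also have "\<dots> = ((LINT \<omega>|M. w \<omega>) + ((CLINT \<omega>|M. h \<omega>)
              + cnj (CLINT \<omega>|M. h \<omega>)) / 2) * char N s"
        by (simp add: field_simps)
      also have "\<dots> = ((LINT \<omega>|M. w \<omega>) + complex_of_real (Re (CLINT \<omega>|M. h \<omega>))) * char N s"
        by (simp only: complex_add_cnj) simp
      also have "\<dots> = complex_of_real (LINT \<omega>|M. w \<omega> + Re (h \<omega>)) * char N s"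
        using w iRe h by (simp add: Bochner_Integration.integral_add)
      finally show "(CLINT \<omega>|M. complex_of_real (w \<omega> + Re (h \<omega>)) * iexp (s * X \<omega>))
        = complex_of_real (LINT \<omega>|M. w \<omega> + Re (h \<omega>)) * char N s" .
    qed
    moreover have "(LINT \<omega>|M. w \<omega> * indicator A (X \<omega>)) = (LINT \<omega>|M. w \<omega>) * measure N A"
      using order_trans[OF norm_ge_zero hw] by (intro weighted_char_unique[OF N X w _ chw A])
    moreover have "(LINT \<omega>|M. (w \<omega> + Re (h \<omega>)) * indicator A (X \<omega>))
        = (LINT \<omega>|M. w \<omega> * indicator A (X \<omega>)) + (LINT \<omega>|M. Re (h \<omega>) * indicator A (X \<omega>))"
      unfolding distrib_right using ind[OF w] ind[OF iRe] by (rule Bochner_Integration.integral_add)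
    ultimately show ?thesis using w iRe by (simp add: distrib_right)
  qed
  have [measurable]: "g \<in> borel_measurable M" using g by auto
  have ReI: "Re (CLINT \<omega>|M. h \<omega> * indicator A (X \<omega>)) = (LINT \<omega>|M. Re (h \<omega>) * indicator A (X \<omega>))"
    if h: "integrable M h" for h :: "'a \<Rightarrow> complex"
  proof -
    have "integrable M (\<lambda>\<omega>. h \<omega> * indicator A (X \<omega>))"
    proof (rule Bochner_Integration.integrable_bound[OF h])
      show "(\<lambda>\<omega>. h \<omega> * indicator A (X \<omega>)) \<in> borel_measurable M"
        using borel_measurable_integrable[OF h] A by measurable
    qed (auto simp: indicator_def)
    then have "Re (CLINT \<omega>|M. h \<omega> * indicator A (X \<omega>)) = (LINT \<omega>|M. Re (h \<omega> * indicator A (X \<omega>)))"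
      by (rule integral_Re[symmetric])
    also have "\<dots> = (LINT \<omega>|M. Re (h \<omega>) * indicator A (X \<omega>))"
      by (intro Bochner_Integration.integral_cong) (auto simp: indicator_def)
    finally show ?thesis .
  qed
  have 1: "Re (CLINT \<omega>|M. g \<omega> * indicator A (X \<omega>)) = Re ((CLINT \<omega>|M. g \<omega>) * measure N A)"
    unfolding ReI[OF g] re[OF g gw chg] integral_Re[OF g] by simp
  have "(CLINT \<omega>|M. - \<i> * g \<omega> * iexp (s * X \<omega>)) = (CLINT \<omega>|M. - \<i> * g \<omega>) * char N s" for s
  proof -
    have "(CLINT \<omega>|M. - \<i> * g \<omega> * iexp (s * X \<omega>)) = (CLINT \<omega>|M. - \<i> * (g \<omega> * iexp (s * X \<omega>)))"
      by (simp add: mult.assoc)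
    also have "\<dots> = - \<i> * ((CLINT \<omega>|M. g \<omega>) * char N s)"
      by (subst integral_mult_right_zero, subst chg, rule refl)
    finally show ?thesis by (simp add: mult.assoc)
  qed
  note chg' = this
  have g': "integrable M (\<lambda>\<omega>. - \<i> * g \<omega>)" using g by simp
  have gw': "norm (- \<i> * g \<omega>) \<le> w \<omega>" for \<omega> using gw by (simp add: norm_mult)
  have "Re (CLINT \<omega>|M. - \<i> * g \<omega> * indicator A (X \<omega>)) = Re ((CLINT \<omega>|M. - \<i> * g \<omega>) * measure N A)"
    unfolding ReI[OF g'] re[OF g' gw' chg'] integral_Re[OF g'] by simp
  then have 2: "Im (CLINT \<omega>|M. g \<omega> * indicator A (X \<omega>)) = Im ((CLINT \<omega>|M. g \<omega>) * measure N A)"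
    by (simp add: mult.assoc)
  show ?thesis using 1 2 by (rule complex_eqI)
qed


text \<open>The one-dimensional uniqueness theorem suffices: exponentials are traded for indicators
  one coordinate at a time, and meanwhile all the other coordinates are frozen into a bounded
  complex weight.\<close>

theorem (in prob_space) distr_PiM_eqI_char:
  fixes X :: "'i \<Rightarrow> 'a \<Rightarrow> real" and N :: "'i \<Rightarrow> real measure"
  assumes I: "finite I" and N: "\<And>i. i \<in> I \<Longrightarrow> real_distribution (N i)"
    and X: "\<And>i. i \<in> I \<Longrightarrow> X i \<in> borel_measurable M"
    and ch: "\<And>t. (CLINT \<omega>|M. iexp (\<Sum>i\<in>I. t i * X i \<omega>)) = (\<Prod>i\<in>I. char (N i) (t i))"
  shows "distr M (PiM I N) (\<lambda>\<omega>. \<lambda>i\<in>I. X i \<omega>) = PiM I N"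
proof -
  have sN: "sets (N i) = sets borel" "space (N i) = UNIV" if "i \<in> I" for i
    using N[OF that] by (simp_all add: real_distribution_def real_distribution_axioms_def sets_eq_imp_space_eq[of "N i" borel])
  \<comment> \<open>\<open>S\<close> collects the coordinates already tested by indicators.
    \<open>S = {}\<close> is the hypothesis, and \<open>S = I\<close> is the claim on
    rectangles.\<close>
  have key: "(CLINT \<omega>|M. (\<Prod>i\<in>S. indicator (A i) (X i \<omega>)) * iexp (\<Sum>i\<in>I - S. t i * X i \<omega>))
      = (\<Prod>i\<in>S. complex_of_real (measure (N i) (A i))) * (\<Prod>i\<in>I - S. char (N i) (t i))"
    if "S \<subseteq> I" and "\<And>i. i \<in> S \<Longrightarrow> A i \<in> sets borel" for S A t
    using finite_subset[OF that(1) I] that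
  proof (induction S arbitrary: t rule: finite_induct)
    case empty
    then show ?case using ch[of t] by simp
  next
    case (insert j S)
    then have j: "j \<in> I" "j \<notin> S" and S: "S \<subseteq> I" "finite S" by auto
    have [measurable]: "X j \<in> borel_measurable M" "A j \<in> sets borel"
      using X j insert by auto
    have [measurable]: "X i \<in> borel_measurable M" "A i \<in> sets borel" if "i \<in> S" for i
      using X S insert that by auto
    have [measurable]: "X i \<in> borel_measurable M" if "i \<in> I - insert j S" for i
      using X that by auto
    note IH = insert.IH[OF S(1)]
    let ?J = "I - insert j S"
    have IS: "I - S = insert j ?J" "finite ?J" "j \<notin> ?J" using j I by auto
    define w where "w \<omega> = (\<Prod>i\<in>S. indicator (A i) (X i \<omega>) :: real)" for \<omega>
    define g where "g \<omega> = complex_of_real (w \<omega>) * iexp (\<Sum>i\<in>?J. t i * X i \<omega>)" for \<omega>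
    have wc: "complex_of_real (w \<omega>) = (\<Prod>i\<in>S. indicator (A i) (X i \<omega>))" for \<omega>
      by (simp add: w_def of_real_prod of_real_indicator)
    have [measurable]: "w \<in> borel_measurable M" "g \<in> borel_measurable M"
      unfolding w_def g_def by measurable
    have w01: "0 \<le> w \<omega>" "w \<omega> \<le> 1" for \<omega>
      unfolding w_def by (auto intro!: prod_nonneg prod_le_1)
    have gw: "norm (g \<omega>) \<le> w \<omega>" for \<omega>
      using w01 by (simp add: g_def norm_mult)
    have w: "integrable M w" using w01 by (intro integrable_const_bound[of _ 1]) auto
    have g: "integrable M g"
      using order_trans[OF gw w01(2)] by (intro integrable_const_bound[of _ 1]) auto
    have Eg: "(CLINT \<omega>|M. g \<omega> * iexp (s * X j \<omega>))
        = (\<Prod>i\<in>S. complex_of_real (measure (N i) (A i))) * (\<Prod>i\<in>?J. char (N i) (t i)) * char (N j) s" for s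
    proof -
      have "(CLINT \<omega>|M. g \<omega> * iexp (s * X j \<omega>))
          = (CLINT \<omega>|M. (\<Prod>i\<in>S. indicator (A i) (X i \<omega>)) * iexp (\<Sum>i\<in>I - S. (t(j := s)) i * X i \<omega>))"
      proof (intro Bochner_Integration.integral_cong refl)
        fix \<omega>
        have "(\<Sum>i\<in>?J. (t(j := s)) i * X i \<omega>) = (\<Sum>i\<in>?J. t i * X i \<omega>)"
          by (intro sum.cong) auto
        then show "g \<omega> * iexp (s * X j \<omega>) = (\<Prod>i\<in>S. indicator (A i) (X i \<omega>)) * iexp (\<Sum>i\<in>I - S. (t(j := s)) i * X i \<omega>)"
          using IS(2,3) unfolding IS(1) g_def wc
          by (simp add: distrib_left exp_add del: fun_upd_apply) (simp add: mult_ac)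
      qed
      also have "\<dots> = (\<Prod>i\<in>S. complex_of_real (measure (N i) (A i))) * (\<Prod>i\<in>I - S. char (N i) ((t(j := s)) i))"
        using insert by (intro IH) auto
      also have "(\<Prod>i\<in>I - S. char (N i) ((t(j := s)) i)) = char (N j) s * (\<Prod>i\<in>?J. char (N i) (t i))"
      proof -
        have "(\<Prod>i\<in>?J. char (N i) ((t(j := s)) i)) = (\<Prod>i\<in>?J. char (N i) (t i))"
          by (intro prod.cong) auto
        then show ?thesis unfolding IS(1) prod.insert[OF IS(2,3)] by simp
      qed
      finally show ?thesis by (simp add: mult_ac)
    qed
    \<comment> \<open>The dominating nonnegative weight \<open>w\<close> is \<open>g\<close> without
      its exponentials. Its factorization is the induction hypothesis with all frequencies except
      the one at \<open>j\<close> set to 0.\<close>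
    have Ew: "(CLINT \<omega>|M. w \<omega> * iexp (s * X j \<omega>))
        = (\<Prod>i\<in>S. complex_of_real (measure (N i) (A i))) * char (N j) s" for s
    proof -
      have "(CLINT \<omega>|M. w \<omega> * iexp (s * X j \<omega>))
          = (CLINT \<omega>|M. (\<Prod>i\<in>S. indicator (A i) (X i \<omega>)) * iexp (\<Sum>i\<in>I - S. ((\<lambda>_. 0)(j := s)) i * X i \<omega>))"
      proof -
        have "(\<Sum>i\<in>?J. ((\<lambda>_. 0)(j := s)) i * X i \<omega>) = 0" for \<omega>
          by (intro sum.neutral) auto
        then show ?thesis unfolding IS(1) wc sum.insert[OF IS(2,3)] by simp
      qed
      also have "\<dots> = (\<Prod>i\<in>S. complex_of_real (measure (N i) (A i))) * (\<Prod>i\<in>I - S. char (N i) (((\<lambda>_. 0)(j := s)) i))"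
        using insert by (intro IH) auto
      also have "(\<Prod>i\<in>I - S. char (N i) (((\<lambda>_. 0)(j := s)) i)) = char (N j) s"
      proof -
        have "(\<Prod>i\<in>?J. char (N i) (((\<lambda>_. 0)(j := s)) i)) = 1"
          using N real_distribution.char_zero by (intro prod.neutral) auto
        then show ?thesis unfolding IS(1) prod.insert[OF IS(2,3)] by simp
      qed
      finally show ?thesis .
    qed
    interpret Nj: real_distribution "N j" by (rule N[OF j(1)])
    have 1: "(CLINT \<omega>|M. g \<omega> * indicator (A j) (X j \<omega>)) = (CLINT \<omega>|M. g \<omega>) * measure (N j) (A j)"
    proof (rule complex_weighted_char_unique[OF N[OF j(1)] _ w g gw])
      show "(CLINT \<omega>|M. w \<omega> * iexp (s * X j \<omega>)) = complex_of_real (LINT \<omega>|M. w \<omega>) * char (N j) s" for s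
        using Ew[of 0] Ew[of s] Nj.char_zero by simp
      show "(CLINT \<omega>|M. g \<omega> * iexp (s * X j \<omega>)) = (CLINT \<omega>|M. g \<omega>) * char (N j) s" for s
        using Eg[of 0] Eg[of s] Nj.char_zero by simp
    qed auto
    have "(CLINT \<omega>|M. (\<Prod>i\<in>insert j S. indicator (A i) (X i \<omega>)) * iexp (\<Sum>i\<in>?J. t i * X i \<omega>))
        = (CLINT \<omega>|M. g \<omega> * indicator (A j) (X j \<omega>))"
      using S j by (intro Bochner_Integration.integral_cong refl) (simp add: g_def wc mult_ac)
    also have "\<dots> = (\<Prod>i\<in>S. complex_of_real (measure (N i) (A i))) * (\<Prod>i\<in>?J. char (N i) (t i)) * measure (N j) (A j)"
      unfolding 1 using Eg[of 0] Nj.char_zero by simp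
    finally show ?case using S j by (simp add: mult_ac)
  qed
  \<comment> \<open>The product locale wants a probability measure at every index of the type, so
    the family is filled up outside \<open>I\<close>.\<close>
  define N' where "N' i = (if i \<in> I then N i else std_normal_distribution)" for i
  have NN: "PiM I N = PiM I N'" by (intro PiM_cong) (auto simp: N'_def)
  have "real_distribution (N' i)" for i
    using N real_dist_normal_dist by (simp add: N'_def)
  then interpret N': product_prob_space N'
    by (intro product_prob_spaceI) (simp add: real_distribution_def)
  have mX: "(\<lambda>\<omega>. \<lambda>i\<in>I. X i \<omega>) \<in> measurable M (PiM I N)"
    using X sN by (intro measurable_restrict) (simp cong: measurable_cong_sets)
  show ?thesis unfolding NN
  proof (rule N'.PiM_eqI[OF I])
    show "sets (distr M (Pi\<^sub>M I N') (\<lambda>\<omega>. \<lambda>i\<in>I. X i \<omega>)) = sets (Pi\<^sub>M I N')" by simp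
    fix A assume "\<And>i. i \<in> I \<Longrightarrow> A i \<in> sets (N' i)"
    then have A: "\<And>i. i \<in> I \<Longrightarrow> A i \<in> sets borel" "\<And>i. i \<in> I \<Longrightarrow> A i \<in> sets (N i)"
      using sN by (auto simp: N'_def)
    have [measurable]: "X i \<in> borel_measurable M" "A i \<in> sets borel" if "i \<in> I" for i
      using X A that by auto
    have B: "{\<omega> \<in> space M. \<forall>i\<in>I. X i \<omega> \<in> A i} \<in> sets M" using I by measurable
    have "emeasure (distr M (Pi\<^sub>M I N') (\<lambda>\<omega>. \<lambda>i\<in>I. X i \<omega>)) (Pi\<^sub>E I A)
        = emeasure M {\<omega> \<in> space M. \<forall>i\<in>I. X i \<omega> \<in> A i}"
      unfolding NN[symmetric] using A I
      by (subst emeasure_distr[OF mX])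
         (auto intro!: arg_cong2[of _ _ _ _ emeasure] sets_PiM_I_finite simp: PiE_iff Pi_iff)
    also have "\<dots> = ennreal (measure M {\<omega> \<in> space M. \<forall>i\<in>I. X i \<omega> \<in> A i})"
      by (simp add: emeasure_eq_measure)
    finally have em: "emeasure (distr M (Pi\<^sub>M I N') (\<lambda>\<omega>. \<lambda>i\<in>I. X i \<omega>)) (Pi\<^sub>E I A)
        = ennreal (measure M {\<omega> \<in> space M. \<forall>i\<in>I. X i \<omega> \<in> A i})" .
    have "complex_of_real (measure M {\<omega> \<in> space M. \<forall>i\<in>I. X i \<omega> \<in> A i})
        = (CLINT \<omega>|M. complex_of_real (indicator {\<omega> \<in> space M. \<forall>i\<in>I. X i \<omega> \<in> A i} \<omega>))"
      using B by (subst integral_complex_of_real) simp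
    also have "\<dots> = (CLINT \<omega>|M. (\<Prod>i\<in>I. indicator (A i) (X i \<omega>)))"
      using I by (intro Bochner_Integration.integral_cong refl)
        (auto simp: indicator_def  intro!: prod.neutral[symmetric])
    also have "\<dots> = complex_of_real (\<Prod>i\<in>I. measure (N i) (A i))"
      using key[of I A] A by simp
    finally have pm: "measure M {\<omega> \<in> space M. \<forall>i\<in>I. X i \<omega> \<in> A i} = (\<Prod>i\<in>I. measure (N i) (A i))"
      by (rule of_real_eq_iff[THEN iffD1])
    note em[unfolded pm]
    also have "ennreal (\<Prod>i\<in>I. measure (N i) (A i)) = (\<Prod>i\<in>I. ennreal (measure (N i) (A i)))"
      by (rule prod_ennreal[symmetric]) simp
    also have "\<dots> = (\<Prod>i\<in>I. emeasure (N' i) (A i))"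
      using N by (intro prod.cong refl)
        (simp add: N'_def finite_measure.emeasure_eq_measure real_distribution_def prob_space_def)
    finally show "emeasure (distr M (Pi\<^sub>M I N') (\<lambda>\<omega>. \<lambda>i\<in>I. X i \<omega>)) (Pi\<^sub>E I A)
        = (\<Prod>i\<in>I. emeasure (N' i) (A i))" .
  qed
qed

section \<open>Standard normal vectors and reflections\<close>

definition gauss :: "'i set \<Rightarrow> ('i \<Rightarrow> real) measure" where
  "gauss I = (\<Pi>\<^sub>M i\<in>I. std_normal_distribution)"

abbreviation gauss_vec :: "nat \<Rightarrow> (nat \<Rightarrow> real) measure" where
  "gauss_vec n \<equiv> gauss {..<n}"

abbreviation gauss_mat :: "nat \<Rightarrow> nat \<Rightarrow> (nat \<times> nat \<Rightarrow> real) measure" where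
  "gauss_mat n k \<equiv> gauss ({..<n} \<times> {..k})"

text \<open>Encoded by the joint characteristic function, so that rotations, marginals and mixed
  constructions are verified by computing one quadratic form. \<open>std_gauss_family_distr\<close>
  converts this into an identity of laws.\<close>

definition std_gauss_family :: "'a measure \<Rightarrow> 'i set \<Rightarrow> ('i \<Rightarrow> 'a \<Rightarrow> real) \<Rightarrow> bool" where
  "std_gauss_family M I X \<longleftrightarrow> (\<forall>i\<in>I. X i \<in> borel_measurable M) \<and>
     (\<forall>t. (CLINT \<omega>|M. iexp (\<Sum>i\<in>I. t i * X i \<omega>)) = exp (- (\<Sum>i\<in>I. (t i)\<^sup>2) / 2))"

lemma prob_space_std_normal: "prob_space std_normal_distribution"
  by (rule prob_space_normal_density) simp

lemma prob_space_gauss: "prob_space (gauss I)"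
  unfolding gauss_def by (intro prob_space_PiM prob_space_std_normal)

interpretation gauss: prob_space "gauss I" for I
  by (rule prob_space_gauss)

lemma sets_gauss [measurable_cong]: "sets (gauss I) = sets (\<Pi>\<^sub>M i\<in>I. borel)"
  unfolding gauss_def by (intro sets_PiM_cong) auto

lemma std_gauss_family_distr:
  assumes "prob_space M" "finite I" "std_gauss_family M I X"
  shows "distr M (gauss I) (\<lambda>\<omega>. \<lambda>i\<in>I. X i \<omega>) = gauss I"
proof -
  interpret prob_space M by fact
  show ?thesis
    unfolding gauss_def
  proof (rule distr_PiM_eqI_char)
    fix t :: "'b \<Rightarrow> real"
    have "(CLINT \<omega>|M. iexp (\<Sum>i\<in>I. t i * X i \<omega>)) = complex_of_real (exp (- (\<Sum>i\<in>I. (t i)\<^sup>2) / 2))"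
      using assms(3) by (simp add: std_gauss_family_def)
    also have "\<dots> = (\<Prod>i\<in>I. char std_normal_distribution (t i))"
      unfolding char_std_normal_distribution of_real_prod[symmetric]
      using assms(2) by (simp add: exp_sum[symmetric] sum_negf sum_divide_distrib)
    finally show "(CLINT \<omega>|M. iexp (\<Sum>i\<in>I. t i * X i \<omega>)) = (\<Prod>i\<in>I. char std_normal_distribution (t i))" .
  qed (use assms real_dist_normal_dist in \<open>auto simp: std_gauss_family_def\<close>)
qed

lemma std_gauss_family_nn_integral:
  assumes "prob_space M" "finite I" "std_gauss_family M I X"
    and [measurable]: "F \<in> borel_measurable (gauss I)"
  shows "(\<integral>\<^sup>+\<omega>. F (\<lambda>i\<in>I. X i \<omega>) \<partial>M) = (\<integral>\<^sup>+x. F x \<partial>gauss I)"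
proof -
  have [measurable]: "(\<lambda>\<omega>. \<lambda>i\<in>I. X i \<omega>) \<in> measurable M (gauss I)"
    unfolding measurable_cong_sets[OF refl sets_gauss]
    using assms(3) by (intro measurable_restrict) (auto simp: std_gauss_family_def)
  have "(\<integral>\<^sup>+x. F x \<partial>gauss I) = (\<integral>\<^sup>+x. F x \<partial>distr M (gauss I) (\<lambda>\<omega>. \<lambda>i\<in>I. X i \<omega>))"
    unfolding std_gauss_family_distr[OF assms(1-3)] ..
  then show ?thesis by (simp add: nn_integral_distr)
qed

lemma char_gauss:
  assumes I: "finite I"
  shows "(CLINT x|gauss I. iexp (\<Sum>i\<in>I. t i * x i)) = exp (- (\<Sum>i\<in>I. (t i)\<^sup>2) / 2)"
proof -
  interpret N: real_distribution std_normal_distribution by (rule real_dist_normal_dist)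
  interpret product_prob_space "\<lambda>i::'a. std_normal_distribution"
    by (intro product_prob_spaceI prob_space_std_normal)
  have "(CLINT x|gauss I. iexp (\<Sum>i\<in>I. t i * x i)) = (CLINT x|gauss I. \<Prod>i\<in>I. iexp (t i * x i))"
    using I by (simp add: exp_sum[symmetric] sum_distrib_left)
  also have "\<dots> = (\<Prod>i\<in>I. char std_normal_distribution (t i))"
    unfolding gauss_def char_def using I
    by (intro product_integral_prod N.integrable_iexp) auto
  also have "\<dots> = complex_of_real (exp (- (\<Sum>i\<in>I. (t i)\<^sup>2) / 2))"
    unfolding char_std_normal_distribution of_real_prod[symmetric]
    using I by (simp add: exp_sum[symmetric] sum_negf sum_divide_distrib)
  finally show ?thesis .
qed

lemma std_normal_ne_0: "AE x in std_normal_distribution. x \<noteq> 0"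
  using AE_lborel_singleton[of 0] by (simp add: AE_density) (auto elim: eventually_mono)

definition ip :: "nat \<Rightarrow> (nat \<Rightarrow> real) \<Rightarrow> (nat \<Rightarrow> real) \<Rightarrow> real" where
  "ip n a b = (\<Sum>i<n. a i * b i)"

lemma ip_commute: "ip n a b = ip n b a"
  by (simp add: ip_def mult.commute)

lemma ip_nonneg [simp]: "0 \<le> ip n a a"
  by (auto simp: ip_def intro: sum_nonneg)

lemma ip_diff_left: "ip n (\<lambda>i. a i - b i) c = ip n a c - ip n b c"
  by (simp add: ip_def left_diff_distrib sum_subtractf)

lemma ip_scale_left: "ip n (\<lambda>i. s * a i) c = s * ip n a c"
  by (simp add: ip_def sum_distrib_left mult.assoc)

lemma ip_diff_right: "ip n c (\<lambda>i. a i - b i) = ip n c a - ip n c b"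
  by (simp add: ip_def right_diff_distrib sum_subtractf)

lemma ip_cong: "(\<And>i. i < n \<Longrightarrow> a i = a' i) \<Longrightarrow> (\<And>i. i < n \<Longrightarrow> b i = b' i) \<Longrightarrow> ip n a b = ip n a' b'"
  by (simp add: ip_def)

lemma ip_eq_0: "ip n a a = 0 \<longleftrightarrow> (\<forall>i<n. a i = 0)"
  by (auto simp: ip_def sum_nonneg_eq_0_iff)

lemma ip_Suc_shift: "ip (Suc n) a b = a 0 * b 0 + ip n (\<lambda>i. a (Suc i)) (\<lambda>i. b (Suc i))"
  unfolding ip_def by (rule sum.lessThan_Suc_shift)

lemma ip_restrict [simp]: "ip n (\<lambda>i\<in>{..<n}. a i) b = ip n a b" "ip n b (\<lambda>i\<in>{..<n}. a i) = ip n b a"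
  by (auto intro!: ip_cong)

lemma measurable_ip_gauss [measurable]:
  "(\<lambda>x. ip n x b) \<in> borel_measurable (gauss_vec n)"
  "(\<lambda>x. ip n x x) \<in> borel_measurable (gauss_vec n)"
  unfolding ip_def measurable_cong_sets[OF sets_gauss refl] by measurable

lemma AE_gauss_component_ne_0:
  assumes "i \<in> I" shows "AE x in gauss I. x i \<noteq> 0"
  unfolding gauss_def
  by (rule AE_PiM_component[OF prob_space_std_normal assms std_normal_ne_0])

lemma AE_gauss_ip_ne_0:
  assumes "0 < n" shows "AE x in gauss_vec n. ip n x x \<noteq> 0"
  using AE_gauss_component_ne_0[of 0 "{..<n}"] assms by (auto simp: ip_eq_0)

text \<open>The normal vector of the mirror that exchanges \<open>x\<close> with its length times
  the first unit vector.\<close>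

definition hh_axis :: "nat \<Rightarrow> (nat \<Rightarrow> real) \<Rightarrow> nat \<Rightarrow> real" where
  "hh_axis n x i = x i - (if i = 0 then sqrt (ip n x x) else 0)"

text \<open>The Householder reflection that maps \<open>x\<close> to a nonnegative multiple of the first unit vector;
  if \<open>x\<close> already is one, division by zero makes it the identity.\<close>
definition hh :: "nat \<Rightarrow> (nat \<Rightarrow> real) \<Rightarrow> (nat \<Rightarrow> real) \<Rightarrow> nat \<Rightarrow> real" where
  "hh n x y i = y i - 2 * ip n (hh_axis n x) y / ip n (hh_axis n x) (hh_axis n x) * hh_axis n x i"

lemma ip_hh_left:
  "ip n (hh n x y) z = ip n y z - 2 * ip n (hh_axis n x) y / ip n (hh_axis n x) (hh_axis n x) * ip n (hh_axis n x) z"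
  unfolding hh_def[abs_def] ip_diff_left ip_scale_left ..

lemma hh_adjoint: "ip n (hh n x y) z = ip n y (hh n x z)"
  unfolding ip_commute[of n y] ip_hh_left by (simp add: ip_commute)

lemma hh_isometry: "ip n (hh n x y) (hh n x z) = ip n y z"
proof (cases "ip n (hh_axis n x) (hh_axis n x) = 0")
  case True
  then have "hh n x v = v" for v by (simp add: hh_def[abs_def])
  then show ?thesis by simp
next
  case False
  let ?w = "hh_axis n x"
  have "ip n ?w (hh n x z) = - ip n ?w z"
    unfolding ip_commute[of n ?w "hh n x z"] ip_hh_left using False by (simp add: ip_commute)
  then show ?thesis
    using ip_hh_left[of n x z y] by (simp add: ip_hh_left ip_commute[of n y] mult.commute)
qed

lemma hh_self:
  assumes "0 < n" "i < n"
  shows "hh n x x i = (if i = 0 then sqrt (ip n x x) else 0)"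
proof -
  define s where "s = sqrt (ip n x x)"
  define e where "e i = (if i = 0 then s else 0)" for i :: nat
  have w: "hh_axis n x = (\<lambda>i. x i - e i)" by (auto simp: hh_axis_def e_def s_def)
  have e1: "ip n e v = s * v 0" for v
    using assms(1) by (simp add: ip_def e_def if_distrib[of "\<lambda>t. t * _"] cong: if_cong)
  have ss: "s * s = ip n x x" by (simp add: s_def)
  have xe: "ip n x e = s * x 0" by (simp add: ip_commute[of n x e] e1)
  have a: "ip n (hh_axis n x) x = ip n x x - s * x 0"
    unfolding w by (simp add: ip_diff_left e1)
  \<comment> \<open>As \<open>e\<close> has the same length as \<open>x\<close>, the squared length
    of the axis is twice its inner product with \<open>x\<close>. The reflection thus subtracts the
    axis from \<open>x\<close> exactly once and leaves \<open>e\<close>.\<close>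
  have b: "ip n (hh_axis n x) (hh_axis n x) = 2 * (ip n x x - s * x 0)"
    unfolding w by (simp add: ip_diff_left ip_diff_right e1 xe) (simp add: e_def ss)
  show ?thesis
  proof (cases "ip n x x - s * x 0 = 0")
    case True
    then have "hh_axis n x i = 0" using b assms(2) by (simp add: ip_eq_0)
    then show ?thesis using True a by (simp add: hh_def) (simp add: hh_axis_def split: if_splits)
  next
    case False
    then have "hh n x x i = x i - hh_axis n x i" unfolding hh_def a b by simp
    then show ?thesis by (simp add: hh_axis_def)
  qed
qed

text \<open>The reflection is an isometry and sends \<open>x\<close> to its length times the first
  unit vector. The length stands as a factor rather than a divisor so that \<open>x = 0\<close> is
  covered.\<close>

lemma ip_hh_self:
  assumes "0 < n" shows "sqrt (ip n x x) * hh n x y 0 = ip n x y"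
proof -
  have "ip n x y = ip n (hh n x x) (hh n x y)" by (simp add: hh_isometry)
  also have "\<dots> = ip n (\<lambda>i. if i = 0 then sqrt (ip n x x) else 0) (hh n x y)"
    using assms by (intro ip_cong) (simp_all add: hh_self)
  finally show ?thesis
    using assms by (simp add: ip_def if_distrib[of "\<lambda>t. t * _"] cong: if_cong)
qed

lemma measurable_hh:
  assumes [measurable]: "\<And>i. i < n \<Longrightarrow> (\<lambda>\<omega>. x \<omega> i) \<in> borel_measurable M"
    "\<And>i. i < n \<Longrightarrow> (\<lambda>\<omega>. y \<omega> i) \<in> borel_measurable M" and [simp]: "i < n"
  shows "(\<lambda>\<omega>. hh n (x \<omega>) (y \<omega>) i) \<in> borel_measurable M"
proof -
  have [measurable]: "(\<lambda>\<omega>. hh_axis n (x \<omega>) i) \<in> borel_measurable M" if "i < n" for i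
    unfolding hh_axis_def ip_def using that by measurable
  show ?thesis unfolding hh_def ip_def by measurable
qed

text \<open>By self-adjointness the reflection moves from \<open>y\<close> to the frequency vector,
  whose length it preserves.\<close>

lemma std_gauss_family_hh: "std_gauss_family (gauss_vec n) {..<n} (\<lambda>i y. hh n x y i)"
  unfolding std_gauss_family_def
proof (intro conjI allI ballI)
  fix i assume "i \<in> {..<n}"
  then show "(\<lambda>y. hh n x y i) \<in> borel_measurable (gauss_vec n)"
    by (intro measurable_hh) auto
next
  fix t :: "nat \<Rightarrow> real"
  have "(CLINT y|gauss_vec n. iexp (\<Sum>i<n. t i * hh n x y i)) = (CLINT y|gauss_vec n. iexp (\<Sum>i<n. hh n x t i * y i))"
    using hh_adjoint[of n x t] by (simp add: ip_def)
  also have "\<dots> = exp (- (\<Sum>i<n. (hh n x t i)\<^sup>2) / 2)" by (rule char_gauss) simp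
  also have "(\<Sum>i<n. (hh n x t i)\<^sup>2) = (\<Sum>i<n. (t i)\<^sup>2)"
    using hh_isometry[of n x t t] by (simp add: ip_def power2_eq_square)
  finally show "(CLINT y|gauss_vec n. iexp (\<Sum>i<n. t i * hh n x y i)) = complex_of_real (exp (- (\<Sum>i<n. (t i)\<^sup>2) / 2))" .
qed

lemma nn_integral_gauss_hh:
  assumes "F \<in> borel_measurable (gauss_vec n)"
  shows "(\<integral>\<^sup>+y. F (\<lambda>i\<in>{..<n}. hh n x y i) \<partial>gauss_vec n) = (\<integral>\<^sup>+y. F y \<partial>gauss_vec n)"
  by (rule std_gauss_family_nn_integral[OF prob_space_gauss _ std_gauss_family_hh assms]) simp

lemma nn_integral_gauss_reindex:
  assumes I: "finite I" and h: "inj_on h J" "h ` J \<subseteq> I" and F: "F \<in> borel_measurable (gauss J)"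
  shows "(\<integral>\<^sup>+y. F (\<lambda>j\<in>J. y (h j)) \<partial>gauss I) = (\<integral>\<^sup>+y. F y \<partial>gauss J)"
proof (rule std_gauss_family_nn_integral[OF prob_space_gauss _ _ F])
  show J: "finite J" using h I by (metis finite_imageD finite_subset)
  show "std_gauss_family (gauss I) J (\<lambda>j y. y (h j))"
    unfolding std_gauss_family_def
  proof (intro conjI allI ballI)
    fix j assume "j \<in> J"
    then show "(\<lambda>y. y (h j)) \<in> borel_measurable (gauss I)"
      unfolding measurable_cong_sets[OF sets_gauss refl]
      using h by (intro measurable_component_singleton) auto
  next
    fix t :: "'b \<Rightarrow> real"
    \<comment> \<open>Frequencies are transported along \<open>h\<close> and vanish off its image.
      The linear and the quadratic form are both unchanged by this, which is why \<open>sums\<close>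
      is stated for a general \<open>q\<close> with \<open>q 0 i = 0\<close>.\<close>
    define t' where "t' i = (if i \<in> h ` J then t (the_inv_into J h i) else 0)" for i
    have sums: "(\<Sum>j\<in>J. q (t j) (h j)) = (\<Sum>i\<in>I. q (t' i) i)" if "\<And>i. q 0 i = 0" for q :: "real \<Rightarrow> 'a \<Rightarrow> real"
    proof -
      have "(\<Sum>i\<in>I. q (t' i) i) = (\<Sum>i\<in>h ` J. q (t' i) i)"
        using h(2) I that by (intro sum.mono_neutral_right) (auto simp: t'_def)
      also have "\<dots> = (\<Sum>j\<in>J. q (t j) (h j))"
        using h(1) by (simp add: sum.reindex t'_def the_inv_into_f_f)
      finally show ?thesis ..
    qed
    have "(CLINT y|gauss I. iexp (\<Sum>j\<in>J. t j * y (h j))) = (CLINT y|gauss I. iexp (\<Sum>i\<in>I. t' i * y i))"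
      using sums[of "\<lambda>c i. c * _ i"] by simp
    also have "\<dots> = exp (- (\<Sum>i\<in>I. (t' i)\<^sup>2) / 2)" by (rule char_gauss[OF I])
    also have "(\<Sum>i\<in>I. (t' i)\<^sup>2) = (\<Sum>j\<in>J. (t j)\<^sup>2)"
      using sums[of "\<lambda>c i. c\<^sup>2"] by simp
    finally show "(CLINT y|gauss I. iexp (\<Sum>j\<in>J. t j * y (h j))) = complex_of_real (exp (- (\<Sum>j\<in>J. (t j)\<^sup>2) / 2))" .
  qed
qed

text \<open>Rotating \<open>W\<close> by the reflection of \<open>T\<close> and then \<open>T\<close> by the reflection of \<open>W\<close> turns
  \<open>W\<^sub>0\<^sup>2 |T|\<^sup>2 / |W|\<^sup>2\<close> first into \<open>\<langle>T, W\<rangle>\<^sup>2 / |W|\<^sup>2\<close> and then into \<open>T\<^sub>0\<^sup>2\<close>.\<close>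
lemma nn_integral_gauss_beta:
  assumes [measurable]: "f \<in> borel_measurable borel"
  shows "(\<integral>\<^sup>+W. \<integral>\<^sup>+T. f (ip (Suc n) T T * (1 - (W 0)\<^sup>2 / ip (Suc n) W W)) \<partial>gauss_vec (Suc n) \<partial>gauss_vec (Suc n))
       = (\<integral>\<^sup>+x. f (ip n x x) \<partial>gauss_vec n)" (is "?L = _")
proof -
  let ?n = "Suc n" and ?G = "gauss_vec (Suc n)"
  interpret pair_sigma_finite ?G ?G
    by (intro pair_sigma_finite.intro gauss.sigma_finite_measure_axioms)
  have ipm [measurable]: "(\<lambda>z. ip ?n (snd z) (fst z)) \<in> borel_measurable (?G \<Otimes>\<^sub>M ?G)"
    "(\<lambda>z. ip ?n (snd z) (snd z)) \<in> borel_measurable (?G \<Otimes>\<^sub>M ?G)"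
    "(\<lambda>z. ip ?n (fst z) (fst z)) \<in> borel_measurable (?G \<Otimes>\<^sub>M ?G)"
    unfolding ip_def by measurable
  have jm [measurable]: "(\<lambda>z. f (ip ?n (snd z) (snd z) - (ip ?n (snd z) (fst z))\<^sup>2 / ip ?n (fst z) (fst z))) \<in> borel_measurable (?G \<Otimes>\<^sub>M ?G)"
    "(\<lambda>z. f (ip ?n (snd z) (snd z) * (1 - (fst z 0)\<^sup>2 / ip ?n (fst z) (fst z)))) \<in> borel_measurable (?G \<Otimes>\<^sub>M ?G)"
    by measurable
  have "?L = (\<integral>\<^sup>+T. \<integral>\<^sup>+W. f (ip ?n T T * (1 - (W 0)\<^sup>2 / ip ?n W W)) \<partial>?G \<partial>?G)"
    using jm(2) by (intro Fubini') (simp add: split_beta')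
  also have "\<dots> = (\<integral>\<^sup>+T. \<integral>\<^sup>+W. f (ip ?n T T - (ip ?n T W)\<^sup>2 / ip ?n W W) \<partial>?G \<partial>?G)"
  proof (rule nn_integral_cong)
    fix T :: "nat \<Rightarrow> real"
    have "(\<integral>\<^sup>+W. f (ip ?n T T * (1 - (W 0)\<^sup>2 / ip ?n W W)) \<partial>?G)
        = (\<integral>\<^sup>+W. f (ip ?n T T * (1 - (hh ?n T W 0)\<^sup>2 / ip ?n W W)) \<partial>?G)"
    proof -
      have "(\<lambda>W. f (ip ?n T T * (1 - (W 0)\<^sup>2 / ip ?n W W))) \<in> borel_measurable ?G" by measurable
      from nn_integral_gauss_hh[OF this, of T] show ?thesis by (simp add: hh_isometry)
    qed
    also have "\<dots> = (\<integral>\<^sup>+W. f (ip ?n T T - (ip ?n T W)\<^sup>2 / ip ?n W W) \<partial>?G)"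
    proof -
      have "(ip ?n T W)\<^sup>2 = ip ?n T T * (hh ?n T W 0)\<^sup>2" for W
        using arg_cong[OF ip_hh_self[of ?n T W], of power2] by (simp add: power_mult_distrib)
      then show ?thesis by (simp add: right_diff_distrib)
    qed
    finally show "(\<integral>\<^sup>+W. f (ip ?n T T * (1 - (W 0)\<^sup>2 / ip ?n W W)) \<partial>?G)
        = (\<integral>\<^sup>+W. f (ip ?n T T - (ip ?n T W)\<^sup>2 / ip ?n W W) \<partial>?G)" .
  qed
  also have "\<dots> = (\<integral>\<^sup>+W. \<integral>\<^sup>+T. f (ip ?n T T - (ip ?n T W)\<^sup>2 / ip ?n W W) \<partial>?G \<partial>?G)"
    using jm(1) by (intro Fubini') (simp add: split_beta')
  also have "\<dots> = (\<integral>\<^sup>+W. \<integral>\<^sup>+T. f (ip ?n T T - (T 0)\<^sup>2) \<partial>?G \<partial>?G)"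
  proof (rule nn_integral_cong_AE, rule AE_mp[OF AE_gauss_ip_ne_0[of ?n] AE_I2], simp, intro impI)
    fix W :: "nat \<Rightarrow> real" assume W: "ip ?n W W \<noteq> 0"
    have hW: "ip ?n (hh ?n W T) W = sqrt (ip ?n W W) * T 0" for T
    proof -
      have "ip ?n (hh ?n W T) W = ip ?n (hh ?n W W) T" by (rule trans[OF hh_adjoint ip_commute])
      also have "\<dots> = ip ?n (\<lambda>i. if i = 0 then sqrt (ip ?n W W) else 0) T"
        by (intro ip_cong hh_self) auto
      finally show ?thesis by (simp add: ip_def if_distrib[of "\<lambda>t. t * _"] del: sum.lessThan_Suc cong: if_cong)
    qed
    have "(\<integral>\<^sup>+T. f (ip ?n T T - (ip ?n T W)\<^sup>2 / ip ?n W W) \<partial>?G)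
        = (\<integral>\<^sup>+T. f (ip ?n T T - (ip ?n (hh ?n W T) W)\<^sup>2 / ip ?n W W) \<partial>?G)"
    proof -
      have "(\<lambda>T. f (ip ?n T T - (ip ?n T W)\<^sup>2 / ip ?n W W)) \<in> borel_measurable ?G" by measurable
      from nn_integral_gauss_hh[OF this, of W] show ?thesis by (simp add: hh_isometry)
    qed
    then show "(\<integral>\<^sup>+T. f (ip ?n T T - (ip ?n T W)\<^sup>2 / ip ?n W W) \<partial>?G)
        = (\<integral>\<^sup>+T. f (ip ?n T T - (T 0)\<^sup>2) \<partial>?G)"
      using W by (simp add: hW power_mult_distrib)
  qed
  also have "\<dots> = (\<integral>\<^sup>+T. f (ip ?n T T - (T 0)\<^sup>2) \<partial>?G)"
    by (simp add: gauss.emeasure_space_1)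
  also have "\<dots> = (\<integral>\<^sup>+T. f (ip n (\<lambda>i\<in>{..<n}. T (Suc i)) (\<lambda>i\<in>{..<n}. T (Suc i))) \<partial>?G)"
    by (simp add: ip_Suc_shift power2_eq_square)
  also have "\<dots> = (\<integral>\<^sup>+x. f (ip n x x) \<partial>gauss_vec n)"
    by (rule nn_integral_gauss_reindex) auto
  finally show ?thesis .
qed


section \<open>Laplace transform, tails and inverse moment of the chi-square distribution\<close>

lemma nn_integral_std_normal_exp_square:
  assumes s: "- 1 / 2 < s"
  shows "(\<integral>\<^sup>+x. ennreal (exp (- s * x\<^sup>2)) \<partial>std_normal_distribution) = ennreal ((1 + 2 * s) powr (- 1 / 2))"
proof -
  \<comment> \<open>Tilting the standard normal density by \<open>exp (- s * x^2)\<close> gives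
    \<open>q\<close> times the centred normal density with standard deviation
    \<open>q\<close>.\<close>
  define q where "q = 1 / sqrt (1 + 2 * s)"
  have q: "0 < q" "q\<^sup>2 = 1 / (1 + 2 * s)" using s by (simp_all add: q_def power_divide)
  have qp: "q = (1 + 2 * s) powr (- 1 / 2)"
    using s by (simp add: q_def powr_minus_divide powr_half_sqrt)
  have dens: "std_normal_density x * exp (- s * x\<^sup>2) = q * normal_density 0 q x" for x
  proof -
    have "x\<^sup>2 / (2 * q\<^sup>2) = x\<^sup>2 / 2 + s * x\<^sup>2" unfolding q(2) by (simp add: field_simps)
    then have "exp (- (x\<^sup>2 / (2 * q\<^sup>2))) = exp (- (x\<^sup>2) / 2) * exp (- s * x\<^sup>2)"
      by (simp add: exp_add[symmetric])
    then have 1: "normal_density 0 q x = 1 / sqrt (2 * pi * q\<^sup>2) * (exp (- (x\<^sup>2) / 2) * exp (- s * x\<^sup>2))"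
      by (simp add: normal_density_def)
    have 2: "q * (1 / sqrt (2 * pi * q\<^sup>2)) = 1 / sqrt (2 * pi)"
      using q(1) by (simp add: real_sqrt_mult)
    show ?thesis
      unfolding 1 std_normal_density_def 2[symmetric] by (simp only: mult.assoc)
  qed
  have "(\<integral>\<^sup>+x. ennreal (exp (- s * x\<^sup>2)) \<partial>std_normal_distribution)
      = (\<integral>\<^sup>+x. ennreal (std_normal_density x * exp (- s * x\<^sup>2)) \<partial>lborel)"
    by (subst nn_integral_density) (auto simp: ennreal_mult')
  also have "\<dots> = (\<integral>\<^sup>+x. ennreal q * ennreal (normal_density 0 q x) \<partial>lborel)"
    unfolding dens using q by (simp add: ennreal_mult')
  also have "\<dots> = ennreal q * (\<integral>\<^sup>+x. ennreal (normal_density 0 q x) \<partial>lborel)"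
    by (rule nn_integral_cmult) simp
  also have "(\<integral>\<^sup>+x. ennreal (normal_density 0 q x) \<partial>lborel) = 1"
    using q by (subst nn_integral_eq_integral) auto
  finally show ?thesis by (simp add: qp)
qed

text \<open>The Laplace transform of the chi-square law with \<open>n\<close> degrees of freedom.
  Negative \<open>s\<close> serve the upper tail, positive \<open>s\<close> the lower tail and the
  inverse moment.\<close>

lemma nn_integral_gauss_exp:
  assumes s: "- 1 / 2 < s"
  shows "(\<integral>\<^sup>+x. ennreal (exp (- s * ip n x x)) \<partial>gauss_vec n) = ennreal ((1 + 2 * s) powr (- real n / 2))"
proof -
  interpret product_prob_space "\<lambda>i::nat. std_normal_distribution"
    by (intro product_prob_spaceI prob_space_std_normal)
  have "(\<integral>\<^sup>+x. ennreal (exp (- s * ip n x x)) \<partial>gauss_vec n)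
      = (\<integral>\<^sup>+x. (\<Prod>i<n. ennreal (exp (- s * (x i)\<^sup>2))) \<partial>gauss_vec n)"
    by (simp add: prod_ennreal exp_sum[symmetric] ip_def sum_distrib_left sum_negf power2_eq_square)
  also have "\<dots> = (\<Prod>i<n. ennreal ((1 + 2 * s) powr (- 1 / 2)))"
    unfolding gauss_def using nn_integral_std_normal_exp_square[OF s]
    by (subst product_nn_integral_prod) auto
  also have "\<dots> = ennreal (((1 + 2 * s) powr (- 1 / 2)) ^ n)"
    by (simp add: ennreal_power)
  also have "((1 + 2 * s) powr (- 1 / 2)) ^ n = (1 + 2 * s) powr (- real n / 2)"
    using s by (simp add: powr_realpow[symmetric] powr_powr)
  finally show ?thesis .
qed

text \<open>Markov's inequality for \<open>exp (- s * ip n x x)\<close>. The sign of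
  \<open>s\<close> decides which tail is bounded.\<close>

lemma gauss_chernoff:
  assumes s: "- 1 / 2 < s"
  shows "emeasure (gauss_vec n) {x \<in> space (gauss_vec n). - s * ip n x x \<ge> b}
    \<le> ennreal (exp (- b - real n / 2 * ln (1 + 2 * s)))"
proof -
  let ?G = "gauss_vec n"
  have "emeasure ?G {x \<in> space ?G. - s * ip n x x \<ge> b}
      = (\<integral>\<^sup>+x. indicator {x \<in> space ?G. - s * ip n x x \<ge> b} x \<partial>?G)"
    by (rule nn_integral_indicator[symmetric]) measurable
  also have "\<dots> \<le> (\<integral>\<^sup>+x. ennreal (exp (- b)) * ennreal (exp (- s * ip n x x)) \<partial>?G)"
    by (intro nn_integral_mono)
      (auto simp: indicator_def ennreal_mult'[symmetric] exp_add[symmetric] simp flip: ennreal_1)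
  also have "\<dots> = ennreal (exp (- b)) * (\<integral>\<^sup>+x. ennreal (exp (- s * ip n x x)) \<partial>?G)"
    by (rule nn_integral_cmult) measurable
  also have "\<dots> = ennreal (exp (- b - real n / 2 * ln (1 + 2 * s)))"
    unfolding nn_integral_gauss_exp[OF s] using s
    by (simp add: ennreal_mult'[symmetric] powr_def exp_add[symmetric])
  finally show ?thesis .
qed

lemma gauss_upper_tail:
  assumes "0 \<le> \<delta>" "\<delta> \<le> 1"
  shows "emeasure (gauss_vec n) {x \<in> space (gauss_vec n). ip n x x \<ge> real n * (1 + \<delta>)}
    \<le> ennreal (exp (- real n * \<delta>\<^sup>2 / 16))"
proof (cases "\<delta> = 0")
  case True
  then show ?thesis by (simp add: gauss.emeasure_le_1)
next
  case False
  \<comment> \<open>Now \<open>1 + 2 * s = 1 - \<delta> / 4\<close> stays in the range of the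
    quadratic lower bound for \<open>ln\<close>. The terms linear in \<delta> cancel, and
    \<open>- n \<delta>^2 / 8 + n \<delta>^2 / 16\<close> remains.\<close>
  define s where "s = - (\<delta> / 8)"
  have s: "- 1 / 2 < s" using assms by (simp add: s_def)
  have ln: "- (\<delta> / 4) - 2 * (\<delta> / 4)\<^sup>2 \<le> ln (1 + 2 * s)"
    using ln_one_minus_pos_lower_bound[of "\<delta> / 4"] assms by (simp add: s_def)
  have "emeasure (gauss_vec n) {x \<in> space (gauss_vec n). ip n x x \<ge> real n * (1 + \<delta>)}
      = emeasure (gauss_vec n) {x \<in> space (gauss_vec n). - s * ip n x x \<ge> \<delta> / 8 * (real n * (1 + \<delta>))}"
    using assms False by (intro arg_cong2[of _ _ _ _ emeasure]) (auto simp: s_def)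
  also have "\<dots> \<le> ennreal (exp (- (\<delta> / 8 * (real n * (1 + \<delta>))) - real n / 2 * ln (1 + 2 * s)))"
    by (rule gauss_chernoff[OF s])
  also have "\<dots> \<le> ennreal (exp (- real n * \<delta>\<^sup>2 / 16))"
  proof (intro ennreal_leI exp_le_cancel_iff[THEN iffD2])
    have "real n / 2 * (- (\<delta> / 4) - 2 * (\<delta> / 4)\<^sup>2) \<le> real n / 2 * ln (1 + 2 * s)"
      using ln by (intro mult_left_mono) auto
    then show "- (\<delta> / 8 * (real n * (1 + \<delta>))) - real n / 2 * ln (1 + 2 * s) \<le> - real n * \<delta>\<^sup>2 / 16"
      by (simp add: field_simps power2_eq_square)
  qed
  finally show ?thesis .
qed

lemma gauss_lower_tail:
  assumes "0 \<le> \<delta>" "\<delta> \<le> 1"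
  shows "emeasure (gauss_vec n) {x \<in> space (gauss_vec n). ip n x x \<le> real n * (1 - \<delta>)}
    \<le> ennreal (exp (- real n * \<delta>\<^sup>2 / 16))"
proof (cases "\<delta> = 0")
  case True
  then show ?thesis by (simp add: gauss.emeasure_le_1)
next
  case False
  \<comment> \<open>With \<open>ln (1 + \<delta> / 2) \<ge> \<delta> / 2 - \<delta>^2 / 4\<close>
    the linear terms cancel and the exponent is \<open>- n \<delta>^2 / 8\<close>. It is weakened to
    agree with the upper tail.\<close>
  define s where "s = \<delta> / 4"
  have s: "- 1 / 2 < s" using assms by (simp add: s_def)
  have ln: "\<delta> / 2 - (\<delta> / 2)\<^sup>2 \<le> ln (1 + 2 * s)"
    using ln_one_plus_pos_lower_bound[of "\<delta> / 2"] assms by (simp add: s_def)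
  have "emeasure (gauss_vec n) {x \<in> space (gauss_vec n). ip n x x \<le> real n * (1 - \<delta>)}
      = emeasure (gauss_vec n) {x \<in> space (gauss_vec n). - s * ip n x x \<ge> - (\<delta> / 4 * (real n * (1 - \<delta>)))}"
    using assms False by (intro arg_cong2[of _ _ _ _ emeasure]) (auto simp: s_def)
  also have "\<dots> \<le> ennreal (exp (- (- (\<delta> / 4 * (real n * (1 - \<delta>)))) - real n / 2 * ln (1 + 2 * s)))"
    by (rule gauss_chernoff[OF s])
  also have "\<dots> \<le> ennreal (exp (- real n * \<delta>\<^sup>2 / 16))"
  proof (intro ennreal_leI exp_le_cancel_iff[THEN iffD2])
    have "real n / 2 * (\<delta> / 2 - (\<delta> / 2)\<^sup>2) \<le> real n / 2 * ln (1 + 2 * s)"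
      using ln by (intro mult_left_mono) auto
    moreover have "0 \<le> real n * \<delta>\<^sup>2" by simp
    ultimately show "- (- (\<delta> / 4 * (real n * (1 - \<delta>)))) - real n / 2 * ln (1 + 2 * s) \<le> - real n * \<delta>\<^sup>2 / 16"
      by (simp add: field_simps power2_eq_square)
  qed
  finally show ?thesis .
qed

text \<open>Write \<open>1 / q\<close> as the integral of \<open>exp (- s * q)\<close> over
  \<open>s \<ge> 0\<close> and exchange integrals: what remains is the integral of the Laplace
  transform, which converges at infinity because \<open>n > 2\<close>.\<close>

lemma nn_integral_gauss_inverse:
  assumes n: "3 \<le> n"
  shows "(\<integral>\<^sup>+x. ennreal (1 / ip n x x) \<partial>gauss_vec n) = ennreal (1 / (real n - 2))"
proof -
  let ?G = "gauss_vec n"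
  interpret pair_sigma_finite ?G lborel
    by (intro pair_sigma_finite.intro gauss.sigma_finite_measure_axioms lborel.sigma_finite_measure_axioms)
  have [measurable]: "(\<lambda>z. ip n (fst z) (fst z)) \<in> borel_measurable (?G \<Otimes>\<^sub>M lborel)"
    unfolding ip_def by measurable
  have exp_int: "(\<integral>\<^sup>+s. ennreal (exp (- s * a)) * indicator {0..} s \<partial>lborel) = ennreal (1 / a)" if a: "0 < a" for a :: real
  proof -
    have "(\<integral>\<^sup>+s. ennreal (exp (- s * a)) * indicator {0..} s \<partial>lborel) = ennreal (0 - (- exp (- 0 * a) / a))"
    proof (rule nn_integral_FTC_atLeast)
      show "((\<lambda>s. - exp (- s * a) / a) \<longlongrightarrow> 0) at_top" using a by real_asymp
      show "((\<lambda>s. - exp (- s * a) / a) has_real_derivative exp (- s * a)) (at s)" for s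
        using a by (auto intro!: derivative_eq_intros)
    qed auto
    then show ?thesis by simp
  qed
  have "(\<integral>\<^sup>+x. ennreal (1 / ip n x x) \<partial>?G)
      = (\<integral>\<^sup>+x. \<integral>\<^sup>+s. ennreal (exp (- s * ip n x x)) * indicator {0..} s \<partial>lborel \<partial>?G)"
  proof (rule nn_integral_cong_AE, rule AE_mp[OF AE_gauss_ip_ne_0[of n] AE_I2])
    show "0 < n" using n by simp
    fix x :: "nat \<Rightarrow> real"
    show "ip n x x \<noteq> 0 \<longrightarrow> ennreal (1 / ip n x x) = (\<integral>\<^sup>+s. ennreal (exp (- s * ip n x x)) * indicator {0..} s \<partial>lborel)"
      using exp_int[of "ip n x x"] ip_nonneg[of n x] by (auto simp: less_le)
  qed
  also have "\<dots> = (\<integral>\<^sup>+s. \<integral>\<^sup>+x. ennreal (exp (- s * ip n x x)) * indicator {0..} s \<partial>?G \<partial>lborel)"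
    by (intro Fubini'[symmetric]) (simp add: split_beta')
  also have "\<dots> = (\<integral>\<^sup>+s. ennreal ((1 + 2 * s) powr (- real n / 2)) * indicator {0..} s \<partial>lborel)"
  proof (rule nn_integral_cong)
    fix s :: real
    show "(\<integral>\<^sup>+x. ennreal (exp (- s * ip n x x)) * indicator {0..} s \<partial>?G) = ennreal ((1 + 2 * s) powr (- real n / 2)) * indicator {0..} s"
      using nn_integral_gauss_exp[of s n] by (cases "0 \<le> s") auto
  qed
  also have "\<dots> = ennreal (0 - (- ((1 + 2 * 0) powr (1 - real n / 2) / (real n - 2))))"
  proof (rule nn_integral_FTC_atLeast)
    have "1 - real n / 2 < 0" using n by simp
    then show "((\<lambda>s. - ((1 + 2 * s) powr (1 - real n / 2) / (real n - 2))) \<longlongrightarrow> 0) at_top"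
      by real_asymp
    fix s :: real assume s: "0 \<le> s"
    show "((\<lambda>s. - ((1 + 2 * s) powr (1 - real n / 2) / (real n - 2))) has_real_derivative (1 + 2 * s) powr (- real n / 2)) (at s)"
    proof -
      define c where "c = real n - 2"
      have c: "0 < c" "real n = c + 2" using n by (simp_all add: c_def)
      have "((\<lambda>s. - ((1 + 2 * s) powr (- (c / 2)) / c)) has_real_derivative (1 + 2 * s) powr (- (c / 2) - 1)) (at s)"
        using s c(1) by (auto intro!: derivative_eq_intros)
      moreover have "- (c + 2) / 2 = - (c / 2) - 1" "1 - (c + 2) / 2 = - (c / 2)" "c + 2 - 2 = c"
        by (simp_all add: field_simps)
      ultimately show ?thesis unfolding c(2) by (simp only:)
    qed
  qed auto
  finally show ?thesis by simp
qed

section \<open>Gaussian elimination on Gram matrices\<close>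

text \<open>The Schur complement of the pivot \<open>G 0 0\<close>, with the remaining indices
  shifted down by one.\<close>

definition sweep :: "(nat \<Rightarrow> nat \<Rightarrow> real) \<Rightarrow> nat \<Rightarrow> nat \<Rightarrow> real" where
  "sweep G i j = G (Suc i) (Suc j) - G (Suc i) 0 * G 0 (Suc j) / G 0 0"

text \<open>All \<open>k\<close> pivots of the elimination are nonzero. For a Gram matrix this
  expresses linear independence of the first \<open>k\<close> columns.\<close>

primrec nondeg :: "nat \<Rightarrow> (nat \<Rightarrow> nat \<Rightarrow> real) \<Rightarrow> bool" where
  "nondeg 0 G \<longleftrightarrow> True"
| "nondeg (Suc k) G \<longleftrightarrow> G 0 0 \<noteq> 0 \<and> nondeg k (sweep G)"

text \<open>The Schur complement of the leading \<open>k\<close> by \<open>k\<close> block at the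
  entry \<open>(k, k)\<close>. For a Gram matrix it is the residual sum of squares of column
  \<open>k\<close> regressed on the columns before it.\<close>

primrec schur :: "nat \<Rightarrow> (nat \<Rightarrow> nat \<Rightarrow> real) \<Rightarrow> real" where
  "schur 0 G = G 0 0"
| "schur (Suc k) G = schur k (sweep G)"

text \<open>Back substitution for the leading \<open>k\<close> by \<open>k\<close> system whose
  right-hand side is column \<open>k\<close>.\<close>

primrec sol :: "nat \<Rightarrow> (nat \<Rightarrow> nat \<Rightarrow> real) \<Rightarrow> nat \<Rightarrow> real" where
  "sol 0 G = (\<lambda>_. 0)"
| "sol (Suc k) G = case_nat ((G 0 (Suc k) - (\<Sum>a<k. G 0 (Suc a) * sol k (sweep G) a)) / G 0 0) (sol k (sweep G))"

text \<open>Row 0 determines \<open>u 0\<close>, and inserting this value turns the other rows into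
  the system of \<open>sweep G\<close>. The equivalence delivers existence and uniqueness at
  once.\<close>

lemma sol_iff:
  "nondeg k G \<Longrightarrow> (\<forall>a<k. (\<Sum>b<k. G a b * u b) = G a k) \<longleftrightarrow> (\<forall>b<k. u b = sol k G b)"
proof (induction k arbitrary: G u)
  case (Suc k)
  define u' where "u' b = u (Suc b)" for b
  have G0: "G 0 0 \<noteq> 0" and nd: "nondeg k (sweep G)" using Suc.prems by auto
  define S where "S = (\<Sum>b<k. G 0 (Suc b) * u' b)"
  have row0: "(\<Sum>b<Suc k. G 0 b * u b) = G 0 (Suc k) \<longleftrightarrow> u 0 = (G 0 (Suc k) - S) / G 0 0"
    using G0 by (auto simp: sum.lessThan_Suc_shift S_def u'_def field_simps simp del: sum.lessThan_Suc)
  have row: "(\<Sum>b<Suc k. G (Suc a) b * u b) = G (Suc a) (Suc k) \<longleftrightarrow> (\<Sum>b<k. sweep G a b * u' b) = sweep G a k"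
    if u0: "u 0 = (G 0 (Suc k) - S) / G 0 0" for a
  proof -
    define T where "T = (\<Sum>b<k. G (Suc a) (Suc b) * u' b)"
    have 1: "(\<Sum>b<k. sweep G a b * u' b) = T - G (Suc a) 0 / G 0 0 * S"
      unfolding sweep_def S_def T_def left_diff_distrib sum_subtractf sum_distrib_left by (simp add: mult_ac)
    have 2: "(\<Sum>b<Suc k. G (Suc a) b * u b) = G (Suc a) 0 * u 0 + T"
      by (simp add: sum.lessThan_Suc_shift u'_def T_def del: sum.lessThan_Suc)
    show ?thesis
    proof -
      have "G (Suc a) 0 * ((G 0 (Suc k) - S) / G 0 0) + T - G (Suc a) (Suc k)
          = (T - G (Suc a) 0 / G 0 0 * S) - (G (Suc a) (Suc k) - G (Suc a) 0 * G 0 (Suc k) / G 0 0)"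
        by (simp add: right_diff_distrib diff_divide_distrib)
      from diff_eq_diff_eq[OF this] show ?thesis unfolding 1 2 u0 unfolding sweep_def .
    qed
  qed
  have "(\<forall>a<Suc k. (\<Sum>b<Suc k. G a b * u b) = G a (Suc k)) \<longleftrightarrow>
      u 0 = (G 0 (Suc k) - S) / G 0 0 \<and> (\<forall>a<k. (\<Sum>b<k. sweep G a b * u' b) = sweep G a k)"
    unfolding All_less_Suc2 row0 using row by auto
  also have "\<dots> \<longleftrightarrow> u 0 = (G 0 (Suc k) - S) / G 0 0 \<and> (\<forall>b<k. u' b = sol k (sweep G) b)"
    using Suc.IH[OF nd, of u'] by blast
  also have "\<dots> \<longleftrightarrow> (\<forall>b<Suc k. u b = sol (Suc k) G b)"
    unfolding All_less_Suc2 by (auto simp: u'_def S_def)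
  finally show ?case .
qed simp

text \<open>The right-hand side keeps its value when row and column 0 are eliminated, so it descends
  to \<open>sweep G\<close>.\<close>

lemma schur_eq:
  "nondeg k G \<Longrightarrow> (\<And>a. a < k \<Longrightarrow> (\<Sum>b<k. G a b * u b) = G a k) \<Longrightarrow> schur k G = G k k - (\<Sum>b<k. G k b * u b)"
proof (induction k arbitrary: G u)
  case (Suc k)
  define u' where "u' b = u (Suc b)" for b
  have G0: "G 0 0 \<noteq> 0" and nd: "nondeg k (sweep G)" using Suc.prems by auto
  define S where "S = (\<Sum>b<k. G 0 (Suc b) * u' b)"
  have row0: "G 0 0 * u 0 + S = G 0 (Suc k)"
    using Suc.prems(2)[of 0] by (simp add: sum.lessThan_Suc_shift S_def u'_def del: sum.lessThan_Suc)
  have sw: "(\<Sum>b<k. sweep G a b * u' b) = (\<Sum>b<k. G (Suc a) (Suc b) * u' b) - G (Suc a) 0 / G 0 0 * S" for a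
    unfolding sweep_def S_def left_diff_distrib sum_subtractf sum_distrib_left by (simp add: mult_ac)
  have full: "(\<Sum>b<Suc k. G (Suc a) b * u b) = G (Suc a) 0 * u 0 + (\<Sum>b<k. G (Suc a) (Suc b) * u' b)" for a
    by (simp add: sum.lessThan_Suc_shift u'_def del: sum.lessThan_Suc)
  have fin: "schur (Suc k) G = sweep G k k - (\<Sum>b<k. sweep G k b * u' b)"
  proof (simp, rule Suc.IH[OF nd])
    fix a assume "a < k"
    then have eq: "G (Suc a) 0 * u 0 + (\<Sum>b<k. G (Suc a) (Suc b) * u' b) = G (Suc a) (Suc k)"
      using Suc.prems(2)[of "Suc a"] full by simp
    show "(\<Sum>b<k. sweep G a b * u' b) = sweep G a k"
      unfolding sw unfolding sweep_def eq[symmetric] row0[symmetric] using G0 by (simp add: field_simps)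
  qed
  show ?case
    unfolding fin sw full unfolding sweep_def row0[symmetric] using G0 by (simp add: field_simps)
qed simp

lemma nondeg_schur_sol_cong:
  assumes "\<And>i j. i \<le> k \<Longrightarrow> j \<le> k \<Longrightarrow> G i j = H i j"
  shows "nondeg k G = nondeg k H" "schur k G = schur k H" "sol k G = sol k H"
  using assms
proof (induction k arbitrary: G H)
  case (Suc k)
  have sw: "sweep G i j = sweep H i j"
    if "\<And>i j. i \<le> Suc k \<Longrightarrow> j \<le> Suc k \<Longrightarrow> G i j = H i j" "i \<le> k" "j \<le> k" for G H i j
    using that by (simp add: sweep_def)
  {
    case 1
    have "nondeg k (sweep G) = nondeg k (sweep H)" by (rule Suc.IH(1), rule sw) (use 1 in auto)
    then show ?case using 1 by simp
  next
    case 2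
    have "schur k (sweep G) = schur k (sweep H)" by (rule Suc.IH(2), rule sw) (use 2 in auto)
    then show ?case using 2 by simp
  next
    case 3
    have "sol k (sweep G) = sol k (sweep H)" by (rule Suc.IH(3), rule sw) (use 3 in auto)
    then show ?case using 3 by simp
  }
qed auto

lemma measurable_nondeg_schur_sol:
  assumes "\<And>i j. i \<le> k \<Longrightarrow> j \<le> k \<Longrightarrow> (\<lambda>\<omega>. G \<omega> i j) \<in> borel_measurable M"
  shows "Measurable.pred M (\<lambda>\<omega>. nondeg k (G \<omega>))" "(\<lambda>\<omega>. schur k (G \<omega>)) \<in> borel_measurable M"
    "(\<lambda>\<omega>. sol k (G \<omega>) a) \<in> borel_measurable M"
  using assms
proof (induction k arbitrary: G a)
  case (Suc k)
  have sw: "(\<lambda>\<omega>. sweep (G \<omega>) i j) \<in> borel_measurable M"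
    if "\<And>i j. i \<le> Suc k \<Longrightarrow> j \<le> Suc k \<Longrightarrow> (\<lambda>\<omega>. G \<omega> i j) \<in> borel_measurable M" "i \<le> k" "j \<le> k" for G i j
    unfolding sweep_def using that
    by (intro borel_measurable_diff borel_measurable_times borel_measurable_divide) auto
  {
    case 1
    have [measurable]: "(\<lambda>\<omega>. G \<omega> 0 0) \<in> borel_measurable M" using 1 by auto
    have [measurable]: "Measurable.pred M (\<lambda>\<omega>. nondeg k (sweep (G \<omega>)))"
      by (rule Suc.IH(1), rule sw) (use 1 in auto)
    show ?case by simp
  next
    case 2
    have "(\<lambda>\<omega>. schur k (sweep (G \<omega>))) \<in> borel_measurable M"
      by (rule Suc.IH(2), rule sw) (use 2 in auto)
    then show ?case by simp
  next
    case 3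
    have [measurable]: "(\<lambda>\<omega>. G \<omega> 0 j) \<in> borel_measurable M" if "j \<le> Suc k" for j using 3 that by auto
    have [measurable]: "(\<lambda>\<omega>. sol k (sweep (G \<omega>)) a) \<in> borel_measurable M" for a
      by (rule Suc.IH(3), rule sw) (use 3 in auto)
    have "(\<lambda>\<omega>. (G \<omega> 0 (Suc k) - (\<Sum>a<k. G \<omega> 0 (Suc a) * sol k (sweep (G \<omega>)) a)) / G \<omega> 0 0) \<in> borel_measurable M"
      by measurable
    then show ?case by (cases a) simp_all
  }
qed auto

definition gram :: "nat \<Rightarrow> (nat \<Rightarrow> nat \<Rightarrow> real) \<Rightarrow> nat \<Rightarrow> nat \<Rightarrow> real" where
  "gram n C a b = (\<Sum>i<n. C i a * C i b)"

lemma gram_commute: "gram n C a b = gram n C b a"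
  by (simp add: gram_def mult.commute)

text \<open>On Gram matrices, sweeping is one Gram-Schmidt step: column 0 is projected out of all
  the others.\<close>

lemma sweep_gram:
  assumes "gram n C 0 0 \<noteq> 0"
  shows "sweep (gram n C) = gram n (\<lambda>i a. C i (Suc a) - gram n C 0 (Suc a) / gram n C 0 0 * C i 0)"
proof (intro ext)
  fix a b
  let ?g = "\<lambda>a. gram n C 0 (Suc a) / gram n C 0 0"
  have "gram n (\<lambda>i a. C i (Suc a) - ?g a * C i 0) a b
      = (\<Sum>i<n. C i (Suc a) * C i (Suc b) - ?g b * (C i (Suc a) * C i 0) - ?g a * (C i 0 * C i (Suc b))
          + ?g a * ?g b * (C i 0 * C i 0))"
    unfolding gram_def[of n "\<lambda>i a. C i (Suc a) - ?g a * C i 0"]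
    by (intro sum.cong refl) (simp add: algebra_simps)
  also have "\<dots> = gram n C (Suc a) (Suc b) - ?g b * gram n C (Suc a) 0 - ?g a * gram n C 0 (Suc b)
      + ?g a * ?g b * gram n C 0 0"
    by (simp only: sum.distrib sum_subtractf sum_distrib_left[symmetric] gram_def[symmetric])
  also have "\<dots> = sweep (gram n C) a b"
    using assms unfolding sweep_def gram_commute[of n C "Suc a" 0] by (simp add: field_simps)
  finally show "sweep (gram n C) a b = gram n (\<lambda>i a. C i (Suc a) - ?g a * C i 0) a b" by simp
qed

text \<open>A zero pivot means that the current column vanished after the projections. Undoing the
  projections turns this into a linear relation between the original columns.\<close>

lemma degenerate_gram_null_vector:
  assumes "\<not> nondeg k (gram n C)"
  obtains h where "\<exists>a<k. h a \<noteq> 0" "\<And>i. i < n \<Longrightarrow> (\<Sum>a<k. h a * C i a) = 0"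
proof -
  have "\<exists>h. (\<exists>a<k. h a \<noteq> 0) \<and> (\<forall>i<n. (\<Sum>a<k. h a * C i a) = 0)"
    using assms
  proof (induction k arbitrary: C)
    case (Suc k)
    show ?case
    proof (cases "gram n C 0 0 = 0")
      case True
      then have "C i 0 = 0" if "i < n" for i
        using that by (auto simp: gram_def sum_nonneg_eq_0_iff)
      then show ?thesis
        by (intro exI[of _ "\<lambda>a. if a = 0 then 1 else 0"])
          (auto simp: if_distrib[of "\<lambda>t. t * _"] cong: if_cong)
    next
      case False
      let ?g = "\<lambda>a. gram n C 0 (Suc a) / gram n C 0 0"
      let ?D = "\<lambda>i a. C i (Suc a) - ?g a * C i 0"
      have "\<not> nondeg k (gram n ?D)" using Suc.prems False sweep_gram[OF False] by simp
      from Suc.IH[OF this] obtain h where h: "\<exists>a<k. h a \<noteq> 0" "\<And>i. i < n \<Longrightarrow> (\<Sum>a<k. h a * ?D i a) = 0"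
        by blast
      \<comment> \<open>The coefficient of column 0 gathers the multiples of that column which the
        projection had subtracted from the others.\<close>
      have "(\<Sum>a<Suc k. case_nat (- (\<Sum>a<k. h a * ?g a)) h a * C i a) = 0" if "i < n" for i
      proof -
        have "(\<Sum>a<k. h a * ?D i a) = (\<Sum>a<k. h a * C i (Suc a)) - (\<Sum>a<k. h a * ?g a) * C i 0"
          by (simp add: right_diff_distrib sum_subtractf sum_distrib_right mult.assoc)
        then show ?thesis using h(2)[OF that]
          by (simp add: sum.lessThan_Suc_shift del: sum.lessThan_Suc)
      qed
      moreover have "\<exists>a<Suc k. case_nat (- (\<Sum>a<k. h a * ?g a)) h a \<noteq> 0"
      proof -
        obtain a where "a < k" "h a \<noteq> 0" using h(1) by blast
        then show ?thesis by (intro exI[of _ "Suc a"]) simp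
      qed
      ultimately show ?thesis by blast
    qed
  qed simp
  then show ?thesis using that by blast
qed

text \<open>A linear relation between the columns lies in the kernel of the Gram matrix. Added to
  the solution it gives another solution, against the uniqueness in \<open>sol_iff\<close>.\<close>

lemma nondeg_gram_independent:
  assumes nd: "nondeg k (gram n C)" and h: "\<And>i. i < n \<Longrightarrow> (\<Sum>a<k. h a * C i a) = 0" and "a < k"
  shows "h a = 0"
proof -
  have "(\<Sum>b<k. gram n C a b * h b) = (\<Sum>i<n. C i a * (\<Sum>b<k. h b * C i b))" for a
    unfolding gram_def sum_distrib_left sum_distrib_right by (subst sum.swap) (simp add: mult_ac)
  also have "\<dots> a = 0" for a using h by simp
  finally have 0: "(\<Sum>b<k. gram n C a b * h b) = 0" for a .
  have s: "(\<Sum>b<k. gram n C a b * sol k (gram n C) b) = gram n C a k" if "a < k" for a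
    using sol_iff[OF nd, of "sol k (gram n C)"] that by blast
  have "\<forall>b<k. sol k (gram n C) b + h b = sol k (gram n C) b"
    by (subst sol_iff[OF nd, symmetric]) (auto simp: distrib_left sum.distrib s 0)
  then show ?thesis using \<open>a < k\<close> by simp
qed

text \<open>Pythagoras: the residual of column \<open>k\<close> is orthogonal to the earlier
  columns. The scale \<open>t\<close> is carried along because the noise will enter as \<tau> times
  column \<open>k\<close>; the minimizer in \<open>u\<close> is then \<open>t\<close> times
  \<open>sol\<close>.\<close>

lemma least_squares_decomposition:
  fixes C :: "nat \<Rightarrow> nat \<Rightarrow> real"
  assumes nd: "nondeg k (gram n C)"
  shows "(\<Sum>i<n. (t * C i k - (\<Sum>a<k. u a * C i a))\<^sup>2)
    = t\<^sup>2 * schur k (gram n C) + (\<Sum>i<n. (\<Sum>a<k. (u a - t * sol k (gram n C) a) * C i a)\<^sup>2)"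
proof -
  define v where "v = sol k (gram n C)"
  define r where "r i = C i k - (\<Sum>a<k. v a * C i a)" for i
  define w where "w i = (\<Sum>a<k. (u a - t * v a) * C i a)" for i
  have s: "(\<Sum>b<k. gram n C a b * v b) = gram n C a k" if "a < k" for a
    using sol_iff[OF nd, of v] that unfolding v_def by blast
  have rC: "(\<Sum>i<n. r i * C i a) = gram n C a k - (\<Sum>b<k. gram n C a b * v b)" for a
  proof -
    have "(\<Sum>b<k. gram n C a b * v b) = (\<Sum>i<n. (\<Sum>b<k. v b * C i b) * C i a)"
      unfolding gram_def sum_distrib_left sum_distrib_right by (subst sum.swap) (simp add: mult_ac)
    moreover have "gram n C a k = (\<Sum>i<n. C i k * C i a)" by (simp add: gram_def mult.commute)
    ultimately show ?thesis unfolding r_def left_diff_distrib sum_subtractf by simp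
  qed
  have orth: "(\<Sum>i<n. r i * C i a) = 0" if "a < k" for a
    unfolding rC using s[OF that] by simp
  have rw: "(\<Sum>i<n. r i * (\<Sum>a<k. g a * C i a)) = 0" for g
  proof -
    have "(\<Sum>i<n. r i * (\<Sum>a<k. g a * C i a)) = (\<Sum>a<k. g a * (\<Sum>i<n. r i * C i a))"
      unfolding sum_distrib_left by (subst sum.swap) (simp add: mult_ac)
    then show ?thesis by (simp add: orth)
  qed
  have "(\<Sum>i<n. (r i)\<^sup>2) = (\<Sum>i<n. r i * C i k - r i * (\<Sum>a<k. v a * C i a))"
    by (intro sum.cong refl) (simp add: r_def power2_eq_square algebra_simps)
  also have "\<dots> = schur k (gram n C)"
    unfolding sum_subtractf rw rC using schur_eq[OF nd s] by simp
  finally have rr: "(\<Sum>i<n. (r i)\<^sup>2) = schur k (gram n C)" .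
  have "(\<Sum>i<n. (t * C i k - (\<Sum>a<k. u a * C i a))\<^sup>2) = (\<Sum>i<n. t\<^sup>2 * (r i)\<^sup>2 - 2 * t * (r i * w i) + (w i)\<^sup>2)"
  proof (intro sum.cong refl)
    fix i
    have "w i = (\<Sum>a<k. u a * C i a) - t * (\<Sum>a<k. v a * C i a)"
      by (simp add: w_def left_diff_distrib sum_subtractf sum_distrib_left mult.assoc)
    then have e: "t * C i k - (\<Sum>a<k. u a * C i a) = t * r i - w i" by (simp add: r_def algebra_simps)
    show "(t * C i k - (\<Sum>a<k. u a * C i a))\<^sup>2 = t\<^sup>2 * (r i)\<^sup>2 - 2 * t * (r i * w i) + (w i)\<^sup>2"
      unfolding e by (simp add: power2_diff power_mult_distrib)
  qed
  also have "\<dots> = t\<^sup>2 * (\<Sum>i<n. (r i)\<^sup>2) - 2 * t * (\<Sum>i<n. r i * w i) + (\<Sum>i<n. (w i)\<^sup>2)"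
    by (simp add: sum.distrib sum_subtractf sum_distrib_left)
  also have "(\<Sum>i<n. r i * w i) = 0" unfolding w_def by (rule rw)
  finally show ?thesis by (simp add: rr w_def v_def)
qed

section \<open>Least squares for standard normal matrices\<close>

abbreviation gm :: "nat \<Rightarrow> (nat \<times> nat \<Rightarrow> real) \<Rightarrow> nat \<Rightarrow> nat \<Rightarrow> real" where
  "gm n W \<equiv> gram n (\<lambda>i a. W (i, a))"

text \<open>The variance inflation factor: the conditional prediction error is \<open>\<tau>\<^sup>2\<close> times this quantity.\<close>
definition vif :: "nat \<Rightarrow> (nat \<Rightarrow> nat \<Rightarrow> real) \<Rightarrow> real" where
  "vif k G = 1 + (\<Sum>a<k. (sol k G a)\<^sup>2)"

lemma vif_ge_1: "1 \<le> vif k G"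
  by (simp add: vif_def sum_nonneg)

lemma vif_pos: "0 < vif k G"
  using vif_ge_1[of k G] by linarith

section \<open>Peeling one row and one column off a standard normal matrix\<close>

text \<open>A reflection is its own inverse, so this rebuilds a matrix from its first column
  \<open>x\<close>, the first row \<open>g\<close> of the reflected remaining columns, and the rest
  \<open>Y\<close> of these columns. In this direction the map is linear in \<open>g\<close> and
  \<open>Y\<close> once \<open>x\<close> is fixed, which makes its characteristic function
  computable.\<close>

definition peel_inv :: "nat \<Rightarrow> (nat \<Rightarrow> real) \<Rightarrow> (nat \<Rightarrow> real) \<Rightarrow> (nat \<times> nat \<Rightarrow> real) \<Rightarrow> nat \<times> nat \<Rightarrow> real" where
  "peel_inv n x g Y = (\<lambda>(i, a). case a of 0 \<Rightarrow> x i
     | Suc a \<Rightarrow> hh (Suc n) x (case_nat (g a) (\<lambda>l. Y (l, a))) i)"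

lemma peel_inv_simps:
  "peel_inv n x g Y (i, 0) = x i"
  "peel_inv n x g Y (i, Suc a) = hh (Suc n) x (case_nat (g a) (\<lambda>l. Y (l, a))) i"
  by (simp_all add: peel_inv_def)

lemma measurable_gauss_component:
  "i \<in> I \<Longrightarrow> f \<in> measurable M (gauss I) \<Longrightarrow> (\<lambda>\<omega>. f \<omega> i) \<in> borel_measurable M"
  unfolding measurable_cong_sets[OF refl sets_gauss]
  by (rule measurable_component_singleton[THEN measurable_compose[rotated]])

text \<open>For fixed \<open>x\<close> the frequencies are merely reflected, so integrating out
  \<open>Y\<close> and then \<open>g\<close> leaves a factor whose exponent is the squared length of
  the frequencies. That length is free of \<open>x\<close>, and the integral over \<open>x\<close>
  splits off.\<close>

lemma std_gauss_family_peel_inv: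
  "std_gauss_family (gauss_mat n k \<Otimes>\<^sub>M (gauss_vec (Suc n) \<Otimes>\<^sub>M gauss {..k})) ({..<Suc n} \<times> {..Suc k})
     (\<lambda>p (Y, x, g). peel_inv n x g Y p)"
  unfolding std_gauss_family_def
proof (intro conjI allI ballI)
  let ?MY = "gauss_mat n k" and ?Mx = "gauss_vec (Suc n)" and ?Mg = "gauss {..k}"
  let ?M = "?MY \<Otimes>\<^sub>M (?Mx \<Otimes>\<^sub>M ?Mg)"
  interpret xg: pair_prob_space ?Mx ?Mg by (intro pair_prob_space.intro pair_sigma_finite.intro gauss.sigma_finite_measure_axioms prob_space_gauss)
  interpret Yxg: pair_prob_space ?MY "?Mx \<Otimes>\<^sub>M ?Mg"
    by (intro pair_prob_space.intro pair_sigma_finite.intro gauss.sigma_finite_measure_axioms prob_space_gauss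
        xg.sigma_finite_measure_axioms xg.prob_space_axioms)
  have comp: "(\<lambda>\<omega>. fst (snd \<omega>) i) \<in> borel_measurable ?M" if "i < Suc n" for i
    using that by (intro measurable_gauss_component[of i "{..<Suc n}"]) auto
  have comp': "(\<lambda>\<omega>. snd (snd \<omega>) a) \<in> borel_measurable ?M" "(\<lambda>\<omega>. fst \<omega> (l, a)) \<in> borel_measurable ?M"
    if "a \<le> k" "l < n" for a l
    using that by (auto intro!: measurable_gauss_component[of a "{..k}"] measurable_gauss_component[of "(l, a)" "{..<n} \<times> {..k}"])
  have meas: "(\<lambda>(Y, x, g). peel_inv n x g Y p) \<in> borel_measurable ?M" if pI: "p \<in> {..<Suc n} \<times> {..Suc k}" for p
  proof (cases "snd p")
    case 0
    then obtain i where p: "p = (i, 0)" "i < Suc n" using pI by (cases p) auto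
    show ?thesis unfolding p(1) peel_inv_simps split_beta' using p(2) by (rule comp)
  next
    case (Suc a)
    then obtain i where p: "p = (i, Suc a)" "i < Suc n" "a \<le> k" using pI by (cases p) auto
    show ?thesis unfolding p(1) peel_inv_simps split_beta'
    proof (rule measurable_hh[OF _ _ p(2)])
      fix i assume "i < Suc n"
      then show "(\<lambda>\<omega>. case_nat (snd (snd \<omega>) a) (\<lambda>l. fst \<omega> (l, a)) i) \<in> borel_measurable ?M"
        using p(3) comp' by (cases i) auto
    qed (rule comp)
  qed
  show "(\<lambda>(Y, x, g). peel_inv n x g Y p) \<in> borel_measurable ?M" if "p \<in> {..<Suc n} \<times> {..Suc k}" for p
    using that by (rule meas)
  fix t :: "nat \<times> nat \<Rightarrow> real"
  \<comment> \<open>The frequency vector of column \<open>Suc a\<close>, reflected: its entry 0 acts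
    on \<open>g a\<close>, its later entries act on column \<open>a\<close> of
    \<open>Y\<close>.\<close>
  define h where "h x a = hh (Suc n) x (\<lambda>i. t (i, Suc a))" for x a
  have split_sum: "(\<Sum>p\<in>{..<Suc n} \<times> {..Suc k}. q p) = (\<Sum>i<Suc n. q (i, 0)) + (\<Sum>a\<le>k. \<Sum>i<Suc n. q (i, Suc a))" for q :: "nat \<times> nat \<Rightarrow> real"
  proof -
    have "(\<Sum>p\<in>{..<Suc n} \<times> {..Suc k}. q p) = (\<Sum>i<Suc n. \<Sum>a\<le>Suc k. q (i, a))"
      by (simp add: sum.cartesian_product del: sum.lessThan_Suc sum.atMost_Suc)
    also have "\<dots> = (\<Sum>a\<le>Suc k. \<Sum>i<Suc n. q (i, a))" by (rule sum.swap)
    finally show ?thesis by (simp only: sum.atMost_Suc_shift)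
  qed
  have lin: "(\<Sum>p\<in>{..<Suc n} \<times> {..Suc k}. t p * peel_inv n x g Y p)
      = (\<Sum>i<Suc n. t (i, 0) * x i) + ((\<Sum>a\<le>k. h x a 0 * g a) + (\<Sum>p\<in>{..<n} \<times> {..k}. h x (snd p) (Suc (fst p)) * Y p))" for x g Y
  proof -
    have "(\<Sum>i<Suc n. t (i, Suc a) * hh (Suc n) x (case_nat (g a) (\<lambda>l. Y (l, a))) i)
        = h x a 0 * g a + (\<Sum>l<n. h x a (Suc l) * Y (l, a))" for a
      using hh_adjoint[of "Suc n" x "\<lambda>i. t (i, Suc a)" "case_nat (g a) (\<lambda>l. Y (l, a))", symmetric]
      unfolding h_def ip_def by (simp add: sum.lessThan_Suc_shift del: sum.lessThan_Suc)
    moreover have "(\<Sum>a\<le>k. \<Sum>l<n. h x a (Suc l) * Y (l, a)) = (\<Sum>p\<in>{..<n} \<times> {..k}. h x (snd p) (Suc (fst p)) * Y p)"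
      by (subst sum.swap) (simp add: sum.cartesian_product split_beta')
    ultimately show ?thesis
      unfolding split_sum peel_inv_simps by (simp add: sum.distrib del: sum.lessThan_Suc)
  qed
  \<comment> \<open>The dependence on \<open>x\<close> disappears here, because reflections preserve
    length.\<close>
  have sq: "(\<Sum>a\<le>k. (h x a 0)\<^sup>2) + (\<Sum>p\<in>{..<n} \<times> {..k}. (h x (snd p) (Suc (fst p)))\<^sup>2) = (\<Sum>a\<le>k. \<Sum>i<Suc n. (t (i, Suc a))\<^sup>2)" for x
  proof -
    have "(\<Sum>i<Suc n. (t (i, Suc a))\<^sup>2) = (h x a 0)\<^sup>2 + (\<Sum>l<n. (h x a (Suc l))\<^sup>2)" for a
      using hh_isometry[of "Suc n" x "\<lambda>i. t (i, Suc a)" "\<lambda>i. t (i, Suc a)", symmetric]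
      unfolding h_def ip_def by (simp add: sum.lessThan_Suc_shift power2_eq_square del: sum.lessThan_Suc)
    moreover have "(\<Sum>a\<le>k. \<Sum>l<n. (h x a (Suc l))\<^sup>2) = (\<Sum>p\<in>{..<n} \<times> {..k}. (h x (snd p) (Suc (fst p)))\<^sup>2)"
      by (subst sum.swap) (simp add: sum.cartesian_product split_beta')
    ultimately show ?thesis by (simp add: sum.distrib del: sum.lessThan_Suc)
  qed
  define E where "E \<omega> = iexp (\<Sum>p\<in>{..<Suc n} \<times> {..Suc k}. t p * (case \<omega> of (Y, x, g) \<Rightarrow> peel_inv n x g Y p))" for \<omega>
  have Em: "E \<in> borel_measurable ?M" unfolding E_def using meas by measurable
  have Ei: "integrable ?M E"
    using Em by (intro Yxg.P.integrable_const_bound[of _ 1]) (auto simp: E_def)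
  define A where "A x = iexp (\<Sum>i<Suc n. t (i, 0) * x i)" for x
  define e1 where "e1 x = complex_of_real (exp (- (\<Sum>p\<in>{..<n} \<times> {..k}. (h x (snd p) (Suc (fst p)))\<^sup>2) / 2))" for x
  have "(CLINT \<omega>|?M. E \<omega>) = (CLINT z|?Mx \<Otimes>\<^sub>M ?Mg. CLINT Y|?MY. E (Y, z))"
    using Yxg.integral_snd[of "\<lambda>Y z. E (Y, z)"] Ei by simp
  also have "(\<lambda>z. CLINT Y|?MY. E (Y, z)) = (\<lambda>z. A (fst z) * (iexp (\<Sum>a\<le>k. h (fst z) a 0 * snd z a) * e1 (fst z)))"
  proof
    fix z
    have "E (Y, z) = A (fst z) * (iexp (\<Sum>a\<le>k. h (fst z) a 0 * snd z a) * iexp (\<Sum>p\<in>{..<n} \<times> {..k}. h (fst z) (snd p) (Suc (fst p)) * Y p))" for Y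
      unfolding E_def A_def by (simp only: split_beta' fst_conv snd_conv lin) (simp add: distrib_left exp_add)
    then have "(CLINT Y|?MY. E (Y, z)) = A (fst z) * (iexp (\<Sum>a\<le>k. h (fst z) a 0 * snd z a) * (CLINT Y|?MY. iexp (\<Sum>p\<in>{..<n} \<times> {..k}. h (fst z) (snd p) (Suc (fst p)) * Y p)))"
      by (simp only: integral_mult_right_zero)
    then show "(CLINT Y|?MY. E (Y, z)) = A (fst z) * (iexp (\<Sum>a\<le>k. h (fst z) a 0 * snd z a) * e1 (fst z))"
      by (subst (asm) char_gauss) (simp_all only: e1_def finite_cartesian_product finite_lessThan finite_atMost)
  qed
  also have "(CLINT z|?Mx \<Otimes>\<^sub>M ?Mg. A (fst z) * (iexp (\<Sum>a\<le>k. h (fst z) a 0 * snd z a) * e1 (fst z)))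
      = (CLINT x|?Mx. CLINT g|?Mg. A x * (iexp (\<Sum>a\<le>k. h x a 0 * g a) * e1 x))"
  proof (subst xg.integral_fst'[symmetric])
    have [measurable]: "(\<lambda>z. h (fst z) a i) \<in> borel_measurable (?Mx \<Otimes>\<^sub>M ?Mg)" if "i < Suc n" for a i
      unfolding h_def using that by (intro measurable_hh) auto
    show "integrable (?Mx \<Otimes>\<^sub>M ?Mg) (\<lambda>z. A (fst z) * (iexp (\<Sum>a\<le>k. h (fst z) a 0 * snd z a) * e1 (fst z)))"
    proof (rule xg.P.integrable_const_bound[of _ 1])
      show "(\<lambda>z. A (fst z) * (iexp (\<Sum>a\<le>k. h (fst z) a 0 * snd z a) * e1 (fst z))) \<in> borel_measurable (?Mx \<Otimes>\<^sub>M ?Mg)"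
        unfolding A_def e1_def by measurable auto
    qed (auto simp: A_def e1_def norm_mult sum_nonneg)
  qed simp
  also have "\<dots> = (CLINT x|?Mx. A x * exp (- (\<Sum>a\<le>k. \<Sum>i<Suc n. (t (i, Suc a))\<^sup>2) / 2))"
  proof (intro Bochner_Integration.integral_cong refl)
    fix x
    have "(CLINT g|?Mg. A x * (iexp (\<Sum>a\<le>k. h x a 0 * g a) * e1 x)) = A x * (exp (- (\<Sum>a\<le>k. (h x a 0)\<^sup>2) / 2) * e1 x)"
      by (simp only: integral_mult_right_zero integral_mult_left_zero char_gauss finite_atMost)
    also have "complex_of_real (exp (- (\<Sum>a\<le>k. (h x a 0)\<^sup>2) / 2)) * e1 x = complex_of_real (exp (- (\<Sum>a\<le>k. \<Sum>i<Suc n. (t (i, Suc a))\<^sup>2) / 2))"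
      unfolding e1_def of_real_mult[symmetric] exp_add[symmetric] sq[of x, symmetric] by (simp add: field_simps)
    finally show "(CLINT g|?Mg. A x * (iexp (\<Sum>a\<le>k. h x a 0 * g a) * e1 x)) = A x * exp (- (\<Sum>a\<le>k. \<Sum>i<Suc n. (t (i, Suc a))\<^sup>2) / 2)" .
  qed
  also have "\<dots> = exp (- (\<Sum>i<Suc n. (t (i, 0))\<^sup>2) / 2) * complex_of_real (exp (- (\<Sum>a\<le>k. \<Sum>i<Suc n. (t (i, Suc a))\<^sup>2) / 2))"
    unfolding A_def by (simp only: integral_mult_left_zero char_gauss finite_lessThan)
  also have "\<dots> = exp (- (\<Sum>p\<in>{..<Suc n} \<times> {..Suc k}. (t p)\<^sup>2) / 2)"
    unfolding of_real_mult[symmetric] exp_add[symmetric] split_sum by (simp add: field_simps del: sum.lessThan_Suc)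
  finally show "(CLINT \<omega>|?M. iexp (\<Sum>p\<in>{..<Suc n} \<times> {..Suc k}. t p * (case \<omega> of (Y, x, g) \<Rightarrow> peel_inv n x g Y p)))
      = complex_of_real (exp (- (\<Sum>p\<in>{..<Suc n} \<times> {..Suc k}. (t p)\<^sup>2) / 2))"
    unfolding E_def .
qed

lemma nn_integral_peel:
  assumes F: "F \<in> borel_measurable (gauss_mat (Suc n) (Suc k))"
  shows "(\<integral>\<^sup>+W. F W \<partial>gauss_mat (Suc n) (Suc k))
    = (\<integral>\<^sup>+Y. \<integral>\<^sup>+x. \<integral>\<^sup>+g. F (restrict (peel_inv n x g Y) ({..<Suc n} \<times> {..Suc k}))
        \<partial>gauss {..k} \<partial>gauss_vec (Suc n) \<partial>gauss_mat n k)"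
proof -
  let ?I = "{..<Suc n} \<times> {..Suc k}"
  let ?MY = "gauss_mat n k" and ?Mx = "gauss_vec (Suc n)" and ?Mg = "gauss {..k}"
  let ?M = "?MY \<Otimes>\<^sub>M (?Mx \<Otimes>\<^sub>M ?Mg)"
  interpret xg: pair_prob_space ?Mx ?Mg by (intro pair_prob_space.intro pair_sigma_finite.intro gauss.sigma_finite_measure_axioms prob_space_gauss)
  interpret Yxg: pair_prob_space ?MY "?Mx \<Otimes>\<^sub>M ?Mg"
    by (intro pair_prob_space.intro pair_sigma_finite.intro gauss.sigma_finite_measure_axioms prob_space_gauss
        xg.sigma_finite_measure_axioms xg.prob_space_axioms)
  let ?R = "\<lambda>\<omega>. restrict (peel_inv n (fst (snd \<omega>)) (snd (snd \<omega>)) (fst \<omega>)) ?I"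
  have R: "?R \<in> measurable ?M (gauss ?I)"
    unfolding measurable_cong_sets[OF refl sets_gauss]
    using std_gauss_family_peel_inv[of n k] by (intro measurable_restrict) (auto simp: std_gauss_family_def split_beta')
  have FR: "(\<lambda>\<omega>. F (?R \<omega>)) \<in> borel_measurable ?M"
    by (rule measurable_compose[OF R F])
  have "(\<integral>\<^sup>+W. F W \<partial>gauss ?I) = (\<integral>\<^sup>+\<omega>. F (?R \<omega>) \<partial>?M)"
    using std_gauss_family_nn_integral[OF Yxg.prob_space_axioms _ std_gauss_family_peel_inv F]
    by (simp add: split_beta')
  also have "\<dots> = (\<integral>\<^sup>+Y. \<integral>\<^sup>+z. F (?R (Y, z)) \<partial>(?Mx \<Otimes>\<^sub>M ?Mg) \<partial>?MY)"
    by (rule xg.nn_integral_fst[OF FR, symmetric])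
  also have "\<dots> = (\<integral>\<^sup>+Y. \<integral>\<^sup>+x. \<integral>\<^sup>+g. F (?R (Y, x, g)) \<partial>?Mg \<partial>?Mx \<partial>?MY)"
  proof (rule nn_integral_cong)
    fix Y assume "Y \<in> space ?MY"
    from measurable_compose[OF measurable_Pair1'[OF this] FR]
    have "(\<lambda>z. F (?R (Y, z))) \<in> borel_measurable (?Mx \<Otimes>\<^sub>M ?Mg)" .
    from gauss.nn_integral_fst[OF this]
    show "(\<integral>\<^sup>+z. F (?R (Y, z)) \<partial>(?Mx \<Otimes>\<^sub>M ?Mg)) = (\<integral>\<^sup>+x. \<integral>\<^sup>+g. F (?R (Y, x, g)) \<partial>?Mg \<partial>?Mx)"
      by simp
  qed
  finally show ?thesis by simp
qed

text \<open>Scalar products may be taken after reflecting, where column 0 is \<open>|x|\<close>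
  times a unit vector. Hence \<open>g\<close> enters the remaining Gram matrix as the rank one term
  \<open>g a * g b\<close>, which is exactly what elimination of column 0 removes. Back substitution
  adds one new coefficient, the residual of \<open>g k\<close> divided by
  \<open>|x|\<close>.\<close>

lemma gram_peel_inv:
  fixes x g :: "nat \<Rightarrow> real" and Y :: "nat \<times> nat \<Rightarrow> real" and n k :: nat
  assumes x: "ip (Suc n) x x \<noteq> 0"
  defines "W \<equiv> restrict (peel_inv n x g Y) ({..<Suc n} \<times> {..Suc k})"
  shows "nondeg (Suc k) (gm (Suc n) W) = nondeg k (gm n Y)"
    and "schur (Suc k) (gm (Suc n) W) = schur k (gm n Y)"
    and "vif (Suc k) (gm (Suc n) W)
      = vif k (gm n Y) + (g k - (\<Sum>a<k. sol k (gm n Y) a * g a))\<^sup>2 / ip (Suc n) x x"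
proof -
  define G where "G = gm (Suc n) (peel_inv n x g Y)"
  have WG: "gm (Suc n) W i j = G i j" if "i \<le> Suc k" "j \<le> Suc k" for i j
    using that unfolding G_def W_def gram_def by (intro sum.cong) auto
  let ?s = "sqrt (ip (Suc n) x x)"
  let ?y = "\<lambda>a. case_nat (g a) (\<lambda>l. Y (l, a))"
  have ss: "?s * ?s = ip (Suc n) x x" "?s \<noteq> 0" using x by simp_all
  have cancel: "(c * p) * (c * q) / (c * c) = p * q" "c * p / (c * c) = p / c" if "c \<noteq> 0" for c p q :: real
    using that by simp_all
  have G00: "G 0 0 = ip (Suc n) x x"
    unfolding G_def gram_def peel_inv_simps by (simp add: ip_def)
  have G0: "G 0 (Suc a) = ?s * g a" for a
  proof -
    have "G 0 (Suc a) = ip (Suc n) x (hh (Suc n) x (?y a))"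
      unfolding G_def gram_def peel_inv_simps ip_def ..
    also have "\<dots> = ip (Suc n) (hh (Suc n) x x) (?y a)" by (simp add: hh_adjoint)
    also have "\<dots> = ip (Suc n) (\<lambda>i. if i = 0 then ?s else 0) (?y a)"
      by (intro ip_cong) (simp_all add: hh_self)
    finally show ?thesis
      by (simp add: ip_def if_distrib[of "\<lambda>t. t * _"] del: sum.lessThan_Suc cong: if_cong)
  qed
  have G0': "G (Suc a) 0 = ?s * g a" for a
    using G0[of a] unfolding G_def by (subst gram_commute)
  have GS: "G (Suc a) (Suc b) = g a * g b + gm n Y a b" for a b
  proof -
    have "G (Suc a) (Suc b) = ip (Suc n) (hh (Suc n) x (?y a)) (hh (Suc n) x (?y b))"
      unfolding G_def gram_def peel_inv_simps ip_def ..
    also have "\<dots> = ip (Suc n) (?y a) (?y b)" by (rule hh_isometry)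
    finally show ?thesis unfolding ip_Suc_shift by (simp add: ip_def gram_def)
  qed
  have sw: "sweep G = gm n Y"
  proof (intro ext)
    fix a b
    have "sweep G a b = g a * g b + gm n Y a b - (?s * g a) * (?s * g b) / (?s * ?s)"
      unfolding sweep_def G00 G0 G0' GS ss(1) ..
    also have "\<dots> = gm n Y a b" by (simp only: cancel(1)[OF ss(2)])
    finally show "sweep G a b = gm n Y a b" .
  qed
  have cong: "nondeg (Suc k) (gm (Suc n) W) = nondeg (Suc k) G" "schur (Suc k) (gm (Suc n) W) = schur (Suc k) G"
    "sol (Suc k) (gm (Suc n) W) = sol (Suc k) G"
    using WG by (intro nondeg_schur_sol_cong; blast)+
  show "nondeg (Suc k) (gm (Suc n) W) = nondeg k (gm n Y)"
    using cong(1) x by (simp add: sw G00)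
  show "schur (Suc k) (gm (Suc n) W) = schur k (gm n Y)"
    using cong(2) by (simp add: sw)
  have sol0: "sol (Suc k) G 0 = (g k - (\<Sum>a<k. sol k (gm n Y) a * g a)) / ?s"
  proof -
    have "sol (Suc k) G 0 = (?s * g k - (\<Sum>a<k. ?s * g a * sol k (gm n Y) a)) / ip (Suc n) x x"
      by (simp add: sw G00 G0)
    also have "(\<Sum>a<k. ?s * g a * sol k (gm n Y) a) = ?s * (\<Sum>a<k. sol k (gm n Y) a * g a)"
      by (simp add: sum_distrib_left mult_ac)
    also have "(?s * g k - ?s * (\<Sum>a<k. sol k (gm n Y) a * g a)) / ip (Suc n) x x
        = ?s * (g k - (\<Sum>a<k. sol k (gm n Y) a * g a)) / (?s * ?s)"
      unfolding ss(1) right_diff_distrib ..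
    also have "\<dots> = (g k - (\<Sum>a<k. sol k (gm n Y) a * g a)) / ?s" by (rule cancel(2)[OF ss(2)])
    finally show ?thesis .
  qed
  have "vif (Suc k) (gm (Suc n) W) = 1 + ((sol (Suc k) G 0)\<^sup>2 + (\<Sum>a<k. (sol k (gm n Y) a)\<^sup>2))"
    unfolding vif_def unfolding cong(3) unfolding sum.lessThan_Suc_shift by (simp add: sw)
  then show "vif (Suc k) (gm (Suc n) W)
      = vif k (gm n Y) + (g k - (\<Sum>a<k. sol k (gm n Y) a * g a))\<^sup>2 / ip (Suc n) x x"
    unfolding sol0 by (simp add: vif_def power_divide)
qed

section \<open>Laws of \<open>schur\<close> and \<open>vif\<close> for a standard normal
  matrix\<close>

lemma measurable_gm:
  assumes "a \<le> k" "b \<le> k"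
  shows "(\<lambda>W. gm n W a b) \<in> borel_measurable (gauss_mat n k)"
  unfolding gram_def using assms
  by (intro borel_measurable_sum borel_measurable_times measurable_gauss_component[of _ "{..<n} \<times> {..k}"]) auto

lemmas measurable_gm_nondeg_schur_sol [measurable] =
  measurable_nondeg_schur_sol[of k "\<lambda>W. gm n W" "gauss_mat n k" for n k, OF measurable_gm]

lemma measurable_vif [measurable]: "(\<lambda>W. vif k (gm n W)) \<in> borel_measurable (gauss_mat n k)"
  unfolding vif_def by measurable

lemma nn_integral_gauss_const_AE:
  fixes c :: ennreal
  assumes "\<And>x g. ip (Suc n) x x \<noteq> 0 \<Longrightarrow> F x g = c"
  shows "(\<integral>\<^sup>+x. \<integral>\<^sup>+g. F x g \<partial>gauss J \<partial>gauss_vec (Suc n)) = c"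
proof -
  have "(\<integral>\<^sup>+x. \<integral>\<^sup>+g. F x g \<partial>gauss J \<partial>gauss_vec (Suc n)) = (\<integral>\<^sup>+x. c \<partial>gauss_vec (Suc n))"
    using AE_gauss_ip_ne_0[of "Suc n"]
    by (intro nn_integral_cong_AE) (auto elim!: eventually_mono simp: assms gauss.emeasure_space_1)
  then show ?thesis by (simp add: gauss.emeasure_space_1)
qed

lemma AE_gauss_nondeg:
  assumes "k \<le> n"
  shows "AE W in gauss_mat n k. nondeg k (gm n W)"
proof -
  \<comment> \<open>The almost sure statement is recast as a vanishing integral, to which
    \<open>nn_integral_peel\<close> applies.\<close>
  let ?F = "\<lambda>k n W. if nondeg k (gm n W) then 0 else (1 :: ennreal)"
  have "(\<integral>\<^sup>+W. ?F k n W \<partial>gauss_mat n k) = 0"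
    using assms
  proof (induction k arbitrary: n)
    case (Suc k)
    then obtain n' where n: "n = Suc n'" "k \<le> n'" by (cases n) auto
    have "(\<integral>\<^sup>+W. ?F (Suc k) n W \<partial>gauss_mat n (Suc k))
        = (\<integral>\<^sup>+Y. \<integral>\<^sup>+x. \<integral>\<^sup>+g. ?F (Suc k) n (restrict (peel_inv n' x g Y) ({..<n} \<times> {..Suc k}))
        \<partial>gauss {..k} \<partial>gauss_vec n \<partial>gauss_mat n' k)"
      unfolding n by (rule nn_integral_peel) measurable
    also have "\<dots> = (\<integral>\<^sup>+Y. ?F k n' Y \<partial>gauss_mat n' k)"
      unfolding n by (rule nn_integral_cong, rule nn_integral_gauss_const_AE) (simp only: gram_peel_inv not_False_eq_True)
    also have "\<dots> = 0" by (rule Suc.IH[OF n(2)])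
    finally show ?case .
  qed simp
  then show ?thesis
    by (subst (asm) nn_integral_0_iff_AE) (auto split: if_splits elim: eventually_mono)
qed

text \<open>Peeling leaves \<open>schur\<close> unchanged while \<open>n\<close> and
  \<open>k\<close> drop together. At \<open>k = 0\<close> it is the squared length of a single
  column with \<open>n - k\<close> entries.\<close>

lemma nn_integral_gauss_schur:
  assumes "k \<le> n" and f: "f \<in> borel_measurable borel"
  shows "(\<integral>\<^sup>+W. f (schur k (gm n W)) \<partial>gauss_mat n k) = (\<integral>\<^sup>+x. f (ip (n - k) x x) \<partial>gauss_vec (n - k))"
  using assms(1)
proof (induction k arbitrary: n)
  case 0
  have "(\<integral>\<^sup>+W. f (ip n (\<lambda>i\<in>{..<n}. W (i, 0)) (\<lambda>i\<in>{..<n}. W (i, 0))) \<partial>gauss_mat n (0 :: nat)) = (\<integral>\<^sup>+x. f (ip n x x) \<partial>gauss_vec n)"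
    using f by (intro nn_integral_gauss_reindex[of _ "\<lambda>i. (i, 0)"]) (auto intro!: inj_onI finite_cartesian_product measurable_compose[OF measurable_ip_gauss(2)])
  then show ?case by (simp add: gram_def ip_def)
next
  case (Suc k)
  then obtain n' where n: "n = Suc n'" "k \<le> n'" by (cases n) auto
  note [measurable] = f
  have "(\<integral>\<^sup>+W. f (schur (Suc k) (gm n W)) \<partial>gauss_mat n (Suc k))
      = (\<integral>\<^sup>+Y. \<integral>\<^sup>+x. \<integral>\<^sup>+g. f (schur (Suc k) (gm n (restrict (peel_inv n' x g Y) ({..<n} \<times> {..Suc k}))))
      \<partial>gauss {..k} \<partial>gauss_vec n \<partial>gauss_mat n' k)"
    unfolding n by (rule nn_integral_peel) measurable
  also have "\<dots> = (\<integral>\<^sup>+Y. f (schur k (gm n' Y)) \<partial>gauss_mat n' k)"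
    unfolding n by (rule nn_integral_cong, rule nn_integral_gauss_const_AE) (simp only: gram_peel_inv not_False_eq_True)
  also have "\<dots> = (\<integral>\<^sup>+x. f (ip (n - Suc k) x x) \<partial>gauss_vec (n - Suc k))"
    using Suc.IH[OF n(2)] by (simp add: n(1))
  finally show ?case .
qed

text \<open>One elimination step for \<open>vif\<close>, with \<open>V\<close> its previous value.
  The residual of \<open>g k\<close> is \<open>sqrt V\<close> times a standard normal
  \<open>z\<close> independent of \<open>x\<close>, so the denominator is
  \<open>V * (1 + z^2 / |x|^2)\<close>. The factor \<open>|x|^2 / (|x|^2 + z^2)\<close> is a beta
  variable, and \<open>nn_integral_gauss_beta\<close> absorbs it into \<open>|T|^2\<close> at the
  cost of one dimension.\<close>

lemma nn_integral_gauss_scaled_ratio: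
  fixes v :: "nat \<Rightarrow> real" and f :: "real \<Rightarrow> ennreal" and k :: nat
  assumes [measurable]: "f \<in> borel_measurable borel"
  defines "V \<equiv> 1 + (\<Sum>a<k. (v a)\<^sup>2)"
  shows "(\<integral>\<^sup>+x. \<integral>\<^sup>+g. \<integral>\<^sup>+T. f (ip (Suc (Suc n)) T T / (V + (g k - (\<Sum>a<k. v a * g a))\<^sup>2 / ip (Suc n) x x))
      \<partial>gauss_vec (Suc (Suc n)) \<partial>gauss {..k} \<partial>gauss_vec (Suc n))
    = (\<integral>\<^sup>+T. f (ip (Suc n) T T / V) \<partial>gauss_vec (Suc n))"
proof -
  let ?n2 = "Suc (Suc n)"
  let ?Mx = "gauss_vec (Suc n)" and ?Mg = "gauss {..k}" and ?MT = "gauss_vec ?n2"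
  have V: "0 < V" unfolding V_def by (simp add: add_pos_nonneg sum_nonneg)
  interpret xg: pair_prob_space ?Mx ?Mg by (intro pair_prob_space.intro pair_sigma_finite.intro gauss.sigma_finite_measure_axioms prob_space_gauss)
  \<comment> \<open>The unit vector in direction \<open>(- v, 1)\<close>. The residual of
    \<open>g k\<close> divided by \<open>sqrt V\<close> is its scalar product with \<open>g\<close>,
    hence standard normal.\<close>
  define c where "c a = (if a < k then - v a else 1) / sqrt V" for a
  have cs: "(\<Sum>a\<le>k. c a * g a) = (g k - (\<Sum>a<k. v a * g a)) / sqrt V" for g :: "nat \<Rightarrow> real"
    by (simp add: lessThan_Suc_atMost[symmetric] c_def sum_divide_distrib diff_divide_distrib sum_negf)
  have c1: "(\<Sum>a\<le>k. (s * c a)\<^sup>2) = s\<^sup>2" for s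
  proof -
    have "(\<Sum>a\<le>k. (s * c a)\<^sup>2) = s\<^sup>2 * ((\<Sum>a<k. (v a)\<^sup>2) / V + 1 / V)"
      using V by (simp add: lessThan_Suc_atMost[symmetric] c_def power_mult_distrib power_divide sum_divide_distrib
          sum_distrib_left distrib_left)
    also have "(\<Sum>a<k. (v a)\<^sup>2) / V + 1 / V = 1"
      using V by (simp add: add_divide_distrib[symmetric]) (simp add: V_def)
    finally show ?thesis by simp
  qed
  define X where "X i z = (case i of 0 \<Rightarrow> (\<Sum>a\<le>k. c a * snd z a) | Suc i \<Rightarrow> fst z i)"
    for i :: nat and z :: "(nat \<Rightarrow> real) \<times> (nat \<Rightarrow> real)"
  have XX: "(\<Sum>i<?n2. t i * X i z) = (\<Sum>i<Suc n. t (Suc i) * fst z i) + (\<Sum>a\<le>k. t 0 * c a * snd z a)" for t z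
    by (simp add: sum.lessThan_Suc_shift[of _ "Suc n"] X_def sum_distrib_left mult.assoc del: sum.lessThan_Suc sum.atMost_Suc)
  have fam: "std_gauss_family (?Mx \<Otimes>\<^sub>M ?Mg) {..<?n2} X"
    unfolding std_gauss_family_def
  proof (intro conjI ballI allI)
    fix i assume "i \<in> {..<?n2}"
    then show "X i \<in> borel_measurable (?Mx \<Otimes>\<^sub>M ?Mg)"
      unfolding X_def
      by (cases i) (auto intro!: borel_measurable_sum borel_measurable_times measurable_gauss_component[of _ "{..k}"]
          measurable_gauss_component[of _ "{..<Suc n}"] simp del: sum.atMost_Suc)
  next
    fix t :: "nat \<Rightarrow> real"
    have "(CLINT z|?Mx \<Otimes>\<^sub>M ?Mg. iexp (\<Sum>i<?n2. t i * X i z))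
        = (CLINT z|?Mx \<Otimes>\<^sub>M ?Mg. iexp (\<Sum>i<Suc n. t (Suc i) * fst z i) * iexp (\<Sum>a\<le>k. t 0 * c a * snd z a))"
      unfolding XX by (simp only: of_real_add distrib_left exp_add)
    also have "\<dots> = (CLINT x|?Mx. CLINT g|?Mg. iexp (\<Sum>i<Suc n. t (Suc i) * x i) * iexp (\<Sum>a\<le>k. t 0 * c a * g a))"
    proof (subst xg.integral_fst'[symmetric])
      show "integrable (?Mx \<Otimes>\<^sub>M ?Mg) (\<lambda>z. iexp (\<Sum>i<Suc n. t (Suc i) * fst z i) * iexp (\<Sum>a\<le>k. t 0 * c a * snd z a))"
      proof (rule xg.P.integrable_const_bound[of _ 1])
        show "(\<lambda>z. iexp (\<Sum>i<Suc n. t (Suc i) * fst z i) * iexp (\<Sum>a\<le>k. t 0 * c a * snd z a)) \<in> borel_measurable (?Mx \<Otimes>\<^sub>M ?Mg)"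
          by measurable
      qed (auto simp: norm_mult)
    qed simp
    also have "\<dots> = complex_of_real (exp (- (\<Sum>i<Suc n. (t (Suc i))\<^sup>2) / 2)) * complex_of_real (exp (- (\<Sum>a\<le>k. (t 0 * c a)\<^sup>2) / 2))"
      by (simp only: integral_mult_right_zero integral_mult_left_zero char_gauss finite_atMost finite_lessThan)
    also have "\<dots> = exp (- (\<Sum>i<?n2. (t i)\<^sup>2) / 2)"
      unfolding c1 of_real_mult[symmetric] exp_add[symmetric] sum.lessThan_Suc_shift[of _ "Suc n"]
      by (simp add: field_simps del: sum.lessThan_Suc)
    finally show "(CLINT z|?Mx \<Otimes>\<^sub>M ?Mg. iexp (\<Sum>i<?n2. t i * X i z)) = complex_of_real (exp (- (\<Sum>i<?n2. (t i)\<^sup>2) / 2))" .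
  qed
  \<comment> \<open>Everything is expressed by the single vector \<open>W = (z, x)\<close>:
    \<open>W 0\<close> is the normalized residual, and \<open>|W|^2 - (W 0)^2\<close> is
    \<open>|x|^2\<close>.\<close>
  define F where "F W = (\<integral>\<^sup>+T. f (ip ?n2 T T / (V + V * (W 0)\<^sup>2 / (ip ?n2 W W - (W 0)\<^sup>2))) \<partial>?MT)" for W
  have [measurable]: "(\<lambda>z. ip ?n2 (snd z) (snd z)) \<in> borel_measurable (?MT \<Otimes>\<^sub>M ?MT)"
    "(\<lambda>z. ip ?n2 (fst z) (fst z)) \<in> borel_measurable (?MT \<Otimes>\<^sub>M ?MT)"
    unfolding ip_def by measurable
  have jm: "(\<lambda>z. f (ip ?n2 (snd z) (snd z) / (V + V * (fst z 0)\<^sup>2 / (ip ?n2 (fst z) (fst z) - (fst z 0)\<^sup>2))))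
      \<in> borel_measurable (?MT \<Otimes>\<^sub>M ?MT)" by measurable
  have Fm: "F \<in> borel_measurable ?MT"
    unfolding F_def using jm by (intro gauss.borel_measurable_nn_integral) (simp add: split_beta')
  have X0: "X 0 z = (snd z k - (\<Sum>a<k. v a * snd z a)) / sqrt V" for z
    by (simp add: X_def cs)
  have Xip: "ip ?n2 (\<lambda>i\<in>{..<?n2}. X i z) (\<lambda>i\<in>{..<?n2}. X i z) - (X 0 z)\<^sup>2 = ip (Suc n) (fst z) (fst z)" for z
    by (simp only: ip_restrict ip_Suc_shift[of "Suc n"]) (simp add: X_def power2_eq_square)
  have FX: "F (\<lambda>i\<in>{..<?n2}. X i z) = (\<integral>\<^sup>+T. f (ip ?n2 T T / (V + (snd z k - (\<Sum>a<k. v a * snd z a))\<^sup>2 / ip (Suc n) (fst z) (fst z))) \<partial>?MT)" for z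
  proof -
    have "V * (X 0 z)\<^sup>2 = (snd z k - (\<Sum>a<k. v a * snd z a))\<^sup>2"
      unfolding X0 using V by (simp add: power_divide)
    then show ?thesis unfolding F_def using Xip[of z] by simp
  qed
  have "(\<lambda>\<omega>. \<lambda>i\<in>{..<?n2}. X i \<omega>) \<in> measurable (?Mx \<Otimes>\<^sub>M ?Mg) ?MT"
    unfolding measurable_cong_sets[OF refl sets_gauss]
    using fam by (intro measurable_restrict) (auto simp: std_gauss_family_def)
  from measurable_compose[OF this Fm]
  have FXm: "(\<lambda>z. F (\<lambda>i\<in>{..<?n2}. X i z)) \<in> borel_measurable (?Mx \<Otimes>\<^sub>M ?Mg)" .
  have "(\<integral>\<^sup>+x. \<integral>\<^sup>+g. \<integral>\<^sup>+T. f (ip ?n2 T T / (V + (g k - (\<Sum>a<k. v a * g a))\<^sup>2 / ip (Suc n) x x)) \<partial>?MT \<partial>?Mg \<partial>?Mx)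
      = (\<integral>\<^sup>+x. \<integral>\<^sup>+g. F (\<lambda>i\<in>{..<?n2}. X i (x, g)) \<partial>?Mg \<partial>?Mx)"
    unfolding FX by simp
  also have "\<dots> = (\<integral>\<^sup>+z. F (\<lambda>i\<in>{..<?n2}. X i z) \<partial>(?Mx \<Otimes>\<^sub>M ?Mg))"
    by (rule gauss.nn_integral_fst[OF FXm])
  also have "\<dots> = (\<integral>\<^sup>+W. F W \<partial>?MT)"
    by (rule std_gauss_family_nn_integral[OF xg.prob_space_axioms _ fam Fm]) simp
  also have "\<dots> = (\<integral>\<^sup>+W. \<integral>\<^sup>+T. f (ip ?n2 T T * (1 - (W 0)\<^sup>2 / ip ?n2 W W) / V) \<partial>?MT \<partial>?MT)"
  \<comment> \<open>\<open>W 1\<close> is the first entry of the \<open>x\<close> part, so excluding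
    its zero keeps \<open>|x|^2\<close> positive in the denominator.\<close>
  proof (rule nn_integral_cong_AE, rule AE_mp[OF AE_gauss_component_ne_0[of 1] AE_I2])
    fix W :: "nat \<Rightarrow> real"
    show "W 1 \<noteq> 0 \<longrightarrow> F W = (\<integral>\<^sup>+T. f (ip ?n2 T T * (1 - (W 0)\<^sup>2 / ip ?n2 W W) / V) \<partial>?MT)"
    proof
      assume W: "W 1 \<noteq> 0"
      define q where "q = ip (Suc n) (\<lambda>i. W (Suc i)) (\<lambda>i. W (Suc i))"
      have q: "q \<noteq> 0" using W unfolding q_def ip_eq_0 by auto
      then have q: "0 < q" using ip_nonneg[of "Suc n" "\<lambda>i. W (Suc i)"] unfolding q_def by linarith
      have W2: "ip ?n2 W W = q + (W 0)\<^sup>2"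
        by (simp add: ip_Suc_shift[of "Suc n"] q_def power2_eq_square)
      have p: "0 < q + (W 0)\<^sup>2" using q by (simp add: add_pos_nonneg)
      have e: "t / (V + V * (W 0)\<^sup>2 / q) = t * (1 - (W 0)\<^sup>2 / (q + (W 0)\<^sup>2)) / V" for t
      proof -
        have "V + V * (W 0)\<^sup>2 / q = V * ((q + (W 0)\<^sup>2) / q)" using q by (simp add: field_simps)
        moreover have "1 - (W 0)\<^sup>2 / (q + (W 0)\<^sup>2) = q / (q + (W 0)\<^sup>2)" using p by (simp add: field_simps)
        ultimately show ?thesis by simp
      qed
      show "F W = (\<integral>\<^sup>+T. f (ip ?n2 T T * (1 - (W 0)\<^sup>2 / ip ?n2 W W) / V) \<partial>?MT)"
        unfolding F_def W2 by (simp add: e)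
    qed
  qed simp
  also have "\<dots> = (\<integral>\<^sup>+T. f (ip (Suc n) T T / V) \<partial>?Mx)"
    by (rule nn_integral_gauss_beta[of "\<lambda>t. f (t / V)" "Suc n"]) measurable
  finally show ?thesis .
qed

text \<open>Each peeling step lowers \<open>k\<close>, \<open>n\<close> and the dimension of
  \<open>T\<close> by one. At \<open>k = 0\<close> the factor \<open>vif\<close> is 1 and only
  \<open>T\<close> is left.\<close>

lemma nn_integral_gauss_vif:
  assumes "k \<le> n" and f: "f \<in> borel_measurable borel"
  shows "(\<integral>\<^sup>+W. \<integral>\<^sup>+T. f (ip (Suc n) T T / vif k (gm n W)) \<partial>gauss_vec (Suc n) \<partial>gauss_mat n k)
    = (\<integral>\<^sup>+x. f (ip (Suc n - k) x x) \<partial>gauss_vec (Suc n - k))"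
  using assms
proof (induction k arbitrary: n f)
  case 0
  then show ?case by (simp add: vif_def gauss.emeasure_space_1)
next
  case (Suc k)
  then obtain n' where n: "n = Suc n'" "k \<le> n'" by (cases n) auto
  note [measurable] = Suc.prems(2)
  let ?MT = "gauss_vec (Suc n)" and ?MW = "gauss_mat n (Suc k)"
  let ?F = "\<lambda>W. \<integral>\<^sup>+T. f (ip (Suc n) T T / vif (Suc k) (gm n W)) \<partial>?MT"
  have "(\<lambda>z. f (ip (Suc n) (snd z) (snd z) / vif (Suc k) (gm n (fst z)))) \<in> borel_measurable (?MW \<Otimes>\<^sub>M ?MT)"
    using measurable_compose[OF measurable_snd measurable_ip_gauss(2)] measurable_compose[OF measurable_fst measurable_vif]
    by measurable
  then have Fm: "?F \<in> borel_measurable ?MW"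
    by (intro gauss.borel_measurable_nn_integral) (simp add: split_beta')
  have "(\<integral>\<^sup>+W. ?F W \<partial>?MW) = (\<integral>\<^sup>+Y. \<integral>\<^sup>+x. \<integral>\<^sup>+g. ?F (restrict (peel_inv n' x g Y) ({..<n} \<times> {..Suc k}))
      \<partial>gauss {..k} \<partial>gauss_vec n \<partial>gauss_mat n' k)"
    using Fm unfolding n by (rule nn_integral_peel)
  also have "\<dots> = (\<integral>\<^sup>+Y. \<integral>\<^sup>+x. \<integral>\<^sup>+g. \<integral>\<^sup>+T. f (ip (Suc n) T T /
        (1 + (\<Sum>a<k. (sol k (gm n' Y) a)\<^sup>2) + (g k - (\<Sum>a<k. sol k (gm n' Y) a * g a))\<^sup>2 / ip n x x))
      \<partial>?MT \<partial>gauss {..k} \<partial>gauss_vec n \<partial>gauss_mat n' k)"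
    unfolding n
  proof (rule nn_integral_cong, rule nn_integral_cong_AE, rule AE_mp[OF AE_gauss_ip_ne_0 AE_I2], simp, rule impI)
    fix Y :: "nat \<times> nat \<Rightarrow> real" and x :: "nat \<Rightarrow> real" assume x: "ip (Suc n') x x \<noteq> 0"
    show "(\<integral>\<^sup>+g. \<integral>\<^sup>+T. f (ip (Suc (Suc n')) T T / vif (Suc k) (gm (Suc n') (restrict (peel_inv n' x g Y) ({..<Suc n'} \<times> {..Suc k}))))
        \<partial>gauss_vec (Suc (Suc n')) \<partial>gauss {..k})
      = (\<integral>\<^sup>+g. \<integral>\<^sup>+T. f (ip (Suc (Suc n')) T T /
        (1 + (\<Sum>a<k. (sol k (gm n' Y) a)\<^sup>2) + (g k - (\<Sum>a<k. sol k (gm n' Y) a * g a))\<^sup>2 / ip (Suc n') x x))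
        \<partial>gauss_vec (Suc (Suc n')) \<partial>gauss {..k})"
      unfolding gram_peel_inv(3)[OF x] unfolding vif_def ..
  qed
  also have "\<dots> = (\<integral>\<^sup>+Y. \<integral>\<^sup>+T. f (ip (Suc n') T T / vif k (gm n' Y)) \<partial>gauss_vec (Suc n') \<partial>gauss_mat n' k)"
    unfolding n vif_def by (intro nn_integral_cong nn_integral_gauss_scaled_ratio Suc.prems(2))
  also have "\<dots> = (\<integral>\<^sup>+x. f (ip (Suc n' - k) x x) \<partial>gauss_vec (Suc n' - k))"
    by (rule Suc.IH[OF n(2) Suc.prems(2)])
  finally show ?case by (simp add: n(1))
qed

text \<open>The choice \<open>f t = 1 / t\<close> separates \<open>vif\<close> from
  \<open>T\<close>, so the mean of \<open>vif\<close> is a quotient of two inverse chi-square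
  moments. The smaller dimension \<open>Suc n - k\<close> is at least 3.\<close>

lemma nn_integral_vif:
  assumes "k + 2 \<le> n"
  shows "(\<integral>\<^sup>+W. ennreal (vif k (gm n W)) \<partial>gauss_mat n k) = ennreal ((real n - 1) / (real n - 1 - real k))"
proof -
  let ?MW = "gauss_mat n k"
  have "(\<integral>\<^sup>+W. \<integral>\<^sup>+T. ennreal (1 / (ip (Suc n) T T / vif k (gm n W))) \<partial>gauss_vec (Suc n) \<partial>?MW)
      = (\<integral>\<^sup>+x. ennreal (1 / ip (Suc n - k) x x) \<partial>gauss_vec (Suc n - k))"
    using assms by (intro nn_integral_gauss_vif[where f = "\<lambda>t. ennreal (1 / t)"]) auto
  also have "\<dots> = ennreal (1 / (real (Suc n - k) - 2))"
    using assms by (intro nn_integral_gauss_inverse) auto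
  also have "(\<integral>\<^sup>+W. \<integral>\<^sup>+T. ennreal (1 / (ip (Suc n) T T / vif k (gm n W))) \<partial>gauss_vec (Suc n) \<partial>?MW)
      = (\<integral>\<^sup>+W. ennreal (vif k (gm n W)) * ennreal (1 / (real (Suc n) - 2)) \<partial>?MW)"
  proof (rule nn_integral_cong)
    fix W
    have "(\<integral>\<^sup>+T. ennreal (1 / (ip (Suc n) T T / vif k (gm n W))) \<partial>gauss_vec (Suc n))
        = (\<integral>\<^sup>+T. ennreal (vif k (gm n W)) * ennreal (1 / ip (Suc n) T T) \<partial>gauss_vec (Suc n))"
      using vif_pos[of k "gm n W"] by (simp add: ennreal_mult'[symmetric] less_imp_le)
    also have "\<dots> = ennreal (vif k (gm n W)) * (\<integral>\<^sup>+T. ennreal (1 / ip (Suc n) T T) \<partial>gauss_vec (Suc n))"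
      by (rule nn_integral_cmult) measurable
    also have "(\<integral>\<^sup>+T. ennreal (1 / ip (Suc n) T T) \<partial>gauss_vec (Suc n)) = ennreal (1 / (real (Suc n) - 2))"
      using assms by (intro nn_integral_gauss_inverse) auto
    finally show "(\<integral>\<^sup>+T. ennreal (1 / (ip (Suc n) T T / vif k (gm n W))) \<partial>gauss_vec (Suc n))
        = ennreal (vif k (gm n W)) * ennreal (1 / (real (Suc n) - 2))" .
  qed
  also have "\<dots> = (\<integral>\<^sup>+W. ennreal (vif k (gm n W)) \<partial>?MW) * ennreal (1 / (real (Suc n) - 2))"
    by (rule nn_integral_multc) measurable
  finally have e: "(\<integral>\<^sup>+W. ennreal (vif k (gm n W)) \<partial>?MW) * ennreal (1 / (real n - 1)) = ennreal (1 / (real n - 1 - real k))"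
    using assms by (simp add: of_nat_diff)
  have "(\<integral>\<^sup>+W. ennreal (vif k (gm n W)) \<partial>?MW) = (\<integral>\<^sup>+W. ennreal (vif k (gm n W)) \<partial>?MW) * (ennreal (1 / (real n - 1)) * ennreal (real n - 1))"
    using assms by (simp add: ennreal_mult'[symmetric])
  also have "\<dots> = ennreal (1 / (real n - 1 - real k)) * ennreal (real n - 1)"
    unfolding mult.assoc[symmetric] e ..
  also have "\<dots> = ennreal ((real n - 1) / (real n - 1 - real k))"
    using assms by (simp add: ennreal_mult'[symmetric])
  finally show ?thesis .
qed

section \<open>Tail bounds for \<open>schur\<close> and \<open>vif\<close>\<close>

lemma nn_integral_indicator_vimage:
  assumes "{\<omega> \<in> space M. X \<omega> \<in> A} \<in> sets M"
  shows "(\<integral>\<^sup>+\<omega>. indicator A (X \<omega>) \<partial>M) = emeasure M {\<omega> \<in> space M. X \<omega> \<in> A}"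
proof -
  have "(\<integral>\<^sup>+\<omega>. indicator A (X \<omega>) \<partial>M) = (\<integral>\<^sup>+\<omega>. indicator {\<omega> \<in> space M. X \<omega> \<in> A} \<omega> \<partial>M)"
    by (rule nn_integral_cong) (simp add: indicator_def)
  then show ?thesis using assms by simp
qed

lemma emeasure_schur_tails:
  assumes "k \<le> n" "0 \<le> \<delta>" "\<delta> \<le> 1"
  shows "emeasure (gauss_mat n k) {W \<in> space (gauss_mat n k). schur k (gm n W) \<ge> real (n - k) * (1 + \<delta>)}
      \<le> ennreal (exp (- real (n - k) * \<delta>\<^sup>2 / 16))" (is ?upper)
    and "emeasure (gauss_mat n k) {W \<in> space (gauss_mat n k). schur k (gm n W) \<le> real (n - k) * (1 - \<delta>)}
      \<le> ennreal (exp (- real (n - k) * \<delta>\<^sup>2 / 16))" (is ?lower)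
proof -
  have eq: "emeasure (gauss_mat n k) {W \<in> space (gauss_mat n k). schur k (gm n W) \<in> A}
      = emeasure (gauss_vec (n - k)) {x \<in> space (gauss_vec (n - k)). ip (n - k) x x \<in> A}" if A[measurable]: "A \<in> sets borel" for A
  proof -
    have "emeasure (gauss_mat n k) {W \<in> space (gauss_mat n k). schur k (gm n W) \<in> A}
        = (\<integral>\<^sup>+W. indicator A (schur k (gm n W)) \<partial>gauss_mat n k)"
      by (rule nn_integral_indicator_vimage[symmetric]) measurable
    also have "\<dots> = (\<integral>\<^sup>+x. indicator A (ip (n - k) x x) \<partial>gauss_vec (n - k))"
      by (rule nn_integral_gauss_schur[OF assms(1)]) simp
    also have "\<dots> = emeasure (gauss_vec (n - k)) {x \<in> space (gauss_vec (n - k)). ip (n - k) x x \<in> A}"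
      by (rule nn_integral_indicator_vimage) measurable
    finally show ?thesis .
  qed
  show ?upper using eq[of "{real (n - k) * (1 + \<delta>)..}"] gauss_upper_tail[OF assms(2,3), of "n - k"] by simp
  show ?lower using eq[of "{..real (n - k) * (1 - \<delta>)}"] gauss_lower_tail[OF assms(2,3), of "n - k"] by simp
qed

text \<open>If \<open>vif\<close> deviates, then so does its independent chi-square multiple, unless the chi-square factor
  deviates in the opposite direction, which happens with probability at most 1/2.\<close>
lemma emeasure_vif_tails_aux:
  assumes "k \<le> n" and [measurable]: "A \<in> sets borel" "B \<in> sets borel" "C \<in> sets borel"
    and AB: "\<And>t v. t \<in> A \<Longrightarrow> v \<in> B \<Longrightarrow> 0 \<le> t \<Longrightarrow> 1 \<le> v \<Longrightarrow> t / v \<in> C"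
    and A: "emeasure (gauss_vec (Suc n)) {x \<in> space (gauss_vec (Suc n)). ip (Suc n) x x \<notin> A} \<le> ennreal (1 / 2)"
    and C: "emeasure (gauss_vec (Suc n - k)) {x \<in> space (gauss_vec (Suc n - k)). ip (Suc n - k) x x \<in> C} \<le> ennreal q" and q: "0 \<le> q"
  shows "emeasure (gauss_mat n k) {W \<in> space (gauss_mat n k). vif k (gm n W) \<in> B} \<le> ennreal (2 * q)"
proof -
  let ?MW = "gauss_mat n k" and ?MT = "gauss_vec (Suc n)"
  let ?A = "{x \<in> space ?MT. ip (Suc n) x x \<in> A}" and ?B = "{W \<in> space ?MW. vif k (gm n W) \<in> B}"
  have sA: "?A \<in> sets ?MT" and sB: "?B \<in> sets ?MW" by measurable
  have "emeasure ?MW ?B * emeasure ?MT ?A = (\<integral>\<^sup>+W. indicator ?B W * emeasure ?MT ?A \<partial>?MW)"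
    using sB by (subst nn_integral_multc) auto
  also have "\<dots> = (\<integral>\<^sup>+W. \<integral>\<^sup>+T. indicator ?B W * indicator ?A T \<partial>?MT \<partial>?MW)"
    using sA by (simp add: nn_integral_cmult)
  also have "\<dots> \<le> (\<integral>\<^sup>+W. \<integral>\<^sup>+T. indicator C (ip (Suc n) T T / vif k (gm n W)) \<partial>?MT \<partial>?MW)"
    using AB vif_ge_1 by (intro nn_integral_mono) (auto simp: indicator_def)
  also have "\<dots> = (\<integral>\<^sup>+x. indicator C (ip (Suc n - k) x x) \<partial>gauss_vec (Suc n - k))"
    by (rule nn_integral_gauss_vif[OF assms(1)]) simp
  also have "\<dots> = emeasure (gauss_vec (Suc n - k)) {x \<in> space (gauss_vec (Suc n - k)). ip (Suc n - k) x x \<in> C}"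
    by (rule nn_integral_indicator_vimage) measurable
  also note C
  finally have "measure ?MW ?B * measure ?MT ?A \<le> q"
    using q by (simp add: gauss.emeasure_eq_measure ennreal_mult'[symmetric])
  moreover have "1 / 2 \<le> measure ?MT ?A"
  proof -
    have "measure ?MT {x \<in> space ?MT. ip (Suc n) x x \<notin> A} \<le> 1 / 2"
      using A unfolding gauss.emeasure_eq_measure by (subst (asm) ennreal_le_iff) simp_all
    then show ?thesis using gauss.prob_neg[OF sA] by simp
  qed
  ultimately have "measure ?MW ?B * (1 / 2) \<le> q"
    by (meson measure_nonneg mult_left_mono order_trans)
  then show ?thesis unfolding gauss.emeasure_eq_measure by (intro ennreal_leI) simp
qed

text \<open>The centre \<open>Suc n / (Suc n - k)\<close> is the ratio of the two degrees of
  freedom. Allowing each chi-square variable a deviation \<delta>/4 is enough, since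
  \<open>1 + \<delta> / 4 \<le> (1 - \<delta> / 4) * (1 + \<delta>)\<close> and
  \<open>(1 + \<delta> / 4) * (1 - \<delta>) \<le> 1 - \<delta> / 4\<close> on [0, 1]. The
  hypothesis \<open>half\<close> provides the probability 1/2 for \<open>T\<close>.\<close>

lemma emeasure_vif_tails:
  assumes "k \<le> n" and d: "0 \<le> \<delta>" "\<delta> \<le> 1" and half: "exp (- real (Suc n) * (\<delta> / 4)\<^sup>2 / 16) < 1 / 2"
  shows "emeasure (gauss_mat n k) {W \<in> space (gauss_mat n k).
        vif k (gm n W) \<ge> (1 + \<delta>) * (real (Suc n) / real (Suc n - k))}
      \<le> ennreal (2 * exp (- real (Suc n - k) * (\<delta> / 4)\<^sup>2 / 16))" (is ?upper)
    and "emeasure (gauss_mat n k) {W \<in> space (gauss_mat n k).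
        vif k (gm n W) \<le> (1 - \<delta>) * (real (Suc n) / real (Suc n - k))}
      \<le> ennreal (2 * exp (- real (Suc n - k) * (\<delta> / 4)\<^sup>2 / 16))" (is ?lower)
proof -
  define N where "N = real (Suc n)"
  define d where "d = real (Suc n - k)"
  have N: "0 < N" and dp: "0 < d" using assms(1) by (auto simp: N_def d_def)
  have e: "0 \<le> \<delta> / 4" "\<delta> / 4 \<le> 1" using d by auto
  have half': "ennreal (exp (- real (Suc n) * (\<delta> / 4)\<^sup>2 / 16)) \<le> ennreal (1 / 2)"
    using half by (intro ennreal_leI) auto
  have "emeasure (gauss_mat n k) {W \<in> space (gauss_mat n k). vif k (gm n W) \<in> {(1 + \<delta>) * (N / d)..}}
      \<le> ennreal (2 * exp (- real (Suc n - k) * (\<delta> / 4)\<^sup>2 / 16))"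
  proof (rule emeasure_vif_tails_aux[OF assms(1), of "{..< N * (1 + \<delta> / 4)}" _ "{..d * (1 - \<delta> / 4)}"])
    fix t v :: real assume tv: "t \<in> {..<N * (1 + \<delta> / 4)}" "v \<in> {(1 + \<delta>) * (N / d)..}" "0 \<le> t" "1 \<le> v"
    have "t \<le> N * (1 + \<delta> / 4)" using tv by simp
    also have "N * (1 + \<delta> / 4) \<le> N * ((1 - \<delta> / 4) * (1 + \<delta>))"
    proof (intro mult_left_mono)
      have "\<delta> * \<delta> \<le> \<delta> * 1" using d by (intro mult_left_mono) auto
      then show "1 + \<delta> / 4 \<le> (1 - \<delta> / 4) * (1 + \<delta>)" using d by (simp add: field_simps)
    qed (use N in simp)
    also have "\<dots> = d * (1 - \<delta> / 4) * ((1 + \<delta>) * (N / d))" using dp by simp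
    also have "\<dots> \<le> d * (1 - \<delta> / 4) * v" using tv dp d by (intro mult_left_mono) auto
    finally show "t / v \<in> {..d * (1 - \<delta> / 4)}" using tv by (simp add: pos_divide_le_eq)
  next
    show "emeasure (gauss_vec (Suc n)) {x \<in> space (gauss_vec (Suc n)). ip (Suc n) x x \<notin> {..<N * (1 + \<delta> / 4)}} \<le> ennreal (1 / 2)"
      using order_trans[OF gauss_upper_tail[OF e, of "Suc n"] half'] by (simp add: N_def not_less del: of_nat_Suc)
    show "emeasure (gauss_vec (Suc n - k)) {x \<in> space (gauss_vec (Suc n - k)). ip (Suc n - k) x x \<in> {..d * (1 - \<delta> / 4)}}
      \<le> ennreal (exp (- real (Suc n - k) * (\<delta> / 4)\<^sup>2 / 16))"
      using gauss_lower_tail[OF e, of "Suc n - k"] by (simp add: d_def)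
  qed auto
  then show ?upper by (simp add: N_def d_def del: of_nat_Suc)
  have "emeasure (gauss_mat n k) {W \<in> space (gauss_mat n k). vif k (gm n W) \<in> {..(1 - \<delta>) * (N / d)}}
      \<le> ennreal (2 * exp (- real (Suc n - k) * (\<delta> / 4)\<^sup>2 / 16))"
  proof (rule emeasure_vif_tails_aux[OF assms(1), of "{N * (1 - \<delta> / 4)<..}" _ "{d * (1 + \<delta> / 4)..}"])
    fix t v :: real assume tv: "t \<in> {N * (1 - \<delta> / 4)<..}" "v \<in> {..(1 - \<delta>) * (N / d)}" "0 \<le> t" "1 \<le> v"
    have "d * (1 + \<delta> / 4) * v \<le> d * (1 + \<delta> / 4) * ((1 - \<delta>) * (N / d))" using tv dp d by (intro mult_left_mono) auto
    also have "\<dots> = N * ((1 + \<delta> / 4) * (1 - \<delta>))" using dp by simp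
    also have "\<dots> \<le> N * (1 - \<delta> / 4)"
    proof (intro mult_left_mono)
      have "0 \<le> \<delta> * \<delta>" by simp
      then show "(1 + \<delta> / 4) * (1 - \<delta>) \<le> 1 - \<delta> / 4" using d by (simp add: field_simps)
    qed (use N in simp)
    also have "\<dots> \<le> t" using tv by simp
    finally show "t / v \<in> {d * (1 + \<delta> / 4)..}" using tv by (simp add: pos_le_divide_eq)
  next
    show "emeasure (gauss_vec (Suc n)) {x \<in> space (gauss_vec (Suc n)). ip (Suc n) x x \<notin> {N * (1 - \<delta> / 4)<..}} \<le> ennreal (1 / 2)"
      using order_trans[OF gauss_lower_tail[OF e, of "Suc n"] half'] by (simp add: N_def not_less del: of_nat_Suc)
    show "emeasure (gauss_vec (Suc n - k)) {x \<in> space (gauss_vec (Suc n - k)). ip (Suc n - k) x x \<in> {d * (1 + \<delta> / 4)..}}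
      \<le> ennreal (exp (- real (Suc n - k) * (\<delta> / 4)\<^sup>2 / 16))"
      using gauss_upper_tail[OF e, of "Suc n - k"] by (simp add: d_def)
  qed auto
  then show ?lower by (simp add: N_def d_def del: of_nat_Suc)
qed

section \<open>The Gaussian linear model\<close>

lemma integrable_mult_of_squares:
  fixes f g :: "'a \<Rightarrow> real"
  assumes [measurable]: "f \<in> borel_measurable M" "g \<in> borel_measurable M"
    and sq: "integrable M (\<lambda>\<omega>. (f \<omega>)\<^sup>2)" "integrable M (\<lambda>\<omega>. (g \<omega>)\<^sup>2)"
  shows "integrable M (\<lambda>\<omega>. f \<omega> * g \<omega>)"
proof (rule Bochner_Integration.integrable_bound)
  show "integrable M (\<lambda>\<omega>. (f \<omega>)\<^sup>2 + (g \<omega>)\<^sup>2)" using sq by simp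
  show "AE \<omega> in M. norm (f \<omega> * g \<omega>) \<le> norm ((f \<omega>)\<^sup>2 + (g \<omega>)\<^sup>2)"
  proof (rule AE_I2)
    fix \<omega>
    have "2 * (\<bar>f \<omega>\<bar> * \<bar>g \<omega>\<bar>) \<le> (f \<omega>)\<^sup>2 + (g \<omega>)\<^sup>2"
      using sum_squares_bound[of "\<bar>f \<omega>\<bar>" "\<bar>g \<omega>\<bar>"] by (simp add: mult.assoc)
    moreover have "0 \<le> \<bar>f \<omega>\<bar> * \<bar>g \<omega>\<bar>" by simp
    ultimately have "\<bar>f \<omega>\<bar> * \<bar>g \<omega>\<bar> \<le> (f \<omega>)\<^sup>2 + (g \<omega>)\<^sup>2" by linarith
    then show "norm (f \<omega> * g \<omega>) \<le> norm ((f \<omega>)\<^sup>2 + (g \<omega>)\<^sup>2)" by (simp add: abs_mult)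
  qed
qed simp

lemma (in prob_space) gaussian_rv_integrable:
  assumes "gaussian_rv M Z"
  shows "integrable M Z" "integrable M (\<lambda>\<omega>. (Z \<omega>)\<^sup>2)"
proof -
  have Z[measurable]: "Z \<in> borel_measurable M" using assms by (simp add: gaussian_rv_def)
  from assms consider \<mu> where "AE \<omega> in M. Z \<omega> = \<mu>"
    | \<mu> s where "0 < s" "distributed M lborel Z (normal_density \<mu> s)"
    by (auto simp: gaussian_rv_def)
  then have "integrable M Z \<and> integrable M (\<lambda>\<omega>. (Z \<omega>)\<^sup>2)"
  proof cases
    case 1
    have "integrable M Z"
      using 1 by (intro integrable_cong_AE_imp[of M "\<lambda>_. \<mu>" Z]) auto
    moreover have "integrable M (\<lambda>\<omega>. (Z \<omega>)\<^sup>2)"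
    proof (rule integrable_cong_AE_imp[of M "\<lambda>_. \<mu>\<^sup>2"])
      show "AE \<omega> in M. \<mu>\<^sup>2 = (Z \<omega>)\<^sup>2" using 1 by eventually_elim simp
    qed simp_all
    ultimately show ?thesis ..
  next
    case 2
    have "integrable M (\<lambda>\<omega>. (Z \<omega> - \<mu>) ^ k)" for k
      using distributed_integrable[OF 2(2), of "\<lambda>x. (x - \<mu>) ^ k"] integrable_normal_moment[OF 2(1), of \<mu> k] by simp
    from this[of 1] this[of 2] have i: "integrable M (\<lambda>\<omega>. Z \<omega> - \<mu>)" "integrable M (\<lambda>\<omega>. (Z \<omega> - \<mu>)\<^sup>2)" by simp_all
    have "integrable M (\<lambda>\<omega>. (Z \<omega> - \<mu>) + \<mu>)" using i by (intro Bochner_Integration.integrable_add) auto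
    then have "integrable M Z" by simp
    moreover have "integrable M (\<lambda>\<omega>. (Z \<omega> - \<mu>)\<^sup>2 + 2 * \<mu> * Z \<omega> - \<mu>\<^sup>2)"
      using i \<open>integrable M Z\<close> by simp
    moreover have "(\<lambda>\<omega>. (Z \<omega> - \<mu>)\<^sup>2 + 2 * \<mu> * Z \<omega> - \<mu>\<^sup>2) = (\<lambda>\<omega>. (Z \<omega>)\<^sup>2)"
      by (auto simp: power2_diff algebra_simps power2_eq_square)
    ultimately show ?thesis by simp
  qed
  then show "integrable M Z" "integrable M (\<lambda>\<omega>. (Z \<omega>)\<^sup>2)" by auto
qed

text \<open>The frequency is absorbed into \<open>Z\<close>, because multiples and linear
  combinations are Gaussian as well. A point mass is the case of second moment 0.\<close>

lemma (in prob_space) gaussian_rv_char: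
  assumes G: "gaussian_rv M Z" and mean: "expectation Z = 0"
  shows "(CLINT \<omega>|M. iexp (Z \<omega>)) = exp (- expectation (\<lambda>\<omega>. (Z \<omega>)\<^sup>2) / 2)"
proof -
  have Z[measurable]: "Z \<in> borel_measurable M" using G by (simp add: gaussian_rv_def)
  from G consider \<mu> where "AE \<omega> in M. Z \<omega> = \<mu>"
    | \<mu> s where "0 < s" "distributed M lborel Z (normal_density \<mu> s)"
    by (auto simp: gaussian_rv_def)
  then show ?thesis
  proof cases
    case 1
    have "expectation Z = expectation (\<lambda>_. \<mu>)" using 1 by (intro integral_cong_AE) auto
    then have "\<mu> = 0" using mean by (simp add: prob_space)
    with 1 have 0: "AE \<omega> in M. Z \<omega> = 0" by simp
    have "(CLINT \<omega>|M. iexp (Z \<omega>)) = (CLINT \<omega>|M. 1)"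
    proof (rule integral_cong_AE)
      show "AE \<omega> in M. iexp (Z \<omega>) = 1" using 0 by eventually_elim simp
    qed simp_all
    moreover have "expectation (\<lambda>\<omega>. (Z \<omega>)\<^sup>2) = expectation (\<lambda>\<omega>. 0)"
    proof (rule integral_cong_AE)
      show "AE \<omega> in M. (Z \<omega>)\<^sup>2 = 0" using 0 by eventually_elim simp
    qed simp_all
    ultimately show ?thesis by (simp add: prob_space)
  next
    case 2
    have mu: "\<mu> = 0" using normal_distributed_expectation[OF 2] mean by simp
    have var: "expectation (\<lambda>\<omega>. (Z \<omega>)\<^sup>2) = s\<^sup>2" using normal_distributed_variance[OF 2] mean by simp
    have "distributed M lborel (\<lambda>\<omega>. (Z \<omega> - \<mu>) / s) std_normal_density"
      using 2 by (subst normal_standard_normal_convert[symmetric]) auto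
    then have d: "distr M borel (\<lambda>\<omega>. Z \<omega> / s) = std_normal_distribution"
      unfolding distributed_def mu by (auto cong: distr_cong)
    have "complex_of_real (exp (- s\<^sup>2 / 2)) = char (distr M borel (\<lambda>\<omega>. Z \<omega> / s)) s"
      unfolding d char_std_normal_distribution ..
    also have "\<dots> = (CLINT \<omega>|M. iexp (s * (Z \<omega> / s)))"
      unfolding char_def by (subst integral_distr) auto
    also have "\<dots> = (CLINT \<omega>|M. iexp (Z \<omega>))" using 2(1) by simp
    finally show ?thesis by (simp add: var)
  qed
qed

lemma gaussian_rv_distr:
  assumes f: "f \<in> measurable M N" and Z: "Z \<in> borel_measurable N"
    and G: "gaussian_rv M (\<lambda>\<omega>. Z (f \<omega>))"
  shows "gaussian_rv (distr M N f) Z"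
  unfolding gaussian_rv_def
proof
  show "Z \<in> borel_measurable (distr M N f)" using Z by simp
  from G consider \<mu> where "AE \<omega> in M. Z (f \<omega>) = \<mu>"
    | \<mu> s where "0 < s" "distributed M lborel (\<lambda>\<omega>. Z (f \<omega>)) (normal_density \<mu> s)"
    by (auto simp: gaussian_rv_def)
  then show "(\<exists>\<mu>. AE \<omega> in distr M N f. Z \<omega> = \<mu>) \<or> (\<exists>\<mu> s. 0 < s \<and> distributed (distr M N f) lborel Z (normal_density \<mu> s))"
  proof cases
    case 1
    have "{x \<in> space N. Z x = \<mu>} \<in> sets N" using Z by measurable
    with 1 f have "AE \<omega> in distr M N f. Z \<omega> = \<mu>" by (subst AE_distr_iff) auto
    then show ?thesis by blast
  next
    case 2
    then have "distributed (distr M N f) lborel Z (normal_density \<mu> s)"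
      unfolding distributed_def using f Z by (auto simp: distr_distr comp_def)
    then show ?thesis using 2(1) by blast
  qed
qed

text \<open>\<open>jointly_gaussian\<close> sums over sets of functions, but an indexed family may
  repeat a function; for instance \<open>y\<close> and \<open>u\<close> may coincide. The
  coefficients of equal members are therefore added up first.\<close>

lemma jointly_gaussian_sum:
  assumes J: "jointly_gaussian M V" and I: "finite I" and g: "\<And>i. i \<in> I \<Longrightarrow> g i \<in> V"
  shows "gaussian_rv M (\<lambda>\<omega>. \<Sum>i\<in>I. c i * g i \<omega>)"
proof -
  have "gaussian_rv M (\<lambda>\<omega>. \<Sum>Z\<in>g ` I. (\<Sum>i\<in>{i \<in> I. g i = Z}. c i) * Z \<omega>)"
    using J I g unfolding jointly_gaussian_def
    by (auto simp: image_subset_iff dest!: spec[of _ "g ` I"] spec[of _ "\<lambda>Z. \<Sum>i\<in>{i \<in> I. g i = Z}. c i"])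
  moreover have "(\<Sum>i\<in>I. c i * g i \<omega>) = (\<Sum>Z\<in>g ` I. (\<Sum>i\<in>{i \<in> I. g i = Z}. c i) * Z \<omega>)" for \<omega>
    by (subst sum.image_gen[OF I, of _ g]) (auto simp: sum_distrib_right intro!: sum.cong)
  ultimately show ?thesis by simp
qed

text \<open>\<open>None\<close> stands for the response, \<open>Some j\<close> for the \<open>j\<close>-th regressor.\<close>
definition coord :: "nat option \<Rightarrow> obs \<Rightarrow> real" where
  "coord i \<omega> = (case i of None \<Rightarrow> fst \<omega> | Some j \<Rightarrow> snd \<omega> j)"

lemma coord_simps [simp]: "coord None \<omega> = fst \<omega>" "coord (Some j) \<omega> = snd \<omega> j"
  by (simp_all add: coord_def)

lemma measurable_coord [measurable]: "coord i \<in> borel_measurable obs_space"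
  unfolding coord_def[abs_def] obs_space_def by (cases i) auto

definition lin :: "nat option set \<Rightarrow> (obs \<Rightarrow> real) set" where
  "lin I = {\<lambda>\<omega>. \<Sum>i\<in>I. c i * coord i \<omega> | c. True}"

text \<open>What the later arguments use of the model, phrased through the law of one observation
  alone. The noise, \<beta>, \<sigma> and \<Sigma> no longer occur; the residual variance for each
  model is derived from \<open>D\<close>.\<close>

locale gauss_obs = prob_space D for D :: "obs measure" +
  assumes sets_D [measurable_cong]: "sets D = sets obs_space"
    and lin_gaussian: "\<And>I f. finite I \<Longrightarrow> f \<in> lin I \<Longrightarrow> gaussian_rv D f"
    and lin_mean: "\<And>I f. finite I \<Longrightarrow> f \<in> lin I \<Longrightarrow> expectation f = 0"
    and coord_pos_def: "\<And>J c. finite J \<Longrightarrow> \<exists>j\<in>J. c j \<noteq> 0 \<Longrightarrow>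
      0 < expectation (\<lambda>\<omega>. (\<Sum>j\<in>J. c j * coord (Some j) \<omega>)\<^sup>2)"

lemma (in gaussian_linear_model) gauss_obs_obs_law:
  "gauss_obs (obs_law M y x)" "integral\<^sup>L (obs_law M y x) (\<lambda>\<omega>. (fst \<omega>)\<^sup>2) = variance y"
proof -
  let ?V = "insert y (insert u (range x))"
  have V: "gaussian_rv M Z" if "Z \<in> ?V" for Z
    using jointly_gaussian_sum[OF gaussian, of "{()}" "\<lambda>_. Z" "\<lambda>_. 1"] that by simp
  have meas [measurable]: "y \<in> borel_measurable M" "x j \<in> borel_measurable M" "u \<in> borel_measurable M" for j
    using V by (auto simp: gaussian_rv_def)
  have int: "integrable M y" "integrable M (x j)" "integrable M u" "integrable M (\<lambda>\<omega>. (y \<omega>)\<^sup>2)" for j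
    using V gaussian_rv_integrable by auto
  define f where "f \<omega> = (y \<omega>, \<lambda>j. x j \<omega>)" for \<omega>
  have f [measurable]: "f \<in> measurable M obs_space"
    unfolding f_def obs_space_def by (intro measurable_Pair measurable_PiM_single') auto
  have D: "obs_law M y x = distr M obs_space f" by (simp add: obs_law_def f_def[abs_def])
  define v where "v i = (case i of None \<Rightarrow> y | Some j \<Rightarrow> x j)" for i
  have cf: "coord i (f \<omega>) = v i \<omega>" for i \<omega> by (cases i) (simp_all add: f_def v_def)
  have [measurable]: "v i \<in> borel_measurable M" for i by (cases i) (simp_all add: v_def)
  \<comment> \<open>The response has mean zero by the series: \<open>u\<close> and all partial sums
    have mean zero, so \<open>(expectation y)^2\<close> is at most the mean square of each
    remainder, which tends to 0.\<close>
  have y_mean: "expectation y = 0"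
  proof -
    have "ennreal ((expectation y)\<^sup>2) \<le> (\<integral>\<^sup>+\<omega>. ennreal ((y \<omega> - u \<omega> - (\<Sum>j<N. x j \<omega> * \<beta> j))\<^sup>2) \<partial>M)" for N
    proof -
      \<comment> \<open>\<open>None\<close> stands for \<open>y\<close>, \<open>Some None\<close>
        for \<open>u\<close>, and \<open>Some (Some j)\<close> for \<open>x j\<close>.\<close>
      let ?I = "insert None (insert (Some None) ((\<lambda>j. Some (Some j)) ` {..<N}))"
      let ?g = "\<lambda>i. case i of None \<Rightarrow> y | Some None \<Rightarrow> u | Some (Some j) \<Rightarrow> x j"
      let ?c = "\<lambda>i. case i of None \<Rightarrow> 1 | Some None \<Rightarrow> - 1 | Some (Some j) \<Rightarrow> - \<beta> j"
      let ?W = "\<lambda>\<omega>. y \<omega> - u \<omega> - (\<Sum>j<N. x j \<omega> * \<beta> j)"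
      have "gaussian_rv M (\<lambda>\<omega>. \<Sum>i\<in>?I. ?c i * ?g i \<omega>)"
        by (rule jointly_gaussian_sum[OF gaussian]) (auto split: option.splits)
      moreover have "(\<Sum>i\<in>?I. ?c i * ?g i \<omega>) = ?W \<omega>" for \<omega>
        by (subst sum.insert, simp, force, subst sum.insert, simp, force, subst sum.reindex)
          (auto simp: inj_on_def sum_negf mult.commute)
      ultimately have W: "gaussian_rv M ?W" by simp
      note iW = gaussian_rv_integrable[OF W]
      have "expectation ?W = expectation y"
        using int x_mean u_mean by (simp add: Bochner_Integration.integral_diff Bochner_Integration.integral_sum)
      then have "(expectation y)\<^sup>2 \<le> expectation (\<lambda>\<omega>. (?W \<omega>)\<^sup>2)"
        using variance_eq[OF iW] variance_positive[of ?W] by simp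
      then show ?thesis
        using iW by (subst nn_integral_eq_integral) (auto intro: ennreal_leI)
    qed
    then have "ennreal ((expectation y)\<^sup>2) \<le> 0"
      by (intro LIMSEQ_le_const[OF series]) auto
    then show ?thesis by (simp add: ennreal_eq_0_iff)
  qed
  have v_int: "integrable M (v i)" and v_mean: "expectation (v i) = 0" for i
    using int y_mean x_mean by (cases i; simp add: v_def)+
  interpret D: prob_space "obs_law M y x" unfolding D by (rule prob_space_distr) simp
  have linf: "\<exists>c. g = (\<lambda>\<omega>. \<Sum>i\<in>I. c i * coord i \<omega>)" if "g \<in> lin I" for g I
    using that by (auto simp: lin_def)
  show "gauss_obs (obs_law M y x)"
  proof
    show "sets (obs_law M y x) = sets obs_space" by (simp add: D)
  next
    fix I g assume I: "finite I" and "g \<in> lin I"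
    then obtain c where g: "g = (\<lambda>\<omega>. \<Sum>i\<in>I. c i * coord i \<omega>)" using linf by blast
    have gm: "g \<in> borel_measurable obs_space" unfolding g by measurable
    show "gaussian_rv (obs_law M y x) g"
      unfolding D
    proof (rule gaussian_rv_distr[OF f gm])
      show "gaussian_rv M (\<lambda>\<omega>. g (f \<omega>))"
        unfolding g cf
        by (rule jointly_gaussian_sum[OF gaussian I]) (auto simp: v_def split: option.splits)
    qed
    show "integral\<^sup>L (obs_law M y x) g = 0"
      unfolding D using gm v_int v_mean
      by (subst integral_distr) (auto simp: g cf Bochner_Integration.integral_sum)
  next
    fix J c assume J: "finite (J :: nat set)" "\<exists>j\<in>J. c j \<noteq> (0 :: real)"
    have prod_int: "integrable M (\<lambda>\<omega>. x i \<omega> * x j \<omega>)" for i j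
      by (intro integrable_mult_of_squares x_square_integrable) simp_all
    have "integral\<^sup>L (obs_law M y x) (\<lambda>\<omega>. (\<Sum>j\<in>J. c j * coord (Some j) \<omega>)\<^sup>2) = expectation (\<lambda>\<omega>. (\<Sum>j\<in>J. c j * x j \<omega>)\<^sup>2)"
      unfolding D by (subst integral_distr) (auto simp: cf v_def simp del: coord_simps)
    also have "\<dots> = expectation (\<lambda>\<omega>. \<Sum>i\<in>J. \<Sum>j\<in>J. c i * c j * (x i \<omega> * x j \<omega>))"
      by (intro Bochner_Integration.integral_cong refl) (simp add: power2_eq_square sum_product mult_ac)
    also have "\<dots> = (\<Sum>i\<in>J. \<Sum>j\<in>J. c i * \<Sigma> i j * c j)"
      using prod_int x_covariance by (simp add: Bochner_Integration.integral_sum mult_ac)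
    also have "0 < \<dots>" by (rule positive_definite[OF J])
    finally show "0 < integral\<^sup>L (obs_law M y x) (\<lambda>\<omega>. (\<Sum>j\<in>J. c j * coord (Some j) \<omega>)\<^sup>2)" .
  qed
  have "integral\<^sup>L (obs_law M y x) (\<lambda>\<omega>. (coord None \<omega>)\<^sup>2) = expectation (\<lambda>\<omega>. (y \<omega>)\<^sup>2)"
    unfolding D by (subst integral_distr) (auto simp: cf v_def simp del: coord_simps)
  then show "integral\<^sup>L (obs_law M y x) (\<lambda>\<omega>. (fst \<omega>)\<^sup>2) = variance y" by (simp add: y_mean)
qed

section \<open>Whitening\<close>

lemma linI: "(\<lambda>\<omega>. \<Sum>i\<in>I. c i * coord i \<omega>) \<in> lin I"
  unfolding lin_def by (intro CollectI exI[of _ c]) simp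

lemma linE:
  assumes "f \<in> lin I"
  obtains c where "f = (\<lambda>\<omega>. \<Sum>i\<in>I. c i * coord i \<omega>)"
  using assms unfolding lin_def by (elim CollectE exE conjE)

lemma lin_add:
  assumes "f \<in> lin I" "g \<in> lin I" shows "(\<lambda>\<omega>. f \<omega> + g \<omega>) \<in> lin I"
proof -
  obtain c where c: "f = (\<lambda>\<omega>. \<Sum>i\<in>I. c i * coord i \<omega>)" using assms(1) by (rule linE)
  obtain d where "g = (\<lambda>\<omega>. \<Sum>i\<in>I. d i * coord i \<omega>)" using assms(2) by (rule linE)
  with c have e: "(\<lambda>\<omega>. f \<omega> + g \<omega>) = (\<lambda>\<omega>. \<Sum>i\<in>I. (c i + d i) * coord i \<omega>)"
    by (simp add: distrib_right sum.distrib)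
  show ?thesis unfolding e by (rule linI)
qed

lemma lin_scale:
  assumes "f \<in> lin I" shows "(\<lambda>\<omega>. s * f \<omega>) \<in> lin I"
proof -
  obtain c where "f = (\<lambda>\<omega>. \<Sum>i\<in>I. c i * coord i \<omega>)" using assms by (rule linE)
  then have e: "(\<lambda>\<omega>. s * f \<omega>) = (\<lambda>\<omega>. \<Sum>i\<in>I. (s * c i) * coord i \<omega>)"
    by (simp add: sum_distrib_left mult.assoc)
  show ?thesis unfolding e by (rule linI)
qed

lemma lin_diff: "f \<in> lin I \<Longrightarrow> g \<in> lin I \<Longrightarrow> (\<lambda>\<omega>. f \<omega> - g \<omega>) \<in> lin I"
  using lin_add[of f I "\<lambda>\<omega>. - 1 * g \<omega>"] lin_scale[of g I "- 1"] by simp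

lemma lin_zero: "(\<lambda>\<omega>. 0) \<in> lin I"
  using linI[of "\<lambda>_. 0" I] by simp

lemma lin_sum: "(\<And>a. a \<in> A \<Longrightarrow> f a \<in> lin I) \<Longrightarrow> (\<lambda>\<omega>. \<Sum>a\<in>A. f a \<omega>) \<in> lin I"
  by (induction A rule: infinite_finite_induct) (auto intro: lin_zero lin_add)

lemma lin_mono:
  assumes "finite J" "I \<subseteq> J" "f \<in> lin I" shows "f \<in> lin J"
proof -
  obtain c where "f = (\<lambda>\<omega>. \<Sum>i\<in>I. c i * coord i \<omega>)" using assms(3) by (rule linE)
  also have "\<dots> = (\<lambda>\<omega>. \<Sum>i\<in>J. (if i \<in> I then c i else 0) * coord i \<omega>)"
    using assms by (intro ext sum.mono_neutral_cong_left) auto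
  finally show ?thesis by (simp only: linI)
qed

lemma lin_coord:
  assumes "finite I" "i \<in> I" shows "coord i \<in> lin I"
proof -
  have "(\<lambda>\<omega>. \<Sum>j\<in>I. (if j = i then 1 else 0) * coord j \<omega>) = coord i"
    using assms by (simp add: if_distrib[of "\<lambda>t. t * _"] cong: if_cong)
  then show ?thesis using linI[of "\<lambda>j. if j = i then 1 else 0" I] by simp
qed

lemma lin_measurable: "f \<in> lin I \<Longrightarrow> f \<in> borel_measurable obs_space"
  by (elim linE) simp

context gauss_obs
begin

lemma lin_integrable:
  assumes "finite I" "f \<in> lin I" "g \<in> lin I"
  shows "integrable D f" "integrable D (\<lambda>\<omega>. f \<omega> * g \<omega>)" "integrable D (\<lambda>\<omega>. (f \<omega>)\<^sup>2)"
proof -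
  have m: "h \<in> borel_measurable D" if "h \<in> lin I" for h
    using lin_measurable[OF that] by (simp cong: measurable_cong_sets add: sets_D)
  note int = gaussian_rv_integrable[OF lin_gaussian[OF assms(1)]]
  show "integrable D f" "integrable D (\<lambda>\<omega>. (f \<omega>)\<^sup>2)" using int assms by auto
  show "integrable D (\<lambda>\<omega>. f \<omega> * g \<omega>)" using int m assms by (intro integrable_mult_of_squares) auto
qed

definition orthonormal :: "nat \<Rightarrow> (nat \<Rightarrow> obs \<Rightarrow> real) \<Rightarrow> bool" where
  "orthonormal k Z \<longleftrightarrow> (\<forall>a<k. \<forall>b<k. expectation (\<lambda>\<omega>. Z a \<omega> * Z b \<omega>) = (if a = b then 1 else 0))"

lemma expectation_mult_sum:
  assumes I: "finite I" "f \<in> lin I" "\<And>a. a < k \<Longrightarrow> Z a \<in> lin I"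
  shows "expectation (\<lambda>\<omega>. f \<omega> * (\<Sum>a<k. u a * Z a \<omega>)) = (\<Sum>a<k. u a * expectation (\<lambda>\<omega>. f \<omega> * Z a \<omega>))"
proof -
  have "expectation (\<lambda>\<omega>. f \<omega> * (\<Sum>a<k. u a * Z a \<omega>)) = expectation (\<lambda>\<omega>. \<Sum>a<k. u a * (f \<omega> * Z a \<omega>))"
    by (simp add: sum_distrib_left mult_ac)
  also have "\<dots> = (\<Sum>a<k. expectation (\<lambda>\<omega>. u a * (f \<omega> * Z a \<omega>)))"
    using I lin_integrable(2)[OF I(1,2)] by (intro Bochner_Integration.integral_sum) simp
  finally show ?thesis by simp
qed

lemma expectation_square_orthonormal:
  assumes I: "finite I" "\<And>a. a < k \<Longrightarrow> Z a \<in> lin I" and Z: "orthonormal k Z"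
  shows "expectation (\<lambda>\<omega>. (\<Sum>a<k. u a * Z a \<omega>)\<^sup>2) = (\<Sum>a<k. (u a)\<^sup>2)"
proof -
  have l: "(\<lambda>\<omega>. \<Sum>a<k. u a * Z a \<omega>) \<in> lin I" using I by (intro lin_sum lin_scale) auto
  have e: "expectation (\<lambda>\<omega>. (\<Sum>a<k. u a * Z a \<omega>) * Z b \<omega>) = u b" if b: "b < k" for b
  proof -
    have "expectation (\<lambda>\<omega>. Z b \<omega> * (\<Sum>a<k. u a * Z a \<omega>)) = (\<Sum>a<k. u a * (if b = a then 1 else 0))"
      using I b Z by (subst expectation_mult_sum[OF I(1)]) (auto simp: orthonormal_def)
    then show ?thesis using b by (simp add: mult.commute if_distrib[of "\<lambda>t. _ * t"] cong: if_cong)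
  qed
  have "expectation (\<lambda>\<omega>. (\<Sum>a<k. u a * Z a \<omega>)\<^sup>2) = (\<Sum>a<k. u a * expectation (\<lambda>\<omega>. (\<Sum>a<k. u a * Z a \<omega>) * Z a \<omega>))"
    unfolding power2_eq_square by (rule expectation_mult_sum[OF I(1) l I(2)])
  then show ?thesis by (simp add: e power2_eq_square)
qed

text \<open>Every combination is Gaussian with mean 0 and variance equal to the sum of the squared
  coefficients, so for jointly Gaussian variables orthonormality already means independent standard
  normal.\<close>

lemma char_orthonormal:
  assumes I: "finite I" "\<And>a. a < k \<Longrightarrow> Z a \<in> lin I" and Z: "orthonormal k Z"
  shows "(CLINT \<omega>|D. iexp (\<Sum>a<k. u a * Z a \<omega>)) = exp (- (\<Sum>a<k. (u a)\<^sup>2) / 2)"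
proof -
  have l: "(\<lambda>\<omega>. \<Sum>a<k. u a * Z a \<omega>) \<in> lin I" using I by (intro lin_sum lin_scale) auto
  show ?thesis
    using gaussian_rv_char[OF lin_gaussian[OF I(1) l] lin_mean[OF I(1) l]]
    by (simp add: expectation_square_orthonormal[OF I Z])
qed

lemma residual_orthogonal:
  assumes I: "finite I" "f \<in> lin I" "\<And>a. a < k \<Longrightarrow> Z a \<in> lin I" and Z: "orthonormal k Z"
  defines "r \<equiv> \<lambda>\<omega>. f \<omega> - (\<Sum>a<k. expectation (\<lambda>\<omega>. f \<omega> * Z a \<omega>) * Z a \<omega>)"
  shows "r \<in> lin I" "\<And>b. b < k \<Longrightarrow> expectation (\<lambda>\<omega>. r \<omega> * Z b \<omega>) = 0"
proof -
  let ?\<gamma> = "\<lambda>a. expectation (\<lambda>\<omega>. f \<omega> * Z a \<omega>)"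
  have l: "(\<lambda>\<omega>. \<Sum>a<k. ?\<gamma> a * Z a \<omega>) \<in> lin I" using I by (intro lin_sum lin_scale) auto
  show "r \<in> lin I" unfolding r_def by (intro lin_diff I l)
  fix b assume b: "b < k"
  have "expectation (\<lambda>\<omega>. r \<omega> * Z b \<omega>) = ?\<gamma> b - expectation (\<lambda>\<omega>. (\<Sum>a<k. ?\<gamma> a * Z a \<omega>) * Z b \<omega>)"
    unfolding r_def left_diff_distrib using I l b
    by (intro Bochner_Integration.integral_diff lin_integrable(2)[OF I(1)]) auto
  also have "expectation (\<lambda>\<omega>. (\<Sum>a<k. ?\<gamma> a * Z a \<omega>) * Z b \<omega>) = (\<Sum>a<k. ?\<gamma> a * (if b = a then 1 else 0))"
    unfolding mult.commute[of _ "Z b _"]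
    using I b Z by (subst expectation_mult_sum[OF I(1)]) (auto simp: orthonormal_def)
  finally show "expectation (\<lambda>\<omega>. r \<omega> * Z b \<omega>) = 0"
    using b by (simp add: if_distrib[of "\<lambda>t. _ * t"] cong: if_cong)
qed

lemma orthonormal_extend:
  assumes Z: "orthonormal k Z" and r: "\<And>b. b < k \<Longrightarrow> expectation (\<lambda>\<omega>. r \<omega> * Z b \<omega>) = 0"
    and s: "0 < expectation (\<lambda>\<omega>. (r \<omega>)\<^sup>2)" (is "0 < ?s")
  shows "orthonormal (Suc k) (Z(k := \<lambda>\<omega>. 1 / sqrt ?s * r \<omega>))"
proof -
  have rr: "expectation (\<lambda>\<omega>. (1 / sqrt ?s * r \<omega>) * (1 / sqrt ?s * r \<omega>)) = 1"
  proof -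
    have "expectation (\<lambda>\<omega>. (1 / sqrt ?s * r \<omega>) * (1 / sqrt ?s * r \<omega>)) = expectation (\<lambda>\<omega>. (1 / sqrt ?s)\<^sup>2 * (r \<omega>)\<^sup>2)"
      by (simp only: power2_eq_square mult_ac)
    also have "\<dots> = (1 / sqrt ?s)\<^sup>2 * ?s" by (rule integral_mult_right_zero)
    finally show ?thesis using s by (simp add: power_divide)
  qed
  have rz: "expectation (\<lambda>\<omega>. (1 / sqrt ?s * r \<omega>) * Z b \<omega>) = 0" if "b < k" for b
  proof -
    have "expectation (\<lambda>\<omega>. 1 / sqrt ?s * (r \<omega> * Z b \<omega>)) = 1 / sqrt ?s * expectation (\<lambda>\<omega>. r \<omega> * Z b \<omega>)"
      by (rule integral_mult_right_zero)
    then show ?thesis using r[OF that] by (simp add: mult.assoc)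
  qed
  have zr: "expectation (\<lambda>\<omega>. Z b \<omega> * (1 / sqrt ?s * r \<omega>)) = 0" if "b < k" for b
    using rz[OF that] by (simp only: mult.commute)
  show ?thesis
    unfolding orthonormal_def
  proof (intro allI impI)
    fix a b assume "a < Suc k" "b < Suc k"
    then consider "a < k" "b < k" | "a = k" "b < k" | "a < k" "b = k" | "a = k" "b = k" by linarith
    then show "expectation (\<lambda>\<omega>. (Z(k := \<lambda>\<omega>. 1 / sqrt ?s * r \<omega>)) a \<omega> * (Z(k := \<lambda>\<omega>. 1 / sqrt ?s * r \<omega>)) b \<omega>) = (if a = b then 1 else 0)"
    proof cases
      case 1
      then show ?thesis using Z by (auto simp: orthonormal_def)
    next
      case 2
      then show ?thesis using rz[of b] by (simp only: fun_upd_same fun_upd_other if_False less_irrefl) auto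
    next
      case 3
      then show ?thesis using zr[of a] by (simp only: fun_upd_same fun_upd_other if_False less_irrefl) auto
    next
      case 4
      then show ?thesis using rr by (simp only: fun_upd_same if_True refl)
    qed
  qed
qed

text \<open>Positive definiteness for the combination with coefficient 1 at \<open>j\<close>. It
  keeps Gram-Schmidt from ever dividing by zero.\<close>

lemma coord_residual_pos:
  assumes J: "finite J" "j \<notin> J" and g: "g \<in> lin (Some ` J)"
  shows "0 < expectation (\<lambda>\<omega>. (coord (Some j) \<omega> - g \<omega>)\<^sup>2)"
proof -
  obtain d where d: "g = (\<lambda>\<omega>. \<Sum>i\<in>Some ` J. d i * coord i \<omega>)" using g by (rule linE)
  define c where "c i = (if i = j then 1 else - d (Some i))" for i
  have "(\<Sum>i\<in>insert j J. c i * coord (Some i) \<omega>) = coord (Some j) \<omega> - g \<omega>" for \<omega>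
  proof -
    have "(\<Sum>i\<in>J. c i * coord (Some i) \<omega>) = (\<Sum>i\<in>J. - (d (Some i) * coord (Some i) \<omega>))"
      using J by (intro sum.cong) (auto simp: c_def)
    then show ?thesis using J by (simp add: d sum.reindex sum_negf c_def)
  qed
  moreover have "0 < expectation (\<lambda>\<omega>. (\<Sum>i\<in>insert j J. c i * coord (Some i) \<omega>)\<^sup>2)"
    using J by (intro coord_pos_def) (auto simp: c_def)
  ultimately show ?thesis by simp
qed

text \<open>Gram-Schmidt in mean square. The span property holds for every \<omega>, not just almost
  surely, because least squares is later carried out on individual samples.\<close>

lemma whitening:
  assumes "inj_on js {..<k}"
  obtains Z where "\<And>a. a < k \<Longrightarrow> Z a \<in> lin (Some ` js ` {..<k})" "orthonormal k Z"
    "\<And>f. f \<in> lin (Some ` js ` {..<k}) \<Longrightarrow> \<exists>u. f = (\<lambda>\<omega>. \<Sum>a<k. u a * Z a \<omega>)"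
proof -
  have "\<exists>Z. (\<forall>a<k. Z a \<in> lin (Some ` js ` {..<k})) \<and> orthonormal k Z \<and>
    (\<forall>f\<in>lin (Some ` js ` {..<k}). \<exists>u. f = (\<lambda>\<omega>. \<Sum>a<k. u a * Z a \<omega>))"
    using assms
  proof (induction k)
    case 0
    show ?case by (auto simp: orthonormal_def lin_def)
  next
    case (Suc k)
    let ?J = "js ` {..<k}"
    let ?I = "Some ` js ` {..<Suc k}"
    have inj: "inj_on js {..<k}" "js k \<notin> ?J"
      using Suc.prems by (auto simp: lessThan_Suc inj_on_insert)
    obtain Z where Z: "\<And>a. a < k \<Longrightarrow> Z a \<in> lin (Some ` ?J)" "orthonormal k Z"
      "\<And>f. f \<in> lin (Some ` ?J) \<Longrightarrow> \<exists>u. f = (\<lambda>\<omega>. \<Sum>a<k. u a * Z a \<omega>)"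
      using Suc.IH[OF inj(1)] by blast
    have sub: "lin (Some ` ?J) \<subseteq> lin ?I" by (auto intro!: lin_mono[of ?I "Some ` ?J"])
    define \<gamma> where "\<gamma> a = expectation (\<lambda>\<omega>. coord (Some (js k)) \<omega> * Z a \<omega>)" for a
    define r where "r \<omega> = coord (Some (js k)) \<omega> - (\<Sum>a<k. \<gamma> a * Z a \<omega>)" for \<omega>
    define s where "s = expectation (\<lambda>\<omega>. (r \<omega>)\<^sup>2)"
    have c: "coord (Some (js k)) \<in> lin ?I" by (intro lin_coord) auto
    have r: "r \<in> lin ?I" "\<And>b. b < k \<Longrightarrow> expectation (\<lambda>\<omega>. r \<omega> * Z b \<omega>) = 0"
      using residual_orthogonal[of ?I "coord (Some (js k))" k Z] c Z sub unfolding r_def[abs_def] \<gamma>_def by blast+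
    have "(\<lambda>\<omega>. \<Sum>a<k. \<gamma> a * Z a \<omega>) \<in> lin (Some ` ?J)" using Z(1) by (intro lin_sum lin_scale) auto
    from coord_residual_pos[OF _ inj(2) this] have s: "0 < s" unfolding s_def r_def by simp
    define Z' where "Z' = Z(k := \<lambda>\<omega>. 1 / sqrt s * r \<omega>)"
    have "orthonormal (Suc k) Z'"
      unfolding Z'_def s_def using s unfolding s_def by (intro orthonormal_extend Z(2) r(2))
    moreover have "Z' a \<in> lin ?I" if "a < Suc k" for a
      using that Z(1)[of a] sub lin_scale[OF r(1), of "1 / sqrt s"] by (auto simp: Z'_def less_Suc_eq)
    moreover have "\<exists>u. f = (\<lambda>\<omega>. \<Sum>a<Suc k. u a * Z' a \<omega>)" if fI: "f \<in> lin ?I" for f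
    proof -
      obtain d where d: "f = (\<lambda>\<omega>. \<Sum>i\<in>?I. d i * coord i \<omega>)" using fI by (rule linE)
      define f' where "f' \<omega> = (\<Sum>i\<in>Some ` ?J. d i * coord i \<omega>)" for \<omega>
      have "f' \<in> lin (Some ` ?J)" unfolding f'_def[abs_def] by (rule linI)
      then obtain u where u: "f' = (\<lambda>\<omega>. \<Sum>a<k. u a * Z a \<omega>)" using Z(3) by blast
      let ?d = "d (Some (js k))"
      define u' where "u' a = (if a = k then ?d * sqrt s else u a + ?d * \<gamma> a)" for a
      have "f \<omega> = (\<Sum>a<Suc k. u' a * Z' a \<omega>)" for \<omega>
      proof -
        have "f \<omega> = f' \<omega> + ?d * coord (Some (js k)) \<omega>"
          using inj(2) by (simp add: d f'_def lessThan_Suc image_iff)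
        also have "coord (Some (js k)) \<omega> = (\<Sum>a<k. \<gamma> a * Z a \<omega>) + r \<omega>" by (simp add: r_def)
        also have "f' \<omega> + ?d * ((\<Sum>a<k. \<gamma> a * Z a \<omega>) + r \<omega>) = (\<Sum>a<k. (u a + ?d * \<gamma> a) * Z a \<omega>) + ?d * r \<omega>"
          by (simp add: u distrib_left distrib_right sum.distrib sum_distrib_left mult.assoc)
        also have "\<dots> = (\<Sum>a<Suc k. u' a * Z' a \<omega>)" using s by (simp add: u'_def Z'_def)
        finally show ?thesis .
      qed
      then show ?thesis by blast
    qed
    ultimately show ?case by blast
  qed
  then show ?thesis using that by blast
qed

text \<open>\<open>Z\<close> has one member more than the model has regressors: the last one is the
  normalized residual of the response after projection on the model. Predictions from the model are
  then exactly the combinations of the first \<open>msize m\<close> members, and \<tau> is the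
  standard deviation of the residual.\<close>

lemma canonical_form:
  assumes m: "finite {j. m j}"
  obtains Z \<gamma> \<tau> I where "finite I" "\<And>a. a < Suc (msize m) \<Longrightarrow> Z a \<in> lin I" "orthonormal (Suc (msize m)) Z"
    "\<And>b. \<exists>u. \<forall>\<omega>. predict m (snd \<omega>) b = (\<Sum>a<msize m. u a * Z a \<omega>)"
    "\<And>u. \<exists>b. (\<forall>j. \<not> m j \<longrightarrow> b j = 0) \<and> (\<forall>\<omega>. predict m (snd \<omega>) b = (\<Sum>a<msize m. u a * Z a \<omega>))"
    "AE \<omega> in D. fst \<omega> = (\<Sum>a<msize m. \<gamma> a * Z a \<omega>) + \<tau> * Z (msize m) \<omega>"
    "0 \<le> \<tau>" "\<tau>\<^sup>2 \<le> expectation (\<lambda>\<omega>. (fst \<omega>)\<^sup>2)"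
proof -
  define k where "k = msize m"
  define J where "J = {j. m j}"
  obtain js where "bij_betw js {..<k} J"
    using ex_bij_betw_nat_finite[OF m] unfolding k_def J_def msize_def atLeast0LessThan by blast
  then have js: "inj_on js {..<k}" "js ` {..<k} = J" by (auto simp: bij_betw_def)
  obtain Z where Z: "\<And>a. a < k \<Longrightarrow> Z a \<in> lin (Some ` J)" "orthonormal k Z"
    "\<And>f. f \<in> lin (Some ` J) \<Longrightarrow> \<exists>u. f = (\<lambda>\<omega>. \<Sum>a<k. u a * Z a \<omega>)"
    using whitening[OF js(1)] unfolding js(2) by blast
  have J: "finite J" using m by (simp add: J_def)
  \<comment> \<open>A regressor outside the model, kept in reserve for a vanishing residual. It
    exists since there are infinitely many regressors.\<close>
  obtain j where j: "j \<notin> J" using J ex_new_if_finite infinite_UNIV_nat by blast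
  define I where "I = insert None (insert (Some j) (Some ` J))"
  have I: "finite I" "Some ` J \<subseteq> I" using J by (auto simp: I_def)
  have ZI: "Z a \<in> lin I" if "a < k" for a using lin_mono[OF I Z(1)[OF that]] .
  have lin_combo: "(\<lambda>\<omega>. \<Sum>a<k. u a * Z a \<omega>) \<in> lin (Some ` J)" for u
    using Z(1) by (intro lin_sum lin_scale) auto
  have predict_lin: "(\<lambda>\<omega>. predict m (snd \<omega>) b) = (\<lambda>\<omega>. \<Sum>i\<in>Some ` J. b (the i) * coord i \<omega>)" for b
    by (simp add: predict_def sum.reindex J_def mult.commute)
  have P1: "\<exists>u. \<forall>\<omega>. predict m (snd \<omega>) b = (\<Sum>a<k. u a * Z a \<omega>)" for b
  proof -
    have "(\<lambda>\<omega>. predict m (snd \<omega>) b) \<in> lin (Some ` J)" unfolding predict_lin by (rule linI)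
    from Z(3)[OF this] show ?thesis by metis
  qed
  have P2: "\<exists>b. (\<forall>j. \<not> m j \<longrightarrow> b j = 0) \<and> (\<forall>\<omega>. predict m (snd \<omega>) b = (\<Sum>a<k. u a * Z a \<omega>))" for u
  proof -
    obtain d where d: "(\<lambda>\<omega>. \<Sum>a<k. u a * Z a \<omega>) = (\<lambda>\<omega>. \<Sum>i\<in>Some ` J. d i * coord i \<omega>)"
      using lin_combo[of u] by (rule linE)
    have "predict m (snd \<omega>) (\<lambda>j. if m j then d (Some j) else 0) = (\<Sum>a<k. u a * Z a \<omega>)" for \<omega>
      unfolding fun_cong[OF d] by (simp add: predict_def sum.reindex J_def mult.commute)
    then show ?thesis by (intro exI[of _ "\<lambda>j. if m j then d (Some j) else 0"]) simp
  qed
  define \<gamma> where "\<gamma> a = expectation (\<lambda>\<omega>. coord None \<omega> * Z a \<omega>)" for a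
  define g where "g \<omega> = (\<Sum>a<k. \<gamma> a * Z a \<omega>)" for \<omega>
  define r where "r \<omega> = coord None \<omega> - g \<omega>" for \<omega>
  have N: "coord None \<in> lin I" using I by (intro lin_coord) (auto simp: I_def)
  have r: "r \<in> lin I" "\<And>b. b < k \<Longrightarrow> expectation (\<lambda>\<omega>. r \<omega> * Z b \<omega>) = 0"
    using residual_orthogonal[OF I(1) N ZI Z(2)] unfolding r_def[abs_def] g_def \<gamma>_def by blast+
  have g: "g \<in> lin I" using lin_mono[OF I lin_combo] by (simp add: g_def[abs_def])
  define s where "s = expectation (\<lambda>\<omega>. (r \<omega>)\<^sup>2)"
  have s0: "0 \<le> s" unfolding s_def by simp
  \<comment> \<open>Pythagoras: the residual variance is at most the second moment of the response,
    which makes the later bounds uniform in the parameters.\<close>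
  have "expectation (\<lambda>\<omega>. (coord None \<omega>)\<^sup>2) = expectation (\<lambda>\<omega>. (r \<omega>)\<^sup>2 + (2 * (r \<omega> * g \<omega>) + (g \<omega>)\<^sup>2))"
    by (intro Bochner_Integration.integral_cong refl) (simp add: r_def power2_eq_square algebra_simps)
  also have "\<dots> = s + (2 * expectation (\<lambda>\<omega>. r \<omega> * g \<omega>) + expectation (\<lambda>\<omega>. (g \<omega>)\<^sup>2))"
    using lin_integrable[OF I(1) r(1) g] lin_integrable[OF I(1) g g] by (simp add: s_def)
  also have "expectation (\<lambda>\<omega>. r \<omega> * g \<omega>) = 0"
    unfolding g_def using r ZI by (subst expectation_mult_sum[OF I(1)]) auto
  finally have s_le: "s \<le> expectation (\<lambda>\<omega>. (fst \<omega>)\<^sup>2)" by simp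
  show ?thesis
  proof (cases "s = 0")
    case False
    with s0 have s: "0 < s" by simp
    define Z' where "Z' = Z(k := \<lambda>\<omega>. 1 / sqrt s * r \<omega>)"
    have Z'_less: "(\<Sum>a<k. u a * Z' a \<omega>) = (\<Sum>a<k. u a * Z a \<omega>)" for u \<omega>
      by (intro sum.cong) (auto simp: Z'_def)
    show ?thesis
    proof (rule that[OF I(1), of Z' \<gamma> "sqrt s", unfolded k_def[symmetric] Z'_less])
      show "Z' a \<in> lin I" if "a < Suc k" for a
        using that ZI lin_scale[OF r(1), of "1 / sqrt s"] by (auto simp: Z'_def less_Suc_eq)
      show "orthonormal (Suc k) Z'"
        unfolding Z'_def s_def using s unfolding s_def by (intro orthonormal_extend Z(2) r(2))
      show "AE \<omega> in D. fst \<omega> = (\<Sum>a<k. \<gamma> a * Z a \<omega>) + sqrt s * Z' k \<omega>"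
        using s by (simp add: Z'_def r_def g_def)
    qed (use P1 P2 s_le s0 in auto)
  next
    \<comment> \<open>The response gives no new direction, so the last member of \<open>Z\<close> is
      built from the reserve regressor and receives coefficient 0. Thus \<open>\<tau> = 0\<close>
      needs no separate treatment later.\<close>
    case True
    have AE0: "AE \<omega> in D. r \<omega> = 0"
      using integral_nonneg_eq_0_iff_AE[of D "\<lambda>\<omega>. (r \<omega>)\<^sup>2"] lin_integrable[OF I(1) r(1) r(1)] True
      by (simp add: s_def)
    define \<delta> where "\<delta> a = expectation (\<lambda>\<omega>. coord (Some j) \<omega> * Z a \<omega>)" for a
    define q where "q \<omega> = coord (Some j) \<omega> - (\<Sum>a<k. \<delta> a * Z a \<omega>)" for \<omega>
    define t where "t = expectation (\<lambda>\<omega>. (q \<omega>)\<^sup>2)"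
    have cj: "coord (Some j) \<in> lin I" using I by (intro lin_coord) (auto simp: I_def)
    have q: "q \<in> lin I" "\<And>b. b < k \<Longrightarrow> expectation (\<lambda>\<omega>. q \<omega> * Z b \<omega>) = 0"
      using residual_orthogonal[OF I(1) cj ZI Z(2)] unfolding q_def[abs_def] \<delta>_def by blast+
    have t: "0 < t" using coord_residual_pos[OF J j lin_combo[of \<delta>]] by (simp add: t_def q_def)
    define Z' where "Z' = Z(k := \<lambda>\<omega>. 1 / sqrt t * q \<omega>)"
    have Z'_less: "(\<Sum>a<k. u a * Z' a \<omega>) = (\<Sum>a<k. u a * Z a \<omega>)" for u \<omega>
      by (intro sum.cong) (auto simp: Z'_def)
    show ?thesis
    proof (rule that[OF I(1), of Z' \<gamma> 0, unfolded k_def[symmetric] Z'_less])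
      show "Z' a \<in> lin I" if "a < Suc k" for a
        using that ZI lin_scale[OF q(1), of "1 / sqrt t"] by (auto simp: Z'_def less_Suc_eq)
      show "orthonormal (Suc k) Z'"
        unfolding Z'_def t_def using t unfolding t_def by (intro orthonormal_extend Z(2) q(2))
      show "AE \<omega> in D. fst \<omega> = (\<Sum>a<k. \<gamma> a * Z a \<omega>) + 0 * Z' k \<omega>"
        using AE0 by eventually_elim (simp add: r_def g_def)
    qed (use P1 P2 in auto)
  qed
qed

end

section \<open>The least squares estimator\<close>

lemma ls_est_eqI:
  assumes "\<And>j. \<not> m j \<Longrightarrow> b0 j = 0"
    and "\<And>b. (\<And>j. \<not> m j \<Longrightarrow> b j = 0) \<Longrightarrow> sum_sq n m s b0 \<le> sum_sq n m s b"
    and "\<And>b. (\<And>j. \<not> m j \<Longrightarrow> b j = 0) \<Longrightarrow> sum_sq n m s b \<le> sum_sq n m s b0 \<Longrightarrow> b = b0"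
  shows "ls_est n m s = b0"
proof -
  have ls: "is_ls n m s b0" using assms(1,2) by (auto simp: is_ls_def)
  have uniq: "b = b0" if "is_ls n m s b" for b
    using that assms(1,3) by (auto simp: is_ls_def)
  have "\<exists>!b. is_ls n m s b" using ls uniq by blast
  moreover have "(THE b. is_ls n m s b) = b0" using ls uniq by (intro the_equality)
  ultimately show ?thesis by (simp add: ls_est_def)
qed

lemma predict_eq_imp_eq:
  assumes m: "finite {j. m j}" and b: "\<And>j. \<not> m j \<Longrightarrow> b j = 0" "\<And>j. \<not> m j \<Longrightarrow> b' j = 0"
    and eq: "\<And>x. predict m x b = predict m x b'"
  shows "b = b'"
proof
  fix j
  show "b j = b' j"
  proof (cases "m j")
    case True
    have "predict m (\<lambda>i. if i = j then 1 else 0) c = c j" for c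
      using m True by (simp add: predict_def if_distrib[of "\<lambda>t. t * _"] cong: if_cong)
    then show ?thesis using eq[of "\<lambda>i. if i = j then 1 else 0"] by simp
  qed (simp add: b)
qed

text \<open>The response sits in column \<open>k\<close>, so one Gram matrix carries the normal
  equations together with their right-hand side.\<close>

definition design :: "nat \<Rightarrow> (nat \<Rightarrow> nat) \<Rightarrow> sample \<Rightarrow> nat \<Rightarrow> nat \<Rightarrow> real" where
  "design k js s i a = (if a < k then snd (s i) (js a) else fst (s i))"

text \<open>The estimator is defined by a description operator, so its measurability needs a
  formula. Nonzero pivots give a unique minimizer; a zero pivot gives a null vector, which destroys
  uniqueness and triggers the default value 0.\<close>

lemma ls_est_eq_sol:
  assumes js: "bij_betw js {..<k} {j. m j}"
  shows "ls_est n m s j = (if nondeg k (gram n (design k js s)) \<and> m j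
      then sol k (gram n (design k js s)) (the_inv_into {..<k} js j) else 0)"
proof -
  let ?C = "design k js s"
  let ?G = "gram n ?C"
  have fin: "finite {j. m j}" using js by (metis bij_betw_finite finite_lessThan)
  have inj: "inj_on js {..<k}" and mjs: "\<And>a. a < k \<Longrightarrow> m (js a)" and img: "\<And>j. m j \<Longrightarrow> \<exists>a<k. j = js a"
    using js by (auto simp: bij_betw_def)
  have pr: "predict m x b = (\<Sum>a<k. x (js a) * b (js a))" for x b
    unfolding predict_def using sum.reindex_bij_betw[OF js, of "\<lambda>j. x j * b j"] by simp
  have ss: "sum_sq n m s b = (\<Sum>i<n. (1 * ?C i k - (\<Sum>a<k. b (js a) * ?C i a))\<^sup>2)" for b
    unfolding sum_sq_def pr by (simp add: design_def mult.commute)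
  show ?thesis
  proof (cases "nondeg k ?G")
    case True
    define b0 where "b0 j = (if m j then sol k ?G (the_inv_into {..<k} js j) else 0)" for j
    have b0js: "b0 (js a) = sol k ?G a" if "a < k" for a
      using that mjs the_inv_into_f_f[OF inj] by (simp add: b0_def)
    have dec: "sum_sq n m s b = schur k ?G + (\<Sum>i<n. (\<Sum>a<k. (b (js a) - sol k ?G a) * ?C i a)\<^sup>2)" for b
      unfolding ss least_squares_decomposition[OF True] by simp
    have dec0: "sum_sq n m s b0 = schur k ?G"
      unfolding dec using b0js by simp
    have "ls_est n m s = b0"
    proof (rule ls_est_eqI)
      fix b :: "nat \<Rightarrow> real" assume b: "\<And>j. \<not> m j \<Longrightarrow> b j = 0"
      show "sum_sq n m s b0 \<le> sum_sq n m s b" unfolding dec0 dec[of b] by (simp add: sum_nonneg)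
      assume "sum_sq n m s b \<le> sum_sq n m s b0"
      then have "(\<Sum>i<n. (\<Sum>a<k. (b (js a) - sol k ?G a) * ?C i a)\<^sup>2) = 0"
        unfolding dec0 dec[of b] by (intro antisym sum_nonneg) auto
      then have "(\<Sum>a<k. (b (js a) - sol k ?G a) * ?C i a) = 0" if "i < n" for i
        using that by (subst (asm) sum_nonneg_eq_0_iff) auto
      from nondeg_gram_independent[OF True this]
      have "b (js a) = b0 (js a)" if "a < k" for a using that b0js by auto
      then show "b = b0" using img b by (metis b0_def ext)
    qed (simp add: b0_def)
    then show ?thesis using True by (simp add: b0_def)
  next
    case False
    then obtain h where h: "\<exists>a<k. h a \<noteq> 0" "\<And>i. i < n \<Longrightarrow> (\<Sum>a<k. h a * ?C i a) = 0"
      using degenerate_gram_null_vector by blast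
    \<comment> \<open>Shifting a minimizer along this null vector changes no fitted value.\<close>
    define h' where "h' j = (if m j then h (the_inv_into {..<k} js j) else 0)" for j
    have h'js: "h' (js a) = h a" if "a < k" for a
      using that mjs the_inv_into_f_f[OF inj] by (simp add: h'_def)
    have "\<not> (\<exists>!b. is_ls n m s b)"
    proof
      assume "\<exists>!b. is_ls n m s b"
      then obtain b where b: "is_ls n m s b" and u: "\<And>b'. is_ls n m s b' \<Longrightarrow> b' = b" by blast
      have "sum_sq n m s (\<lambda>j. b j + h' j) = sum_sq n m s b"
        unfolding ss using h(2) h'js by (simp add: distrib_right sum.distrib)
      then have "is_ls n m s (\<lambda>j. b j + h' j)" using b by (auto simp: is_ls_def h'_def)
      from fun_cong[OF u[OF this]] have "h' j = 0" for j by (metis add_cancel_right_right)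
      then show False using h(1) h'js by metis
    qed
    then show ?thesis using False by (simp add: ls_est_def)
  qed
qed

context gauss_obs
begin

abbreviation S :: "nat \<Rightarrow> sample measure" where "S n \<equiv> (\<Pi>\<^sub>M i\<in>{..<n}. D)"

lemma sets_S: "sets (S n) = sets (\<Pi>\<^sub>M i\<in>{..<n}. obs_space)"
  by (intro sets_PiM_cong refl sets_D)

lemma prob_space_S: "prob_space (S n)"
  by (intro prob_space_PiM prob_space_axioms)

lemma measurable_sample_coord:
  assumes "i < n" shows "(\<lambda>s. fst (s i)) \<in> borel_measurable (S n)" "(\<lambda>s. snd (s i) j) \<in> borel_measurable (S n)"
proof -
  have i: "(\<lambda>s. s i) \<in> measurable (S n) obs_space"
    unfolding measurable_cong_sets[OF sets_S refl] using assms by (intro measurable_component_singleton) auto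
  from measurable_compose[OF i measurable_coord[of None]] measurable_compose[OF i measurable_coord[of "Some j"]]
  show "(\<lambda>s. fst (s i)) \<in> borel_measurable (S n)" "(\<lambda>s. snd (s i) j) \<in> borel_measurable (S n)" by simp_all
qed

lemma measurable_ls_est:
  assumes m: "finite {j. m j}"
  shows "(\<lambda>s. ls_est n m s j) \<in> borel_measurable (S n)"
proof -
  obtain js where js: "bij_betw js {..<msize m} {j. m j}"
    using ex_bij_betw_nat_finite[OF m] unfolding msize_def atLeast0LessThan by blast
  let ?k = "msize m"
  have "(\<lambda>s. gram n (design ?k js s) a b) \<in> borel_measurable (S n)" for a b
    unfolding gram_def design_def
    by (cases "a < ?k"; cases "b < ?k") (auto intro!: borel_measurable_sum borel_measurable_times measurable_sample_coord)
  from measurable_nondeg_schur_sol(1,3)[of ?k "\<lambda>s. gram n (design ?k js s)", OF this]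
  have [measurable]: "Measurable.pred (S n) (\<lambda>s. nondeg ?k (gram n (design ?k js s)))"
    "(\<lambda>s. sol ?k (gram n (design ?k js s)) a) \<in> borel_measurable (S n)" for a by blast+
  show ?thesis unfolding ls_est_eq_sol[OF js] by measurable
qed

section \<open>The sample in whitened coordinates\<close>

lemma std_gauss_family_sample:
  assumes I: "finite I" "\<And>a. a < Suc k \<Longrightarrow> Z a \<in> lin I" and Z: "orthonormal (Suc k) Z"
  shows "std_gauss_family (S n) ({..<n} \<times> {..k}) (\<lambda>p s. Z (snd p) (s (fst p)))"
  unfolding std_gauss_family_def
proof (intro conjI ballI allI)
  have Zm: "Z a \<in> borel_measurable D" if "a \<le> k" for a
    using lin_measurable[OF I(2)[of a]] that by (simp add: measurable_cong_sets[OF sets_D refl])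
  fix p assume p: "p \<in> {..<n} \<times> {..k}"
  have 1: "(\<lambda>s. s (fst p)) \<in> measurable (S n) D" using p by (intro measurable_component_singleton) auto
  have 2: "Z (snd p) \<in> borel_measurable D" using p by (intro Zm) auto
  show "(\<lambda>s. Z (snd p) (s (fst p))) \<in> borel_measurable (S n)"
    by (rule measurable_compose[OF 1 2])
next
  interpret P: product_sigma_finite "\<lambda>i::nat. D"
    by (intro product_sigma_finite.intro sigma_finite_measure_axioms)
  have Zm: "Z a \<in> borel_measurable D" if "a \<le> k" for a
    using lin_measurable[OF I(2)[of a]] that by (simp add: measurable_cong_sets[OF sets_D refl])
  fix t :: "nat \<times> nat \<Rightarrow> real"
  have "(CLINT s|S n. iexp (\<Sum>p\<in>{..<n} \<times> {..k}. t p * Z (snd p) (s (fst p))))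
      = (CLINT s|S n. (\<Prod>i<n. iexp (\<Sum>a<Suc k. t (i, a) * Z a (s i))))"
    unfolding exp_sum[OF finite_lessThan, symmetric] of_real_sum[symmetric] sum_distrib_left[symmetric] lessThan_Suc_atMost
    by (simp add: sum.cartesian_product split_beta')
  also have "\<dots> = (\<Prod>i<n. CLINT \<omega>|D. iexp (\<Sum>a<Suc k. t (i, a) * Z a \<omega>))"
  proof (rule P.product_integral_prod)
    fix i :: nat
    show "integrable D (\<lambda>\<omega>. iexp (\<Sum>a<Suc k. t (i, a) * Z a \<omega>))"
      using Zm by (intro integrable_iexp borel_measurable_sum borel_measurable_times) auto
  qed simp
  also have "\<dots> = (\<Prod>i<n. complex_of_real (exp (- (\<Sum>a<Suc k. (t (i, a))\<^sup>2) / 2)))"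
    by (intro prod.cong refl char_orthonormal[OF I Z])
  also have "\<dots> = complex_of_real (exp (\<Sum>i<n. - (\<Sum>a<Suc k. (t (i, a))\<^sup>2) / 2))"
    unfolding exp_sum[OF finite_lessThan] by simp
  also have "(\<Sum>i<n. - (\<Sum>a<Suc k. (t (i, a))\<^sup>2) / 2) = - (\<Sum>p\<in>{..<n} \<times> {..k}. (t p)\<^sup>2) / 2"
    unfolding lessThan_Suc_atMost sum_divide_distrib[symmetric] sum_negf by (simp add: sum.cartesian_product split_beta')
  finally show "(CLINT s|S n. iexp (\<Sum>p\<in>{..<n} \<times> {..k}. t p * Z (snd p) (s (fst p))))
      = complex_of_real (exp (- (\<Sum>p\<in>{..<n} \<times> {..k}. (t p)\<^sup>2) / 2))" .
qed

text \<open>The conditional prediction error at a fixed sample, as an integral over the future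
  observation only. \<open>cond_mspe_eq\<close> identifies it almost surely with the conditional
  expectation.\<close>

definition pred_err :: "nat \<Rightarrow> model \<Rightarrow> sample \<Rightarrow> real" where
  "pred_err n m s = expectation (\<lambda>\<omega>. (fst \<omega> - predict m (snd \<omega>) (ls_est n m s))\<^sup>2)"

lemma residual_lin:
  assumes m: "finite {j. m j}"
  shows "(\<lambda>\<omega>. fst \<omega> - predict m (snd \<omega>) b) \<in> lin (insert None (Some ` {j. m j}))"
proof -
  let ?I = "insert None (Some ` {j. m j})"
  have 1: "coord None \<in> lin ?I" using m by (intro lin_coord) auto
  have 2: "(\<lambda>\<omega>. \<Sum>j | m j. b j * coord (Some j) \<omega>) \<in> lin ?I"
    using m by (intro lin_sum lin_scale lin_coord) auto
  show ?thesis using lin_diff[OF 1 2] by (simp add: predict_def mult.commute)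
qed

text \<open>In the coordinates \<open>Z\<close> the true coefficients \<gamma> merely shift the
  minimizer and cancel from residuals and prediction errors. Only \<tau> and the standard normal
  matrix remain. The exceptional null set covers singular matrices and samples where the
  representation of the response fails.\<close>

lemma sample_representation:
  assumes m: "finite {j. m j}" and k: "msize m \<le> n"
  obtains \<tau> X where "0 \<le> \<tau>" "\<tau>\<^sup>2 \<le> expectation (\<lambda>\<omega>. (fst \<omega>)\<^sup>2)"
    "std_gauss_family (S n) ({..<n} \<times> {..msize m}) X"
    "AE s in S n. RSS n m s = \<tau>\<^sup>2 * schur (msize m) (gm n (\<lambda>p. X p s)) \<and>
        pred_err n m s = \<tau>\<^sup>2 * vif (msize m) (gm n (\<lambda>p. X p s))"
proof -
  define k where "k = msize m"
  obtain Z \<gamma> \<tau> I where "finite I" "\<And>a. a < Suc (msize m) \<Longrightarrow> Z a \<in> lin I" and "orthonormal (Suc (msize m)) Z"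
    and "\<And>b. \<exists>u. \<forall>\<omega>. predict m (snd \<omega>) b = (\<Sum>a<msize m. u a * Z a \<omega>)"
    and "\<And>u. \<exists>b. (\<forall>j. \<not> m j \<longrightarrow> b j = 0) \<and> (\<forall>\<omega>. predict m (snd \<omega>) b = (\<Sum>a<msize m. u a * Z a \<omega>))"
    and "AE \<omega> in D. fst \<omega> = (\<Sum>a<msize m. \<gamma> a * Z a \<omega>) + \<tau> * Z (msize m) \<omega>"
    and \<tau>: "0 \<le> \<tau>" "\<tau>\<^sup>2 \<le> expectation (\<lambda>\<omega>. (fst \<omega>)\<^sup>2)"
    by (rule canonical_form[OF m]) (rule that)
  note I = this(1,2)[folded k_def] and Z = this(3)[folded k_def] and P1 = this(4)[folded k_def]
    and P2 = this(5)[folded k_def] and Y = this(6)[folded k_def]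
  let ?X = "\<lambda>p s. Z (snd p) (s (fst p))"
  note fam = std_gauss_family_sample[OF I Z, of n]
  have XG: "gm n (\<lambda>p. ?X p s) = gram n (\<lambda>i a. Z a (s i))" for s by simp
  have dd: "distr (S n) (gauss_mat n k) (\<lambda>s. \<lambda>p\<in>{..<n} \<times> {..k}. ?X p s) = gauss_mat n k"
    by (rule std_gauss_family_distr[OF prob_space_S _ fam]) simp
  have "AE W in distr (S n) (gauss_mat n k) (\<lambda>s. \<lambda>p\<in>{..<n} \<times> {..k}. ?X p s). nondeg k (gm n W)"
    unfolding dd using k unfolding k_def[symmetric] by (rule AE_gauss_nondeg)
  moreover have "(\<lambda>s. \<lambda>p\<in>{..<n} \<times> {..k}. ?X p s) \<in> measurable (S n) (gauss_mat n k)"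
    unfolding measurable_cong_sets[OF refl sets_gauss]
    using fam by (intro measurable_restrict) (auto simp: std_gauss_family_def)
  ultimately have "AE s in S n. nondeg k (gm n (\<lambda>p\<in>{..<n} \<times> {..k}. ?X p s))"
    by (rule AE_distrD[rotated])
  moreover have "nondeg k (gm n (\<lambda>p\<in>{..<n} \<times> {..k}. ?X p s)) = nondeg k (gram n (\<lambda>i a. Z a (s i)))" for s
    by (rule nondeg_schur_sol_cong) (simp add: gram_def)
  ultimately have nd: "AE s in S n. nondeg k (gram n (\<lambda>i a. Z a (s i)))" by simp
  have ys: "AE s in S n. \<forall>i\<in>{..<n}. fst (s i) = (\<Sum>a<k. \<gamma> a * Z a (s i)) + \<tau> * Z k (s i)"
    by (intro AE_finite_allI finite_lessThan AE_PiM_component[where M = "\<lambda>_. D" and P = "\<lambda>\<omega>. fst \<omega> = (\<Sum>a<k. \<gamma> a * Z a \<omega>) + \<tau> * Z k \<omega>"]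
        prob_space_axioms Y)
  have "AE s in S n. RSS n m s = \<tau>\<^sup>2 * schur k (gm n (\<lambda>p. ?X p s)) \<and> pred_err n m s = \<tau>\<^sup>2 * vif k (gm n (\<lambda>p. ?X p s))"
    using nd ys
  proof eventually_elim
    case (elim s)
    let ?C = "\<lambda>i a. Z a (s i)"
    let ?G = "gram n ?C"
    define v where "v = sol k ?G"
    note nd = elim(1)
    have ys: "fst (s i) = (\<Sum>a<k. \<gamma> a * ?C i a) + \<tau> * ?C i k" if "i < n" for i using elim(2) that by simp
    \<comment> \<open>The minimizer: true coefficients plus \<tau> times the regression coefficients
      of the noise column.\<close>
    obtain b0 where b0: "\<And>j. \<not> m j \<Longrightarrow> b0 j = 0" and pb0: "\<And>\<omega>. predict m (snd \<omega>) b0 = (\<Sum>a<k. (\<gamma> a + \<tau> * v a) * Z a \<omega>)"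
      using P2[of "\<lambda>a. \<gamma> a + \<tau> * v a"] by blast
    have dec: "sum_sq n m s b = \<tau>\<^sup>2 * schur k ?G + (\<Sum>i<n. (\<Sum>a<k. (u a - \<gamma> a - \<tau> * v a) * ?C i a)\<^sup>2)"
      if u: "\<And>\<omega>. predict m (snd \<omega>) b = (\<Sum>a<k. u a * Z a \<omega>)" for b u
    proof -
      have "sum_sq n m s b = (\<Sum>i<n. (\<tau> * ?C i k - (\<Sum>a<k. (u a - \<gamma> a) * ?C i a))\<^sup>2)"
        unfolding sum_sq_def u by (auto simp: ys left_diff_distrib sum_subtractf intro!: sum.cong arg_cong[of _ _ power2])
      then show ?thesis unfolding least_squares_decomposition[OF nd] v_def .
    qed
    have dec0: "sum_sq n m s b0 = \<tau>\<^sup>2 * schur k ?G" unfolding dec[OF pb0] by simp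
    have ls: "ls_est n m s = b0"
    proof (rule ls_est_eqI)
      fix b :: "nat \<Rightarrow> real" assume b: "\<And>j. \<not> m j \<Longrightarrow> b j = 0"
      obtain u where u: "\<And>\<omega>. predict m (snd \<omega>) b = (\<Sum>a<k. u a * Z a \<omega>)" using P1[of b] by blast
      show "sum_sq n m s b0 \<le> sum_sq n m s b" unfolding dec0 dec[OF u] by (simp add: sum_nonneg)
      assume "sum_sq n m s b \<le> sum_sq n m s b0"
      then have "(\<Sum>i<n. (\<Sum>a<k. (u a - \<gamma> a - \<tau> * v a) * ?C i a)\<^sup>2) = 0"
        unfolding dec0 dec[OF u] by (intro antisym sum_nonneg) auto
      then have "(\<Sum>a<k. (u a - \<gamma> a - \<tau> * v a) * ?C i a) = 0" if "i < n" for i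
        using that by (subst (asm) sum_nonneg_eq_0_iff) auto
      from nondeg_gram_independent[OF nd this]
      have "u a - \<gamma> a - \<tau> * v a = 0" if "a < k" for a using that by blast
      then have p: "predict m (snd \<omega>) b = predict m (snd \<omega>) b0" for \<omega> :: obs
        unfolding u pb0 by (intro sum.cong) (auto simp: algebra_simps)
      have "predict m x b = predict m x b0" for x using p[of "(0, x)"] by simp
      with m b b0 show "b = b0" by (rule predict_eq_imp_eq)
    qed (rule b0)
    have "RSS n m s = \<tau>\<^sup>2 * schur k ?G" unfolding RSS_def ls sum_sq_def[symmetric] by (rule dec0)
    moreover have "pred_err n m s = \<tau>\<^sup>2 * vif k ?G"
    proof -
      \<comment> \<open>Coefficients of the prediction error
        \<open>\<tau> * (Z k - (\<Sum>a<k. v a * Z a))\<close>; the squares sum to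
        \<open>\<tau>^2 * vif\<close>.\<close>
      define w where "w a = (if a < k then - (\<tau> * v a) else \<tau>)" for a
      have "pred_err n m s = expectation (\<lambda>\<omega>. (\<Sum>a<Suc k. w a * Z a \<omega>)\<^sup>2)"
        unfolding pred_err_def ls
      proof (rule integral_cong_AE)
        show "AE \<omega> in D. (fst \<omega> - predict m (snd \<omega>) b0)\<^sup>2 = (\<Sum>a<Suc k. w a * Z a \<omega>)\<^sup>2"
          using Y by eventually_elim (simp add: pb0 w_def distrib_right sum.distrib sum_negf)
        show "(\<lambda>\<omega>. (fst \<omega> - predict m (snd \<omega>) b0)\<^sup>2) \<in> borel_measurable D"
          using lin_measurable[OF residual_lin[OF m]] by (simp add: measurable_cong_sets[OF sets_D refl])
        have "Z a \<in> borel_measurable D" if "a < Suc k" for a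
          using lin_measurable[OF I(2)[OF that]] by (simp add: measurable_cong_sets[OF sets_D refl])
        then show "(\<lambda>\<omega>. (\<Sum>a<Suc k. w a * Z a \<omega>)\<^sup>2) \<in> borel_measurable D"
          by (intro borel_measurable_power borel_measurable_sum borel_measurable_times) auto
      qed
      also have "\<dots> = (\<Sum>a<Suc k. (w a)\<^sup>2)" by (rule expectation_square_orthonormal[OF I Z])
      also have "\<dots> = \<tau>\<^sup>2 * vif k ?G"
        by (simp add: w_def vif_def v_def power_mult_distrib sum_distrib_left distrib_left)
      finally show ?thesis .
    qed
    ultimately show ?case by simp
  qed
  then show ?thesis using that[OF \<tau> fam[unfolded k_def]] unfolding k_def by blast
qed

end

section \<open>Prediction errors\<close>

lemma vif_cong:
  assumes "\<And>i j. i \<le> k \<Longrightarrow> j \<le> k \<Longrightarrow> G i j = H i j"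
  shows "vif k G = vif k H"
  using nondeg_schur_sol_cong(3)[of k G H] assms by (simp add: vif_def)

lemma gm_restrict:
  "a \<le> k \<Longrightarrow> b \<le> k \<Longrightarrow> gm n (restrict W ({..<n} \<times> {..k})) a b = gm n W a b"
  unfolding gram_def by (intro sum.cong) auto

lemma schur_vif_restrict:
  "schur k (gm n (restrict W ({..<n} \<times> {..k}))) = schur k (gm n W)"
  "vif k (gm n (restrict W ({..<n} \<times> {..k}))) = vif k (gm n W)"
  by (intro nondeg_schur_sol_cong(2) vif_cong gm_restrict; assumption)+

context gauss_obs
begin

interpretation S: prob_space "S n" for n by (rule prob_space_S)

interpretation SD: pair_prob_space "S n" D for n
  by (intro pair_prob_space.intro pair_sigma_finite.intro S.sigma_finite_measure_axioms
      sigma_finite_measure_axioms prob_space_S prob_space_axioms)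

lemma measurable_sq_pred_err:
  assumes m: "finite {j. m j}"
  shows "sq_pred_err n m \<in> borel_measurable (S n \<Otimes>\<^sub>M D)"
proof -
  have [measurable]: "(\<lambda>\<omega>. fst (snd \<omega>)) \<in> borel_measurable (S n \<Otimes>\<^sub>M D)"
    "(\<lambda>\<omega>. snd (snd \<omega>) j) \<in> borel_measurable (S n \<Otimes>\<^sub>M D)" for j
    using measurable_coord[of None] measurable_coord[of "Some j"] unfolding coord_def[abs_def] option.case
    by (auto intro!: measurable_compose[OF measurable_snd] simp: measurable_cong_sets[OF sets_D refl])
  have [measurable]: "(\<lambda>\<omega>. ls_est n m (fst \<omega>) j) \<in> borel_measurable (S n \<Otimes>\<^sub>M D)" for j
    by (rule measurable_compose[OF measurable_fst measurable_ls_est[OF m]])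
  show ?thesis unfolding sq_pred_err_def predict_def by measurable
qed

lemma measurable_pred_err:
  assumes m: "finite {j. m j}"
  shows "pred_err n m \<in> borel_measurable (S n)"
proof -
  have "(\<lambda>s. \<integral>\<omega>. sq_pred_err n m (s, \<omega>) \<partial>D) \<in> borel_measurable (S n)"
    using measurable_sq_pred_err[OF m] by (intro borel_measurable_lebesgue_integral) simp
  then show ?thesis by (simp add: pred_err_def[abs_def] sq_pred_err_def)
qed

lemma integrable_sq_pred_err_D:
  assumes "finite {j. m j}" shows "integrable D (\<lambda>\<omega>. sq_pred_err n m (s, \<omega>))"
  using assms lin_integrable(3)[OF _ residual_lin[OF assms] residual_lin[OF assms]] by (simp add: sq_pred_err_def)

lemma pred_err_eq: "pred_err n m s = (\<integral>\<omega>. sq_pred_err n m (s, \<omega>) \<partial>D)"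
  by (simp add: pred_err_def sq_pred_err_def)

text \<open>The nonnegative integral comes first. Its finiteness, due to the finite mean of
  \<open>vif\<close>, yields integrability, which the conditional expectation needs as well.\<close>

lemma mspe_eq:
  assumes m: "finite {j. m j}" and k: "msize m + 2 \<le> n"
    and X: "std_gauss_family (S n) ({..<n} \<times> {..msize m}) X"
    and AE: "AE s in S n. pred_err n m s = \<tau>\<^sup>2 * vif (msize m) (gm n (\<lambda>p. X p s))"
  shows "integrable (S n \<Otimes>\<^sub>M D) (sq_pred_err n m)"
    and "mspe n D m = \<tau>\<^sup>2 * ((real n - 1) / (real n - 1 - real (msize m)))"
proof -
  let ?k = "msize m"
  let ?v = "(real n - 1) / (real n - 1 - real ?k)"
  note sm = measurable_sq_pred_err[OF m, of n]
  have "(\<integral>\<^sup>+\<omega>. ennreal (sq_pred_err n m \<omega>) \<partial>(S n \<Otimes>\<^sub>M D)) = (\<integral>\<^sup>+s. \<integral>\<^sup>+\<omega>. ennreal (sq_pred_err n m (s, \<omega>)) \<partial>D \<partial>S n)"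
    using sm by (intro nn_integral_fst[symmetric]) simp
  also have "\<dots> = (\<integral>\<^sup>+s. ennreal (pred_err n m s) \<partial>S n)"
    unfolding pred_err_eq using integrable_sq_pred_err_D[OF m]
    by (intro nn_integral_cong nn_integral_eq_integral) (auto simp: sq_pred_err_def)
  also have "\<dots> = (\<integral>\<^sup>+s. ennreal (\<tau>\<^sup>2) * ennreal (vif ?k (gm n (\<lambda>p\<in>{..<n} \<times> {..?k}. X p s))) \<partial>S n)"
  proof (rule nn_integral_cong_AE)
    show "AE s in S n. ennreal (pred_err n m s) = ennreal (\<tau>\<^sup>2) * ennreal (vif ?k (gm n (\<lambda>p\<in>{..<n} \<times> {..?k}. X p s)))"
      using AE by eventually_elim (unfold schur_vif_restrict, simp add: ennreal_mult' vif_pos less_imp_le)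
  qed
  also have "\<dots> = (\<integral>\<^sup>+W. ennreal (\<tau>\<^sup>2) * ennreal (vif ?k (gm n W)) \<partial>gauss_mat n ?k)"
    by (rule std_gauss_family_nn_integral[OF prob_space_S _ X, of "\<lambda>W. ennreal (\<tau>\<^sup>2) * ennreal (vif ?k (gm n W))"]) (simp, measurable)
  also have "\<dots> = ennreal (\<tau>\<^sup>2) * ennreal ?v"
    using k by (subst nn_integral_cmult) (auto simp: nn_integral_vif)
  also have "\<dots> = ennreal (\<tau>\<^sup>2 * ?v)" using k by (intro ennreal_mult'[symmetric]) simp
  finally have nn: "(\<integral>\<^sup>+\<omega>. ennreal (sq_pred_err n m \<omega>) \<partial>(S n \<Otimes>\<^sub>M D)) = ennreal (\<tau>\<^sup>2 * ?v)" .
  show "integrable (S n \<Otimes>\<^sub>M D) (sq_pred_err n m)"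
    using sm nn by (intro integrableI_nonneg) (auto simp: sq_pred_err_def)
  have "0 \<le> \<tau>\<^sup>2 * ?v" using k by simp
  then show "mspe n D m = \<tau>\<^sup>2 * ?v"
    unfolding mspe_def prediction_space_def using sm nn
    by (subst integral_eq_nn_integral) (auto simp: sq_pred_err_def)
qed

text \<open>Events of the sample algebra are cylinders over sets of samples. On such a cylinder
  Fubini averages out the future observation, which leaves \<open>pred_err\<close>.\<close>

lemma cond_mspe_eq:
  assumes m: "finite {j. m j}" and int: "integrable (S n \<Otimes>\<^sub>M D) (sq_pred_err n m)"
  shows "AE \<omega> in prediction_space n D. cond_mspe n D m \<omega> = pred_err n m (fst \<omega>)"
proof -
  let ?P = "S n \<Otimes>\<^sub>M D"
  let ?S' = "\<Pi>\<^sub>M i\<in>{..<n}. obs_space"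
  let ?F = "vimage_algebra (space ?P) fst ?S'"
  have fst_m: "fst \<in> measurable ?P ?S'"
    using measurable_fst[of "S n" D] by (simp add: measurable_cong_sets[OF refl sets_S])
  have sp: "fst \<in> space ?P \<rightarrow> space ?S'" using measurable_space[OF fst_m] by auto
  have sub: "subalgebra ?P ?F"
    unfolding subalgebra_def
  proof
    show "sets ?F \<subseteq> sets ?P"
      unfolding sets_vimage_algebra2[OF sp] using measurable_sets[OF fst_m] by auto
  qed simp
  interpret finite_measure_subalgebra ?P ?F
    using sub SD.P.finite_measure_axioms by (intro finite_measure_subalgebra.intro finite_measure_subalgebra_axioms.intro)
  have fstF: "fst \<in> measurable ?F ?S'" by (rule measurable_vimage_algebra1[OF sp])
  have pm: "pred_err n m \<in> borel_measurable ?S'"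
    using measurable_pred_err[OF m, of n] by (simp add: measurable_cong_sets[OF sets_S refl])
  have gF: "(\<lambda>\<omega>. pred_err n m (fst \<omega>)) \<in> borel_measurable ?F" by (rule measurable_compose[OF fstF pm])
  have pint: "integrable (S n) (pred_err n m)"
    using SD.integrable_fst'[OF int] by (simp add: pred_err_eq[abs_def])
  have gint: "integrable ?P (\<lambda>\<omega>. pred_err n m (fst \<omega>))"
  proof -
    have "distr ?P (S n) fst = S n" by (rule distr_pair_fst)
    then have "integrable (distr ?P (S n) fst) (pred_err n m)" using pint by simp
    then show ?thesis by (rule integrable_distr[OF measurable_fst])
  qed
  have "AE \<omega> in ?P. real_cond_exp ?P ?F (sq_pred_err n m) \<omega> = pred_err n m (fst \<omega>)"
  proof (rule real_cond_exp_charact[OF _ int gint gF])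
    fix A assume "A \<in> sets ?F"
    then obtain B where B: "B \<in> sets ?S'" "A = fst -` B \<inter> space ?P"
      unfolding sets_vimage_algebra2[OF sp] by auto
    have BS: "B \<in> sets (S n)" using B(1) by (simp add: sets_S)
    have A: "A \<in> sets ?P" unfolding B(2) using measurable_sets[OF fst_m B(1)] .
    have ind: "indicator A (s, \<omega>) = (indicator B s :: real)" if "s \<in> space (S n)" "\<omega> \<in> space D" for s \<omega>
      using that unfolding B(2) by (simp add: indicator_def space_pair_measure)
    have main: "set_lebesgue_integral ?P A f = (\<integral>s. indicator B s * (\<integral>\<omega>. f (s, \<omega>) \<partial>D) \<partial>S n)"
      if f: "integrable ?P f" for f :: "sample \<times> obs \<Rightarrow> real"
    proof -
      have "integrable ?P (\<lambda>x. indicator A x *\<^sub>R f x)" using A f by (rule integrable_mult_indicator)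
      from SD.integral_fst'[OF this]
      have "set_lebesgue_integral ?P A f = (\<integral>s. \<integral>\<omega>. indicator A (s, \<omega>) *\<^sub>R f (s, \<omega>) \<partial>D \<partial>S n)"
        unfolding set_lebesgue_integral_def by simp
      also have "\<dots> = (\<integral>s. \<integral>\<omega>. indicator B s * f (s, \<omega>) \<partial>D \<partial>S n)"
        using ind by (intro Bochner_Integration.integral_cong refl) simp
      finally show ?thesis by simp
    qed
    show "set_lebesgue_integral ?P A (sq_pred_err n m) = (\<integral>x\<in>A. pred_err n m (fst x) \<partial>?P)"
      unfolding main[OF int] main[OF gint] by (simp add: pred_err_eq[symmetric] prob_space)
  qed
  then show ?thesis
    unfolding cond_mspe_def prediction_space_def sample_algebra_def .
qed

lemma emeasure_transfer:
  assumes X: "std_gauss_family (S n) ({..<n} \<times> {..k}) X" and A: "A \<in> sets borel"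
    and g: "g = schur k \<or> g = vif k"
  shows "{s \<in> space (S n). g (gm n (\<lambda>p. X p s)) \<in> A} \<in> sets (S n)"
    and "emeasure (S n) {s \<in> space (S n). g (gm n (\<lambda>p. X p s)) \<in> A}
      = emeasure (gauss_mat n k) {W \<in> space (gauss_mat n k). g (gm n W) \<in> A}"
proof -
  let ?G = "gauss_mat n k"
  let ?R = "\<lambda>s. \<lambda>p\<in>{..<n} \<times> {..k}. X p s"
  have R: "?R \<in> measurable (S n) ?G"
    unfolding measurable_cong_sets[OF refl sets_gauss]
    using X by (intro measurable_restrict) (auto simp: std_gauss_family_def)
  have dd: "distr (S n) ?G ?R = ?G"
    by (rule std_gauss_family_distr[OF prob_space_S _ X]) simp
  have gm: "(\<lambda>W. g (gm n W)) \<in> borel_measurable ?G" using g by (auto intro: measurable_gm_nondeg_schur_sol measurable_vif)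
  have B: "{W \<in> space ?G. g (gm n W) \<in> A} \<in> sets ?G" using gm A by measurable
  have gr: "g (gm n (?R s)) = g (gm n (\<lambda>p. X p s))" for s
    using g schur_vif_restrict by auto
  have eq: "{s \<in> space (S n). g (gm n (\<lambda>p. X p s)) \<in> A} = ?R -` {W \<in> space ?G. g (gm n W) \<in> A} \<inter> space (S n)"
    using measurable_space[OF R] gr by auto
  show "{s \<in> space (S n). g (gm n (\<lambda>p. X p s)) \<in> A} \<in> sets (S n)"
    unfolding eq by (rule measurable_sets[OF R B])
  show "emeasure (S n) {s \<in> space (S n). g (gm n (\<lambda>p. X p s)) \<in> A} = emeasure ?G {W \<in> space ?G. g (gm n W) \<in> A}"
    unfolding eq emeasure_distr[OF R B, symmetric] dd ..
qed

end

section \<open>Uniform bounds\<close>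

text \<open>Criteria and prediction errors are all compared with \<open>t \<cdot> n / d\<close>, where \<open>t\<close> stands for \<open>\<tau>\<^sup>2\<close>.\<close>
lemma criterion_error_bound:
  fixes n d t c \<delta> u V \<kappa> :: real
  assumes d: "2 \<le> d" "d \<le> n" and t: "0 \<le> t" "t \<le> c" and \<delta>: "0 \<le> \<delta>" "\<delta> \<le> 1"
    and u: "d * (1 - \<delta>) < u" "u < d * (1 + \<delta>)"
    and V: "(1 - \<delta>) * ((n + 1) / (d + 1)) < V" "V < (1 + \<delta>) * ((n + 1) / (d + 1))"
    and \<kappa>: "\<kappa> \<in> {n / d, (n - 1) / (d - 1), (n + 1) / (d + 1)}"
  shows "\<bar>t * u / d * \<kappa> - t * V\<bar> \<le> c * (2 * \<delta> * (n / d) + 6 * (n / d) / d)"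
    and "\<bar>t * u / d * \<kappa> - t * ((n - 1) / (d - 1))\<bar> \<le> c * (2 * \<delta> * (n / d) + 6 * (n / d) / d)"
proof -
  define q where "q = n / d"
  have d0: "0 < d" and n0: "0 < n" and q0: "0 \<le> q" using d by (auto simp: q_def)
  have up: "0 \<le> (n - 1) / (d - 1) - q" "(n - 1) / (d - 1) - q \<le> 2 * (q / d)"
  proof -
    have e: "(n - 1) / (d - 1) - q = (n - d) / (d * (d - 1))"
      using d by (simp add: q_def field_simps)
    show "0 \<le> (n - 1) / (d - 1) - q" unfolding e using d by simp
    have "(n - d) / (d * (d - 1)) \<le> n / (d * (d / 2))"
      using d by (intro frac_le mult_left_mono) auto
    also have "n / (d * (d / 2)) = 2 * (q / d)" by (simp add: q_def)
    finally show "(n - 1) / (d - 1) - q \<le> 2 * (q / d)" unfolding e .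
  qed
  have dn: "(n + 1) / (d + 1) - q \<le> 0" "- (2 * (q / d)) \<le> (n + 1) / (d + 1) - q"
  proof -
    have e: "(n + 1) / (d + 1) - q = - ((n - d) / (d * (d + 1)))"
      unfolding q_def minus_divide_left using d by (simp add: field_simps)
    show "(n + 1) / (d + 1) - q \<le> 0" unfolding e using d by simp
    have "(n - d) / (d * (d + 1)) \<le> n / (d * d)"
      using d by (intro frac_le mult_left_mono) auto
    also have "n / (d * d) = q / d" by (simp add: q_def)
    also have "\<dots> \<le> 2 * (q / d)" using divide_nonneg_pos[OF q0 d0] by linarith
    finally show "- (2 * (q / d)) \<le> (n + 1) / (d + 1) - q" unfolding e by simp
  qed
  have qd0: "0 \<le> q / d" using q0 d0 by simp
  have \<kappa>q: "\<bar>\<kappa> - q\<bar> \<le> 2 * (q / d)" using \<kappa> up dn qd0 unfolding q_def by auto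
  have ud: "\<bar>u / d - 1\<bar> \<le> \<delta>"
  proof -
    have "1 - \<delta> < u / d" "u / d < 1 + \<delta>" using u d0 by (simp_all add: pos_less_divide_eq pos_divide_less_eq mult.commute)
    then show ?thesis by linarith
  qed
  have c1: "\<bar>u / d * \<kappa> - q\<bar> \<le> \<delta> * q + 4 * (q / d)"
  proof -
    have "w * \<kappa> - q = w * (\<kappa> - q) + (w - 1) * q" for w by (simp add: algebra_simps)
    from this[of "u / d"] have "u / d * \<kappa> - q = u / d * (\<kappa> - q) + (u / d - 1) * q" .
    then have "\<bar>u / d * \<kappa> - q\<bar> \<le> \<bar>u / d\<bar> * \<bar>\<kappa> - q\<bar> + \<bar>u / d - 1\<bar> * \<bar>q\<bar>"
      by (metis abs_mult abs_triangle_ineq)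
    \<comment> \<open>The first factor 2 bounds \<open>u / d\<close>, as
      \<open>\<delta> \<le> 1\<close>; the inner one is the distance of \<kappa> from
      \<open>q\<close> in units of \<open>q / d\<close>.\<close>
    also have "\<dots> \<le> 2 * (2 * (q / d)) + \<delta> * q"
      using ud \<delta> \<kappa>q q0 qd0 by (intro add_mono mult_mono) auto
    finally show ?thesis by simp
  qed
  have c2: "\<bar>V - q\<bar> \<le> \<delta> * q + 2 * (q / d)"
  proof -
    have p: "0 \<le> (n + 1) / (d + 1)" using n0 d0 by simp
    have "\<delta> * ((n + 1) / (d + 1)) \<le> \<delta> * q" using dn(1) \<delta> by (intro mult_left_mono) auto
    moreover have "(1 - \<delta>) * ((n + 1) / (d + 1)) = (n + 1) / (d + 1) - \<delta> * ((n + 1) / (d + 1))"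
      "(1 + \<delta>) * ((n + 1) / (d + 1)) = (n + 1) / (d + 1) + \<delta> * ((n + 1) / (d + 1))"
      by (simp_all only: left_diff_distrib distrib_right mult_1)
    ultimately show ?thesis using V dn unfolding abs_le_iff by linarith
  qed
  have c3: "\<bar>(n - 1) / (d - 1) - q\<bar> \<le> \<delta> * q + 2 * (q / d)"
    using up q0 \<delta> by (simp add: add_increasing)
  \<comment> \<open>The triangle inequality through \<open>q\<close>: the criterion contributes
    \<open>\<delta> * q + 4 * (q / d)\<close>, and either prediction error contributes
    \<open>\<delta> * q + 2 * (q / d)\<close>.\<close>
  have fin: "\<bar>t * u / d * \<kappa> - t * v\<bar> \<le> c * (2 * \<delta> * (n / d) + 6 * (n / d) / d)"
    if v: "\<bar>v - q\<bar> \<le> \<delta> * q + 2 * (q / d)" for v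
  proof -
    have "\<bar>t * u / d * \<kappa> - t * v\<bar> = t * \<bar>u / d * \<kappa> - v\<bar>"
    proof -
      have "t * u / d * \<kappa> - t * v = t * (u / d * \<kappa> - v)" by (simp add: right_diff_distrib)
      then show ?thesis using t by (simp add: abs_mult)
    qed
    also have "\<dots> \<le> c * (2 * \<delta> * q + 6 * (q / d))"
    proof (intro mult_mono)
      show "\<bar>u / d * \<kappa> - v\<bar> \<le> 2 * \<delta> * q + 6 * (q / d)"
      proof -
        have "\<bar>x - v\<bar> \<le> A + C" if "\<bar>x - q\<bar> \<le> A" "\<bar>v - q\<bar> \<le> C" for x A C using that by linarith
        from this[OF c1 v] show ?thesis by (simp add: algebra_simps)
      qed
    qed (use t in auto)
    finally show ?thesis by (simp add: q_def)
  qed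
  show "\<bar>t * u / d * \<kappa> - t * V\<bar> \<le> c * (2 * \<delta> * (n / d) + 6 * (n / d) / d)" by (rule fin[OF c2])
  show "\<bar>t * u / d * \<kappa> - t * ((n - 1) / (d - 1))\<bar> \<le> c * (2 * \<delta> * (n / d) + 6 * (n / d) / d)" by (rule fin[OF c3])
qed

lemma criterion_eq:
  assumes "crit \<in> {GCV, S_p, rho_hat_sq}" "msize m + 2 \<le> n"
  defines "d \<equiv> real n - real (msize m)"
  obtains \<kappa> where "\<kappa> \<in> {real n / d, (real n - 1) / (d - 1), (real n + 1) / (d + 1)}" "\<And>s. crit n m s = RSS n m s / d * \<kappa>"
  using assms by (force simp: GCV_def S_p_def rho_hat_sq_def algebra_simps)

context gauss_obs
begin

interpretation S: prob_space "S n" for n by (rule prob_space_S)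

interpretation SD: pair_prob_space "S n" D for n
  by (intro pair_prob_space.intro pair_sigma_finite.intro S.sigma_finite_measure_axioms
      sigma_finite_measure_axioms prob_space_S prob_space_axioms)

text \<open>The factor 6 is 1 + 1 for the two tails of \<open>schur\<close> and 2 + 2 for those of
  \<open>vif\<close>. The constant 256 is 16 times 16, because \<open>vif\<close> is controlled
  through deviations \<delta>/4. The same exceptional event serves both prediction errors.\<close>

lemma model_tail:
  fixes n :: nat and \<delta> c :: real
  assumes m: "finite {j. m j}" and k: "msize m + 2 \<le> n" and c: "expectation (\<lambda>\<omega>. (fst \<omega>)\<^sup>2) \<le> c"
    and \<delta>: "0 \<le> \<delta>" "\<delta> \<le> 1" and crit: "crit \<in> {GCV, S_p, rho_hat_sq}"
  defines "d \<equiv> real n - real (msize m)"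
  assumes half: "exp (- d * \<delta>\<^sup>2 / 256) < 1 / 2"
  defines "\<epsilon> \<equiv> c * (2 * \<delta> * (real n / d) + 6 * (real n / d) / d)"
  obtains B where "B \<in> sets (S n)" "emeasure (S n) B \<le> ennreal (6 * exp (- d * \<delta>\<^sup>2 / 256))"
    "AE \<omega> in prediction_space n D. fst \<omega> \<notin> B \<longrightarrow>
      \<bar>crit n m (fst \<omega>) - cond_mspe n D m \<omega>\<bar> \<le> \<epsilon> \<and> \<bar>crit n m (fst \<omega>) - mspe n D m\<bar> \<le> \<epsilon>"
proof -
  define k where "k = msize m"
  have kn: "k \<le> n" "k + 2 \<le> n" using k by (auto simp: k_def)
  have dk: "d = real (n - k)" "d + 1 = real (Suc n - k)" using kn by (auto simp: d_def k_def of_nat_diff)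
  obtain \<tau> X where \<tau>: "0 \<le> \<tau>" "\<tau>\<^sup>2 \<le> expectation (\<lambda>\<omega>. (fst \<omega>)\<^sup>2)"
    and X: "std_gauss_family (S n) ({..<n} \<times> {..k}) X"
    and AE: "AE s in S n. RSS n m s = \<tau>\<^sup>2 * schur k (gm n (\<lambda>p. X p s)) \<and>
        pred_err n m s = \<tau>\<^sup>2 * vif k (gm n (\<lambda>p. X p s))"
    unfolding k_def using sample_representation[OF m, of n] k by auto
  have AEp: "AE s in S n. pred_err n m s = \<tau>\<^sup>2 * vif (msize m) (gm n (\<lambda>p. X p s))"
    using AE unfolding k_def by eventually_elim simp
  note ms = mspe_eq[OF m k X[unfolded k_def] AEp]
  note cm = cond_mspe_eq[OF m ms(1)]
  obtain \<kappa> where \<kappa>: "\<kappa> \<in> {real n / d, (real n - 1) / (d - 1), (real n + 1) / (d + 1)}"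
    and ck: "\<And>s. crit n m s = RSS n m s / d * \<kappa>"
    by (rule criterion_eq[OF crit k, folded d_def]) (rule that)
  let ?g1 = "\<lambda>s. schur k (gm n (\<lambda>p. X p s))" and ?g2 = "\<lambda>s. vif k (gm n (\<lambda>p. X p s))"
  let ?r = "(real n + 1) / (d + 1)"
  define B1 where "B1 = {s \<in> space (S n). ?g1 s \<in> {d * (1 + \<delta>)..}}"
  define B2 where "B2 = {s \<in> space (S n). ?g1 s \<in> {..d * (1 - \<delta>)}}"
  define B3 where "B3 = {s \<in> space (S n). ?g2 s \<in> {(1 + \<delta>) * ?r..}}"
  define B4 where "B4 = {s \<in> space (S n). ?g2 s \<in> {..(1 - \<delta>) * ?r}}"
  define B where "B = B1 \<union> B2 \<union> (B3 \<union> B4)"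
  have sB: "B1 \<in> sets (S n)" "B2 \<in> sets (S n)" "B3 \<in> sets (S n)" "B4 \<in> sets (S n)"
    unfolding B1_def B2_def B3_def B4_def
    by (rule emeasure_transfer(1)[OF X, of _ "schur k"] emeasure_transfer(1)[OF X, of _ "vif k"]; simp)+
  let ?e = "exp (- d * \<delta>\<^sup>2 / 256)"
  have d0: "2 \<le> d" "d \<le> real n" using k by (auto simp: d_def)
  have e1: "exp (- real (n - k) * \<delta>\<^sup>2 / 16) \<le> ?e"
    unfolding dk[symmetric] using d0 by (simp add: field_simps)
  have e2: "exp (- real (Suc n - k) * (\<delta> / 4)\<^sup>2 / 16) \<le> ?e"
    unfolding dk(2)[symmetric] by (simp add: power_divide left_diff_distrib)
  \<comment> \<open>The hypothesis \<open>half\<close> speaks of \<open>d\<close>; it passes to the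
    dimension \<open>Suc n\<close> of \<open>T\<close> because \<open>d \<le> Suc n\<close>.\<close>
  have e3: "exp (- real (Suc n) * (\<delta> / 4)\<^sup>2 / 16) < 1 / 2"
  proof -
    have "d * \<delta>\<^sup>2 \<le> real (Suc n) * \<delta>\<^sup>2" using d0 by (intro mult_right_mono) auto
    then have "exp (- real (Suc n) * (\<delta> / 4)\<^sup>2 / 16) \<le> ?e"
      by (simp add: power_divide left_diff_distrib distrib_right)
    then show ?thesis using half by (rule order.strict_trans1)
  qed
  have "emeasure (S n) B1 \<le> ennreal ?e"
    using emeasure_transfer(2)[OF X, of "{d * (1 + \<delta>)..}" "schur k"] emeasure_schur_tails(1)[OF kn(1) \<delta>] e1
    unfolding B1_def dk(1)[symmetric] by (auto intro: order_trans ennreal_leI)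
  moreover have "emeasure (S n) B2 \<le> ennreal ?e"
    using emeasure_transfer(2)[OF X, of "{..d * (1 - \<delta>)}" "schur k"] emeasure_schur_tails(2)[OF kn(1) \<delta>] e1
    unfolding B2_def dk(1)[symmetric] by (auto intro: order_trans ennreal_leI)
  moreover have "emeasure (S n) B3 \<le> ennreal (2 * ?e)"
  proof -
    have "emeasure (S n) B3 \<le> ennreal (2 * exp (- real (Suc n - k) * (\<delta> / 4)\<^sup>2 / 16))"
      using emeasure_transfer(2)[OF X, of "{(1 + \<delta>) * ?r..}" "vif k"] emeasure_vif_tails(1)[OF kn(1) \<delta> e3]
      unfolding B3_def dk(2)[symmetric] by (simp add: add.commute)
    also have "\<dots> \<le> ennreal (2 * ?e)" using e2 by (intro ennreal_leI) simp
    finally show ?thesis .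
  qed
  moreover have "emeasure (S n) B4 \<le> ennreal (2 * ?e)"
  proof -
    have "emeasure (S n) B4 \<le> ennreal (2 * exp (- real (Suc n - k) * (\<delta> / 4)\<^sup>2 / 16))"
      using emeasure_transfer(2)[OF X, of "{..(1 - \<delta>) * ?r}" "vif k"] emeasure_vif_tails(2)[OF kn(1) \<delta> e3]
      unfolding B4_def dk(2)[symmetric] by (simp add: add.commute)
    also have "\<dots> \<le> ennreal (2 * ?e)" using e2 by (intro ennreal_leI) simp
    finally show ?thesis .
  qed
  moreover have "emeasure (S n) B \<le> (emeasure (S n) B1 + emeasure (S n) B2) + (emeasure (S n) B3 + emeasure (S n) B4)"
    unfolding B_def using sB
    by (intro order_trans[OF emeasure_subadditive] add_mono emeasure_subadditive) auto
  ultimately have "emeasure (S n) B \<le> (ennreal ?e + ennreal ?e) + (ennreal (2 * ?e) + ennreal (2 * ?e))"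
    by (meson add_mono order_trans)
  also have "\<dots> = ennreal (6 * ?e)" by (simp flip: ennreal_plus)
  finally have mB: "emeasure (S n) B \<le> ennreal (6 * ?e)" .
  have fst_S: "distr (S n \<Otimes>\<^sub>M D) (S n) fst = S n" by (rule distr_pair_fst)
  have AE': "AE \<omega> in prediction_space n D. RSS n m (fst \<omega>) = \<tau>\<^sup>2 * ?g1 (fst \<omega>) \<and> pred_err n m (fst \<omega>) = \<tau>\<^sup>2 * ?g2 (fst \<omega>)"
    unfolding prediction_space_def
    by (rule AE_distrD[OF measurable_fst]) (use AE in \<open>simp only: fst_S\<close>)
  show ?thesis
  proof (rule that[OF _ mB])
    show "B \<in> sets (S n)" unfolding B_def using sB by auto
    show "AE \<omega> in prediction_space n D. fst \<omega> \<notin> B \<longrightarrow>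
      \<bar>crit n m (fst \<omega>) - cond_mspe n D m \<omega>\<bar> \<le> \<epsilon> \<and> \<bar>crit n m (fst \<omega>) - mspe n D m\<bar> \<le> \<epsilon>"
      using AE' cm AE_space
    proof eventually_elim
      case (elim \<omega>)
      have sp: "fst \<omega> \<in> space (S n)" using elim(3) by (auto simp: prediction_space_def space_pair_measure)
      show ?case
      proof
        assume nB: "fst \<omega> \<notin> B"
        have u: "d * (1 - \<delta>) < ?g1 (fst \<omega>)" "?g1 (fst \<omega>) < d * (1 + \<delta>)"
          and V: "(1 - \<delta>) * ?r < ?g2 (fst \<omega>)" "?g2 (fst \<omega>) < (1 + \<delta>) * ?r"
          using nB sp unfolding B_def B1_def B2_def B3_def B4_def by (auto simp: not_le)
        note bd = criterion_error_bound[OF d0 _ order_trans[OF \<tau>(2) c] \<delta> u V \<kappa>]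
        have cr: "crit n m (fst \<omega>) = \<tau>\<^sup>2 * ?g1 (fst \<omega>) / d * \<kappa>" unfolding ck using elim(1) by simp
        have cmw: "cond_mspe n D m \<omega> = \<tau>\<^sup>2 * ?g2 (fst \<omega>)" using elim(1,2) by simp
        have msw: "mspe n D m = \<tau>\<^sup>2 * ((real n - 1) / (d - 1))" unfolding ms(2) d_def by (simp add: algebra_simps)
        show "\<bar>crit n m (fst \<omega>) - cond_mspe n D m \<omega>\<bar> \<le> \<epsilon> \<and> \<bar>crit n m (fst \<omega>) - mspe n D m\<bar> \<le> \<epsilon>"
          unfolding cr cmw msw \<epsilon>_def using bd by simp
      qed
    qed
  qed
qed

text \<open>The budget \<open>K * a\<close> is split in halves between the random deviation and the
  bias of order \<open>1 / d\<close>. The union bound works because the tail exponent of every model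
  is at least a multiple of \<open>ln (card \<M> + 1)\<close>. The resulting bound depends on
  \<open>K\<close> and \<open>c\<close> only.\<close>

lemma uniform_tail:
  fixes n :: nat and \<M> :: "model set" and crit and K a c :: real
  assumes n: "2 \<le> n" and \<M>: "finite \<M>" "\<M> \<noteq> {}"
    and sizes: "\<And>m. m \<in> \<M> \<Longrightarrow> finite {j. m j} \<and> msize m < n - 1"
    and a: "a = sqrt (ln (real (card \<M>) + 1) / (real n * (1 - (SUP m\<in>\<M>. real (msize m) / real n)) ^ 3))"
    and c: "expectation (\<lambda>\<omega>. (fst \<omega>)\<^sup>2) \<le> c" "0 < c"
    and K: "65 * c \<le> K" and Ka: "K * a \<le> 4 * c" and crit: "crit \<in> {GCV, S_p, rho_hat_sq}"
    and T: "T \<in> {\<lambda>m \<omega>. \<bar>crit n m (fst \<omega>) - cond_mspe n D m \<omega>\<bar>, \<lambda>m \<omega>. \<bar>crit n m (fst \<omega>) - mspe n D m\<bar>}"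
  shows "emeasure (prediction_space n D) {\<omega> \<in> space (prediction_space n D). \<bar>SUP m\<in>\<M>. T m \<omega>\<bar> > K * a}
    \<le> ennreal (6 * exp (- (K\<^sup>2 / (4096 * c\<^sup>2) - 1) * ln 2))"
proof -
  define r where "r = (SUP m\<in>\<M>. real (msize m) / real n)"
  define L where "L = ln (real (card \<M>) + 1)"
  define e where "e = K\<^sup>2 / (4096 * c\<^sup>2)"
  have K0: "0 < K" using K c by linarith
  have n0: "0 < real n" using n by simp
  have card1: "1 \<le> card \<M>" using \<M> by (simp add: Suc_le_eq card_gt_0_iff)
  then have L2: "ln 2 \<le> L" unfolding L_def by (subst ln_le_cancel_iff) auto
  have L0: "1 / 2 \<le> L" using L2 ln_le_minus_one[of "1 / 2"] by (simp add: ln_div)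
  \<comment> \<open>This is where \<open>K\<close> must exceed \<open>64 * c\<close>, as 4096 is 64
    squared. A factor above 1 beats the number of models in the union bound and also yields the
    probability 1/2 required by \<open>model_tail\<close>.\<close>
  have e1: "1 < e"
  proof -
    have "(64 * c)\<^sup>2 < K\<^sup>2" using K c by (intro power_strict_mono) auto
    then show ?thesis unfolding e_def using c by (simp add: pos_less_divide_eq power_mult_distrib)
  qed
  define dm where "dm m = real n - real (msize m)" for m
  have dm: "2 \<le> dm m" "dm m \<le> real n" "0 < 1 - r" "1 - r \<le> dm m / real n" if "m \<in> \<M>" for m
  proof -
    show d2: "2 \<le> dm m" "dm m \<le> real n" using sizes[OF that] n by (auto simp: dm_def)
    \<comment> \<open>The supremum over finitely many models is attained, so \<open>r < 1\<close>
      follows from the size bound of one model.\<close>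
    have "r \<in> (\<lambda>m. real (msize m) / real n) ` \<M>"
      unfolding r_def using \<M> by (subst cSup_eq_Max) (auto intro!: Max_in)
    then obtain m' where m': "m' \<in> \<M>" "r = real (msize m') / real n" by auto
    have "real (msize m') < real n" using sizes[OF m'(1)] n by linarith
    then show "0 < 1 - r" unfolding m'(2) using n0 by simp
    have "real (msize m) / real n \<le> r" unfolding r_def using \<M> that by (intro cSUP_upper) auto
    then show "1 - r \<le> dm m / real n" using n0 by (simp add: dm_def diff_divide_distrib)
  qed
  \<comment> \<open>Replacing \<open>1 - r\<close> by the larger \<open>dm m / n\<close> makes the
    bound specific to the model: \<open>n * (dm m / n)^3 = dm m^3 / n^2\<close>.\<close>
  have a2: "a\<^sup>2 \<ge> L * (real n)\<^sup>2 / (dm m) ^ 3" if m: "m \<in> \<M>" for m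
  proof -
    note d = dm[OF m]
    have "(1 - r) ^ 3 \<le> (dm m / real n) ^ 3" using d by (intro power_mono) auto
    then have "real n * (1 - r) ^ 3 \<le> real n * (dm m / real n) ^ 3" using n0 by simp
    also have "\<dots> = dm m ^ 3 / (real n)\<^sup>2" using n0 by (simp add: power_divide power2_eq_square power3_eq_cube)
    finally have 1: "real n * (1 - r) ^ 3 \<le> dm m ^ 3 / (real n)\<^sup>2" .
    have 2: "0 < real n * (1 - r) ^ 3" using d n0 by simp
    have "L / (dm m ^ 3 / (real n)\<^sup>2) \<le> L / (real n * (1 - r) ^ 3)"
      using L0 by (intro divide_left_mono[OF 1] mult_pos_pos[OF less_le_trans[OF 2 1] 2]) simp
    moreover have "a\<^sup>2 = L / (real n * (1 - r) ^ 3)"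
      unfolding a L_def[symmetric] r_def[symmetric] using 2 L0 by (intro real_sqrt_pow2) auto
    ultimately show ?thesis by simp
  qed
  have a0: "0 \<le> a"
  proof -
    obtain m where "m \<in> \<M>" using \<M> by auto
    from dm(3)[OF this] show ?thesis
      unfolding a L_def[symmetric] r_def[symmetric] using L0 n0 by simp
  qed
  \<comment> \<open>Chosen so that the deviation term \<open>c * 2 * \<delta> m * n / dm m\<close>
    equals \<open>K * a / 2\<close>. \<open>K * a \<le> 4 * c\<close> gives
    \<open>\<delta> m \<le> 1\<close>, and \<open>4096 = 16 * 256\<close> arises from squaring the 4
    and from the tail exponent.\<close>
  define \<delta> where "\<delta> m = K * a * dm m / (4 * c * real n)" for m
  have \<delta>: "0 \<le> \<delta> m" "\<delta> m \<le> 1" "e * L \<le> dm m * (\<delta> m)\<^sup>2 / 256"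
      "c * (2 * \<delta> m * (real n / dm m) + 6 * (real n / dm m) / dm m) \<le> K * a" if m: "m \<in> \<M>" for m
  proof -
    note d = dm[OF m]
    show "0 \<le> \<delta> m" unfolding \<delta>_def using a0 K0 d c n0 by simp
    have "K * a * dm m \<le> 4 * c * real n" using c d by (intro mult_mono[OF Ka]) auto
    then show "\<delta> m \<le> 1" unfolding \<delta>_def using c n0 by simp
    have dp: "0 < dm m" using d by simp
    have h1: "K\<^sup>2 * (dm m ^ 3 / (4096 * c\<^sup>2 * (real n)\<^sup>2)) * (L * (real n)\<^sup>2 / dm m ^ 3) \<le> K\<^sup>2 * (dm m ^ 3 / (4096 * c\<^sup>2 * (real n)\<^sup>2)) * a\<^sup>2"
      using a2[OF m] dp by (intro mult_left_mono) auto
    have h2: "K\<^sup>2 * (dm m ^ 3 / (4096 * c\<^sup>2 * (real n)\<^sup>2)) * (L * (real n)\<^sup>2 / dm m ^ 3) = e * L"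
      using dp n0 by (simp add: e_def)
    have h3: "K\<^sup>2 * (dm m ^ 3 / (4096 * c\<^sup>2 * (real n)\<^sup>2)) * a\<^sup>2 = dm m * (\<delta> m)\<^sup>2 / 256"
      by (simp add: \<delta>_def power_divide power_mult_distrib power2_eq_square power3_eq_cube mult_ac)
    show "e * L \<le> dm m * (\<delta> m)\<^sup>2 / 256" using h1 unfolding h2 h3 .
    \<comment> \<open>The bias is of smaller order: \<open>1 / 4 \<le> L\<close> and
      \<open>dm m^3 \<le> dm m^4\<close>. The other half of the budget then needs just
      \<open>24 * c \<le> K\<close>.\<close>
    have "(real n / (2 * (dm m)\<^sup>2))\<^sup>2 \<le> a\<^sup>2"
    proof -
      have "(real n / (2 * (dm m)\<^sup>2))\<^sup>2 = (1 / 4) * (real n)\<^sup>2 / dm m ^ 4"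
        by (simp add: power_divide power_mult_distrib power2_eq_square power4_eq_xxxx)
      also have "\<dots> \<le> L * (real n)\<^sup>2 / dm m ^ 3"
        using L0 d n0 by (intro frac_le mult_right_mono power_increasing) auto
      finally show ?thesis using a2[OF m] by simp
    qed
    then have n2: "real n / (2 * (dm m)\<^sup>2) \<le> a" using a0 by (rule power2_le_imp_le)
    have "c * (6 * (real n / dm m) / dm m) = 12 * c * (real n / (2 * (dm m)\<^sup>2))" by (simp add: power2_eq_square)
    also have "\<dots> \<le> 12 * c * a" using n2 c by (intro mult_left_mono) auto
    also have "\<dots> \<le> (K / 2) * a" using K c a0 by (intro mult_right_mono) auto
    finally have 1: "c * (6 * (real n / dm m) / dm m) \<le> K * a / 2" by simp
    have 2: "c * (2 * \<delta> m * (real n / dm m)) = K * a / 2"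
      unfolding \<delta>_def using dp n0 c by simp
    show "c * (2 * \<delta> m * (real n / dm m) + 6 * (real n / dm m) / dm m) \<le> K * a"
      unfolding distrib_left 2 using 1 by simp
  qed
  have expL: "exp (- dm m * (\<delta> m)\<^sup>2 / 256) \<le> exp (- e * L)" if "m \<in> \<M>" for m
    using \<delta>(3)[OF that] by simp
  have half: "exp (- e * L) < 1 / 2"
  proof -
    have "ln 2 \<le> L" by (rule L2)
    also have "L < e * L" using e1 L0 by simp
    finally have "exp (- (e * L)) < exp (- ln 2)" by simp
    also have "exp (- ln 2) = (1 / 2 :: real)" by (simp add: exp_minus)
    finally show ?thesis by simp
  qed
  have "\<exists>B. B \<in> sets (S n) \<and> emeasure (S n) B \<le> ennreal (6 * exp (- e * L)) \<and>
      (AE \<omega> in prediction_space n D. fst \<omega> \<notin> B \<longrightarrow> T m \<omega> \<le> K * a)" if m: "m \<in> \<M>" for m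
  proof -
    have fm: "finite {j. m j}" and k: "msize m + 2 \<le> n" using sizes[OF m] n by auto
    have h: "exp (- (real n - real (msize m)) * (\<delta> m)\<^sup>2 / 256) < 1 / 2"
      using expL[OF m] half unfolding dm_def by linarith
    obtain B where B: "B \<in> sets (S n)" "emeasure (S n) B \<le> ennreal (6 * exp (- dm m * (\<delta> m)\<^sup>2 / 256))"
      and AE: "AE \<omega> in prediction_space n D. fst \<omega> \<notin> B \<longrightarrow>
        \<bar>crit n m (fst \<omega>) - cond_mspe n D m \<omega>\<bar> \<le> c * (2 * \<delta> m * (real n / dm m) + 6 * (real n / dm m) / dm m) \<and>
        \<bar>crit n m (fst \<omega>) - mspe n D m\<bar> \<le> c * (2 * \<delta> m * (real n / dm m) + 6 * (real n / dm m) / dm m)"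
      using model_tail[OF fm k c(1) \<delta>(1,2)[OF m] crit h] unfolding dm_def by blast
    have "emeasure (S n) B \<le> ennreal (6 * exp (- e * L))"
      using B(2) expL[OF m] by (elim order_trans) (intro ennreal_leI, simp)
    moreover have "AE \<omega> in prediction_space n D. fst \<omega> \<notin> B \<longrightarrow> T m \<omega> \<le> K * a"
      using AE by eventually_elim (use T \<delta>(4)[OF m] in auto)
    ultimately show ?thesis using B(1) by blast
  qed
  then have "\<forall>m\<in>\<M>. \<exists>B. B \<in> sets (S n) \<and> emeasure (S n) B \<le> ennreal (6 * exp (- e * L)) \<and>
      (AE \<omega> in prediction_space n D. fst \<omega> \<notin> B \<longrightarrow> T m \<omega> \<le> K * a)" ..
  from bchoice[OF this] obtain B where
    "\<forall>m\<in>\<M>. B m \<in> sets (S n) \<and> emeasure (S n) (B m) \<le> ennreal (6 * exp (- e * L)) \<and>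
      (AE \<omega> in prediction_space n D. fst \<omega> \<notin> B m \<longrightarrow> T m \<omega> \<le> K * a)" ..
  note B = conjunct1[OF bspec[OF this]] conjunct1[OF conjunct2[OF bspec[OF this]]]
    conjunct2[OF conjunct2[OF bspec[OF this]]]
  define U where "U = (\<Union>m\<in>\<M>. B m)"
  have U: "U \<in> sets (S n)" unfolding U_def using \<M>(1) B(1) by blast
  have UP: "fst -` U \<inter> space (S n \<Otimes>\<^sub>M D) \<in> sets (S n \<Otimes>\<^sub>M D)" using U by (rule measurable_sets[OF measurable_fst])
  have T0: "0 \<le> T m \<omega>" for m \<omega> using T by auto
  have "emeasure (prediction_space n D) {\<omega> \<in> space (prediction_space n D). \<bar>SUP m\<in>\<M>. T m \<omega>\<bar> > K * a}
      \<le> emeasure (S n \<Otimes>\<^sub>M D) (fst -` U \<inter> space (S n \<Otimes>\<^sub>M D))"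
    unfolding prediction_space_def
  proof (rule emeasure_mono_AE[OF _ UP])
    \<comment> \<open>The bounds hold almost surely, as \<open>cond_mspe\<close> is determined only
      up to null sets. Finitely many models share one null set.\<close>
    have "AE \<omega> in S n \<Otimes>\<^sub>M D. \<forall>m\<in>\<M>. fst \<omega> \<notin> B m \<longrightarrow> T m \<omega> \<le> K * a"
      using B(3) \<M>(1) unfolding prediction_space_def by (intro AE_finite_allI) auto
    then show "AE \<omega> in S n \<Otimes>\<^sub>M D. \<omega> \<in> {\<omega> \<in> space (S n \<Otimes>\<^sub>M D). K * a < \<bar>SUP m\<in>\<M>. T m \<omega>\<bar>} \<longrightarrow> \<omega> \<in> fst -` U \<inter> space (S n \<Otimes>\<^sub>M D)"
    proof eventually_elim
      case (elim \<omega>)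
      show ?case
      proof (intro impI, rule ccontr)
        assume 1: "\<omega> \<in> {\<omega> \<in> space (S n \<Otimes>\<^sub>M D). K * a < \<bar>SUP m\<in>\<M>. T m \<omega>\<bar>}"
          and 2: "\<omega> \<notin> fst -` U \<inter> space (S n \<Otimes>\<^sub>M D)"
        then have "fst \<omega> \<notin> U" by auto
        then have le: "T m \<omega> \<le> K * a" if "m \<in> \<M>" for m using elim that unfolding U_def by blast
        have "(SUP m\<in>\<M>. T m \<omega>) \<le> K * a" using \<M> le by (intro cSUP_least) auto
        moreover have "0 \<le> (SUP m\<in>\<M>. T m \<omega>)"
        proof -
          obtain m where "m \<in> \<M>" using \<M> by auto
          then have "T m \<omega> \<le> (SUP m\<in>\<M>. T m \<omega>)" using \<M>(1) by (intro cSUP_upper) auto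
          with T0[of m \<omega>] show ?thesis by linarith
        qed
        ultimately show False using 1 by auto
      qed
    qed
  qed
  also have "\<dots> = emeasure (distr (S n \<Otimes>\<^sub>M D) (S n) fst) U"
    using U by (intro emeasure_distr[symmetric]) auto
  also have "distr (S n \<Otimes>\<^sub>M D) (S n) fst = S n" by (rule distr_pair_fst)
  also have "emeasure (S n) U \<le> (\<Sum>m\<in>\<M>. emeasure (S n) (B m))"
    unfolding U_def using B(1) \<M>(1) by (intro emeasure_subadditive_finite) auto
  also have "\<dots> \<le> (\<Sum>m\<in>\<M>. ennreal (6 * exp (- e * L)))"
    by (intro sum_mono B(2))
  also have "\<dots> = ennreal (real (card \<M>) * (6 * exp (- e * L)))"
    by (simp add: ennreal_of_nat_eq_real_of_nat ennreal_mult')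
  \<comment> \<open>The number of models is at most \<open>exp L\<close> and costs one unit of
    \<open>e\<close>. Then \<open>L \<ge> ln 2\<close> removes the dependence on the family of
    models.\<close>
  also have "\<dots> \<le> ennreal (6 * exp (- (e - 1) * ln 2))"
  proof (rule ennreal_leI)
    have "real (card \<M>) \<le> exp L" unfolding L_def by (subst exp_ln) auto
    then have "real (card \<M>) * (6 * exp (- e * L)) \<le> exp L * (6 * exp (- e * L))" by (intro mult_right_mono) auto
    also have "\<dots> = 6 * exp (- (e - 1) * L)" by (simp add: exp_add[symmetric] left_diff_distrib)
    also have "\<dots> \<le> 6 * exp (- (e - 1) * ln 2)"
    proof -
      have "- (e - 1) * L \<le> - (e - 1) * ln 2" using e1 L2 by (intro mult_left_mono_neg) auto
      then show ?thesis by simp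
    qed
    finally show "real (card \<M>) * (6 * exp (- e * L)) \<le> 6 * exp (- (e - 1) * ln 2)" .
  qed
  finally show ?thesis unfolding e_def .
qed

end

section \<open>From tail bounds to uniform stochastic order\<close>

text \<open>Inside the limsup an eventual bound is enough: the sample size from which it holds may
  depend on \<open>K\<close>, but must be the same for all parameters.\<close>

lemma unif_OpI:
  fixes b :: "real \<Rightarrow> real"
  assumes b: "(b \<longlongrightarrow> 0) at_top"
    and bound: "\<And>K. K0 \<le> K \<Longrightarrow> \<forall>\<^sub>F n in sequentially. \<forall>\<theta>\<in>\<Theta>.
      emeasure (P n \<theta>) {\<omega> \<in> space (P n \<theta>). \<bar>T n \<theta> \<omega>\<bar> > K * a n} \<le> ennreal (b K)"
  shows "unif_Op P \<Theta> T a"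
  unfolding unif_Op_def
proof (rule tendsto_sandwich[of "\<lambda>_. 0" _ _ "\<lambda>K. ennreal (b K)"])
  show "\<forall>\<^sub>F K in at_top. limsup (\<lambda>n. SUP \<theta>\<in>\<Theta>. emeasure (P n \<theta>) {\<omega> \<in> space (P n \<theta>). \<bar>T n \<theta> \<omega>\<bar> > K * a n}) \<le> ennreal (b K)"
    using eventually_ge_at_top[of K0]
  proof eventually_elim
    case (elim K)
    show ?case
      using bound[OF elim] by (intro Limsup_bounded) (auto elim!: eventually_mono intro: SUP_least)
  qed
  show "((\<lambda>K. ennreal (b K)) \<longlongrightarrow> 0) at_top"
    using tendsto_ennrealI[OF b] by simp
qed auto

theorem theorem3p4:
  fixes \<M> :: "nat \<Rightarrow> model set" and r a :: "nat \<Rightarrow> real" and c :: real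
    and \<Theta> :: "obs measure set"
  assumes models: "\<And>n. n \<ge> 2 \<Longrightarrow> finite (\<M> n) \<and> \<M> n \<noteq> {}"
    and sizes: "\<And>n m. \<lbrakk>n \<ge> 2; m \<in> \<M> n\<rbrakk> \<Longrightarrow> finite {j. m j} \<and> msize m < n - 1"
    and r_def: "\<And>n. r n = (SUP m\<in>\<M> n. real (msize m) / real n)"
    and a_def: "\<And>n. a n = sqrt (ln (real (card (\<M> n)) + 1) / (real n * (1 - r n) ^ 3))"
    and a_lim: "a \<longlonglongrightarrow> 0"
    and c_pos: "c > 0"
    and params: "\<Theta> = {obs_law M y x | (M :: 'a measure) y x u \<beta> \<sigma> \<Sigma>.
        gaussian_linear_model M y x u \<beta> \<sigma> \<Sigma> \<and> prob_space.variance M y \<le> c}"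
  shows "\<forall>crit \<in> {GCV, S_p, rho_hat_sq}.
     unif_Op prediction_space \<Theta>
       (\<lambda>n D \<omega>. SUP m\<in>\<M> n. \<bar>crit n m (fst \<omega>) - cond_mspe n D m \<omega>\<bar>) a \<and>
     unif_Op prediction_space \<Theta>
       (\<lambda>n D \<omega>. SUP m\<in>\<M> n. \<bar>crit n m (fst \<omega>) - mspe n D m\<bar>) a"
proof
  fix crit assume crit: "crit \<in> {GCV, S_p, rho_hat_sq}"
  define b where "b K = 6 * exp (- (K\<^sup>2 / (4096 * c\<^sup>2) - 1) * ln 2)" for K
  have b: "(b \<longlongrightarrow> 0) at_top"
  proof -
    have "0 < 1 / (4096 * c\<^sup>2)" using c_pos by simp
    then have "((\<lambda>K. 6 * exp (- (K\<^sup>2 * (1 / (4096 * c\<^sup>2)) - 1) * ln 2)) \<longlongrightarrow> 0) at_top"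
      by real_asymp
    then show ?thesis unfolding b_def[abs_def] by simp
  qed
  have \<Theta>: "gauss_obs D \<and> (\<integral>\<omega>. (fst \<omega>)\<^sup>2 \<partial>D) \<le> c" if D: "D \<in> \<Theta>" for D
  proof -
    obtain M :: "'a measure" and y x u \<beta> \<sigma> \<Sigma> where D: "D = obs_law M y x"
      and g: "gaussian_linear_model M y x u \<beta> \<sigma> \<Sigma>" and v: "prob_space.variance M y \<le> c"
      using D unfolding params mem_Collect_eq by (elim exE conjE)
    show ?thesis using gaussian_linear_model.gauss_obs_obs_law[OF g] v unfolding D by simp
  qed
  have main: "\<forall>\<^sub>F n in sequentially. \<forall>D\<in>\<Theta>. \<forall>T\<in>{\<lambda>m \<omega>. \<bar>crit n m (fst \<omega>) - cond_mspe n D m \<omega>\<bar>, \<lambda>m \<omega>. \<bar>crit n m (fst \<omega>) - mspe n D m\<bar>}.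
      emeasure (prediction_space n D) {\<omega> \<in> space (prediction_space n D). \<bar>SUP m\<in>\<M> n. T m \<omega>\<bar> > K * a n} \<le> ennreal (b K)"
    if K: "65 * c \<le> K" for K
  proof -
    \<comment> \<open>The assumption \<open>a_lim\<close> makes \<open>K * a n\<close> drop below
      \<open>4 * c\<close>, from a sample size that depends on \<open>K\<close> but not on the law
      \<open>D\<close>.\<close>
    have "(\<lambda>n. K * a n) \<longlonglongrightarrow> K * 0" by (intro tendsto_intros a_lim)
    then have "\<forall>\<^sub>F n in sequentially. K * a n < 4 * c" using c_pos by (intro order_tendstoD) auto
    with eventually_ge_at_top[of 2] show ?thesis
    proof eventually_elim
      case (elim n)
      show ?case
      proof (intro ballI)
        fix D T
        assume D: "D \<in> \<Theta>" and T: "T \<in> {\<lambda>m \<omega>. \<bar>crit n m (fst \<omega>) - cond_mspe n D m \<omega>\<bar>, \<lambda>m \<omega>. \<bar>crit n m (fst \<omega>) - mspe n D m\<bar>}"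
        interpret gauss_obs D using \<Theta>[OF D] by simp
        show "emeasure (prediction_space n D) {\<omega> \<in> space (prediction_space n D). \<bar>SUP m\<in>\<M> n. T m \<omega>\<bar> > K * a n} \<le> ennreal (b K)"
          unfolding b_def
          using elim models[of n] sizes[of n] \<Theta>[OF D] c_pos K
          by (intro uniform_tail[OF _ _ _ _ _ _ _ _ _ crit T]) (auto simp: a_def r_def)
      qed
    qed
  qed
  show "unif_Op prediction_space \<Theta> (\<lambda>n D \<omega>. SUP m\<in>\<M> n. \<bar>crit n m (fst \<omega>) - cond_mspe n D m \<omega>\<bar>) a \<and>
     unif_Op prediction_space \<Theta> (\<lambda>n D \<omega>. SUP m\<in>\<M> n. \<bar>crit n m (fst \<omega>) - mspe n D m\<bar>) a"
  proof (intro conjI; rule unif_OpI[OF b, of "65 * c"])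
    fix K assume "65 * c \<le> K"
    note ev = main[OF this]
    show "\<forall>\<^sub>F n in sequentially. \<forall>D\<in>\<Theta>. emeasure (prediction_space n D) {\<omega> \<in> space (prediction_space n D).
        \<bar>SUP m\<in>\<M> n. \<bar>crit n m (fst \<omega>) - cond_mspe n D m \<omega>\<bar>\<bar> > K * a n} \<le> ennreal (b K)"
      using ev by eventually_elim simp
    show "\<forall>\<^sub>F n in sequentially. \<forall>D\<in>\<Theta>. emeasure (prediction_space n D) {\<omega> \<in> space (prediction_space n D).
        \<bar>SUP m\<in>\<M> n. \<bar>crit n m (fst \<omega>) - mspe n D m\<bar>\<bar> > K * a n} \<le> ennreal (b K)"
      using ev by eventually_elim simp
  qed
qed

end
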